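(* Let $\mathcal{C}$ be a spherical fusion category over $\mathbb{C}$ and let $X\in\mathcal{O}(\mathcal{C})$ be such that $X^{\otimes n}\cong\mathbbm{1}_{\mathcal{C}}$ for some $n\in\mathbb{Z}_{\geq1}$. If the left or right $\otimes$-action of $X$ on $\mathcal{O}(\mathcal{C})$ has a fixed point (i.e. there exists $Z\in\mathcal{O}(\mathcal{C})$ with $X\otimes Z\cong Z$ or $Z\otimes X\cong Z$), then $\theta_Y$ is an $n$th root of unity for all simple $Y\subset I(X)$.
   Context: $\mathcal{O}(\mathcal{C})$ is the set of isomorphism classes of simple objects of the fusion category $\mathcal{C}$ and $\mathbbm{1}_{\mathcal{C}}$ is its monoidal unit. $\mathcal{Z}(\mathcal{C})$ is the Drinfeld center of $\mathcal{C}$, a modular tensor category with the spherical structure induced from that of $\mathcal{C}$; $\theta_Y$ denotes the twist (a root of unity) of a simple object $Y$ of $\mathcal{Z}(\mathcal{C})$. $F:\mathcal{Z}(\mathcal{C})\to\mathcal{C}$ is the forgetful functor and $I:\mathcal{C}\to\mathcal{Z}(\mathcal{C})$ is its adjoint (induction), so $\mathrm{Hom}_{\mathcal{Z}(\mathcal{C})}(I(X),Y)\cong\mathrm{Hom}_{\mathcal{C}}(X,F(Y))$. *)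

theory Defs
  imports Complex_Main "HOL-Library.FuncSet"
begin

section \<open>Categories\<close>

text \<open>
  Objects form a set \<open>Obj C\<close> and morphisms live in sets \<open>Hom C A B\<close>. Distinct Hom-sets are not
  required to be disjoint: in the Drinfeld center below, the same underlying morphism may be a
  morphism between several pairs of objects. Because of this, a functor acts on a morphism
  together with its source and target.
\<close>

record ('o, 'm) cat =
  Obj :: "'o set"
  Hom :: "'o \<Rightarrow> 'o \<Rightarrow> 'm set"
  ide :: "'o \<Rightarrow> 'm"
  Comp :: "'m \<Rightarrow> 'm \<Rightarrow> 'm"  (infixr "\<cdot>\<index>" 55)

locale category =
  fixes C :: "('o, 'm, 'z) cat_scheme" (structure)
  assumes ide_in: "A \<in> Obj C \<Longrightarrow> ide C A \<in> Hom C A A"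
    and comp_in: "\<lbrakk>A \<in> Obj C; B \<in> Obj C; D \<in> Obj C; f \<in> Hom C A B; g \<in> Hom C B D\<rbrakk>
      \<Longrightarrow> g \<cdot> f \<in> Hom C A D"
    and ide_left: "\<lbrakk>A \<in> Obj C; B \<in> Obj C; f \<in> Hom C A B\<rbrakk> \<Longrightarrow> ide C B \<cdot> f = f"
    and ide_right: "\<lbrakk>A \<in> Obj C; B \<in> Obj C; f \<in> Hom C A B\<rbrakk> \<Longrightarrow> f \<cdot> ide C A = f"
    and comp_assoc: "\<lbrakk>A \<in> Obj C; B \<in> Obj C; D \<in> Obj C; E \<in> Obj C;
      f \<in> Hom C A B; g \<in> Hom C B D; h \<in> Hom C D E\<rbrakk> \<Longrightarrow> (h \<cdot> g) \<cdot> f = h \<cdot> (g \<cdot> f)"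

context
  fixes C :: "('o, 'm, 'z) cat_scheme" (structure)
begin

definition inverse_arrows :: "'o \<Rightarrow> 'o \<Rightarrow> 'm \<Rightarrow> 'm \<Rightarrow> bool" where
  "inverse_arrows A B f g \<longleftrightarrow>
     f \<in> Hom C A B \<and> g \<in> Hom C B A \<and> g \<cdot> f = ide C A \<and> f \<cdot> g = ide C B"

definition iso_arrow :: "'o \<Rightarrow> 'o \<Rightarrow> 'm \<Rightarrow> bool" where
  "iso_arrow A B f \<longleftrightarrow> (\<exists>g. inverse_arrows A B f g)"

definition inv_arrow :: "'o \<Rightarrow> 'o \<Rightarrow> 'm \<Rightarrow> 'm" where
  "inv_arrow A B f = (THE g. inverse_arrows A B f g)"

definition isomorphic :: "'o \<Rightarrow> 'o \<Rightarrow> bool" where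
  "isomorphic A B \<longleftrightarrow> A \<in> Obj C \<and> B \<in> Obj C \<and> (\<exists>f. iso_arrow A B f)"

definition mono_arrow :: "'o \<Rightarrow> 'o \<Rightarrow> 'm \<Rightarrow> bool" where
  "mono_arrow A B f \<longleftrightarrow> f \<in> Hom C A B \<and>
     (\<forall>D\<in>Obj C. \<forall>g\<in>Hom C D A. \<forall>h\<in>Hom C D A. f \<cdot> g = f \<cdot> h \<longrightarrow> g = h)"

definition epi_arrow :: "'o \<Rightarrow> 'o \<Rightarrow> 'm \<Rightarrow> bool" where
  "epi_arrow A B f \<longleftrightarrow> f \<in> Hom C A B \<and>
     (\<forall>D\<in>Obj C. \<forall>g\<in>Hom C B D. \<forall>h\<in>Hom C B D. g \<cdot> f = h \<cdot> f \<longrightarrow> g = h)"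

definition subobject :: "'o \<Rightarrow> 'o \<Rightarrow> bool" where
  "subobject A B \<longleftrightarrow> A \<in> Obj C \<and> B \<in> Obj C \<and> (\<exists>f. mono_arrow A B f)"

end

locale cat_functor =
  S: category S + T: category T
  for S :: "('a, 'm, 'y) cat_scheme" and T :: "('b, 'n, 'z) cat_scheme" +
  fixes Fo :: "'a \<Rightarrow> 'b" and Fm :: "'a \<Rightarrow> 'a \<Rightarrow> 'm \<Rightarrow> 'n"
  assumes obj: "A \<in> Obj S \<Longrightarrow> Fo A \<in> Obj T"
    and hom: "\<lbrakk>A \<in> Obj S; B \<in> Obj S; f \<in> Hom S A B\<rbrakk> \<Longrightarrow> Fm A B f \<in> Hom T (Fo A) (Fo B)"
    and ide: "A \<in> Obj S \<Longrightarrow> Fm A A (ide S A) = ide T (Fo A)"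
    and comp: "\<lbrakk>A \<in> Obj S; B \<in> Obj S; D \<in> Obj S; f \<in> Hom S A B; g \<in> Hom S B D\<rbrakk>
      \<Longrightarrow> Fm A D (Comp S g f) = Comp T (Fm B D g) (Fm A B f)"

text \<open>
  \<open>L\<close> is left adjoint to \<open>R\<close>, where \<open>R\<close> goes from \<open>D\<close> to \<open>C\<close>, through bijections
  \<open>\<Phi> X Y\<close> from \<open>Hom D (L X) Y\<close> to \<open>Hom C X (R Y)\<close> that are natural in \<open>X\<close> and \<open>Y\<close>.
\<close>

locale adjunction =
  L: cat_functor C D Lo Lm + R: cat_functor D C Ro Rm
  for C :: "('a, 'm, 'y) cat_scheme" and D :: "('b, 'n, 'z) cat_scheme"
    and Lo Lm Ro Rm +
  fixes \<Phi> :: "'a \<Rightarrow> 'b \<Rightarrow> 'n \<Rightarrow> 'm"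
  assumes bij: "\<lbrakk>X \<in> Obj C; Y \<in> Obj D\<rbrakk>
      \<Longrightarrow> bij_betw (\<Phi> X Y) (Hom D (Lo X) Y) (Hom C X (Ro Y))"
    and natural_left: "\<lbrakk>X \<in> Obj C; X' \<in> Obj C; Y \<in> Obj D; f \<in> Hom C X' X; h \<in> Hom D (Lo X) Y\<rbrakk>
      \<Longrightarrow> \<Phi> X' Y (Comp D h (Lm X' X f)) = Comp C (\<Phi> X Y h) f"
    and natural_right: "\<lbrakk>X \<in> Obj C; Y \<in> Obj D; Y' \<in> Obj D; g \<in> Hom D Y Y'; h \<in> Hom D (Lo X) Y\<rbrakk>
      \<Longrightarrow> \<Phi> X Y' (Comp D g h) = Comp C (Rm Y Y' g) (\<Phi> X Y h)"


section \<open>Linear, abelian and semisimple categories\<close>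

text \<open>
  All Hom-spaces are subspaces of one ambient complex vector space \<open>'m\<close>, so that they share the
  zero vector. This is no loss of generality: the direct sum of all
  Hom-spaces of a linear category can serve as ambient space.
\<close>

record ('o, 'm) lin_cat = "('o, 'm) cat" +
  scale :: "complex \<Rightarrow> 'm \<Rightarrow> 'm"

locale linear_category = category C
  for C :: "('o, 'm::ab_group_add, 'z) lin_cat_scheme" (structure) +
  assumes vector_space: "vector_space (scale C)"
    and hom_subspace: "\<lbrakk>A \<in> Obj C; B \<in> Obj C\<rbrakk> \<Longrightarrow> module.subspace (scale C) (Hom C A B)"
    and comp_add_left: "\<lbrakk>A \<in> Obj C; B \<in> Obj C; D \<in> Obj C;
      f \<in> Hom C A B; g \<in> Hom C B D; h \<in> Hom C B D\<rbrakk> \<Longrightarrow> (g + h) \<cdot> f = (g \<cdot> f) + (h \<cdot> f)"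
    and comp_add_right: "\<lbrakk>A \<in> Obj C; B \<in> Obj C; D \<in> Obj C;
      f \<in> Hom C A B; g \<in> Hom C A B; h \<in> Hom C B D\<rbrakk> \<Longrightarrow> h \<cdot> (f + g) = (h \<cdot> f) + (h \<cdot> g)"
    and comp_scale_left: "\<lbrakk>A \<in> Obj C; B \<in> Obj C; D \<in> Obj C; f \<in> Hom C A B; g \<in> Hom C B D\<rbrakk>
      \<Longrightarrow> scale C c g \<cdot> f = scale C c (g \<cdot> f)"
    and comp_scale_right: "\<lbrakk>A \<in> Obj C; B \<in> Obj C; D \<in> Obj C; f \<in> Hom C A B; g \<in> Hom C B D\<rbrakk>
      \<Longrightarrow> g \<cdot> scale C c f = scale C c (g \<cdot> f)"

context
  fixes C :: "('o, 'm::ab_group_add, 'z) lin_cat_scheme" (structure)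
begin

definition zero_object :: "'o \<Rightarrow> bool" where
  "zero_object Z \<longleftrightarrow> Z \<in> Obj C \<and> (\<forall>A\<in>Obj C. Hom C A Z = {0} \<and> Hom C Z A = {0})"

definition simple_object :: "'o \<Rightarrow> bool" where
  "simple_object S \<longleftrightarrow> S \<in> Obj C \<and> \<not> zero_object S \<and>
     (\<forall>A\<in>Obj C. \<forall>f. mono_arrow C A S f \<longrightarrow> zero_object A \<or> iso_arrow C A S f)"

text \<open>\<open>A\<close> is the direct sum of \<open>S 0, \<dots>, S (n - 1)\<close>; the case \<open>n = 0\<close> says that \<open>A\<close> is a zero object.\<close>

definition direct_sum :: "nat \<Rightarrow> (nat \<Rightarrow> 'o) \<Rightarrow> 'o \<Rightarrow> (nat \<Rightarrow> 'm) \<Rightarrow> (nat \<Rightarrow> 'm) \<Rightarrow> bool" where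
  "direct_sum n S A i p \<longleftrightarrow>
     A \<in> Obj C \<and>
     (\<forall>k<n. S k \<in> Obj C \<and> i k \<in> Hom C (S k) A \<and> p k \<in> Hom C A (S k)) \<and>
     (\<forall>k<n. \<forall>l<n. p k \<cdot> i l = (if k = l then ide C (S k) else 0)) \<and>
     (\<Sum>k<n. i k \<cdot> p k) = ide C A"

definition is_kernel :: "'o \<Rightarrow> 'o \<Rightarrow> 'm \<Rightarrow> 'o \<Rightarrow> 'm \<Rightarrow> bool" where
  "is_kernel A B f K k \<longleftrightarrow>
     K \<in> Obj C \<and> k \<in> Hom C K A \<and> f \<cdot> k = 0 \<and>
     (\<forall>D\<in>Obj C. \<forall>g\<in>Hom C D A. f \<cdot> g = 0 \<longrightarrow> (\<exists>!h. h \<in> Hom C D K \<and> k \<cdot> h = g))"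

definition is_cokernel :: "'o \<Rightarrow> 'o \<Rightarrow> 'm \<Rightarrow> 'o \<Rightarrow> 'm \<Rightarrow> bool" where
  "is_cokernel A B f Q q \<longleftrightarrow>
     Q \<in> Obj C \<and> q \<in> Hom C B Q \<and> q \<cdot> f = 0 \<and>
     (\<forall>D\<in>Obj C. \<forall>g\<in>Hom C B D. g \<cdot> f = 0 \<longrightarrow> (\<exists>!h. h \<in> Hom C Q D \<and> h \<cdot> q = g))"

end

locale abelian_category = linear_category +
  assumes direct_sums:
      "(\<And>k. k < n \<Longrightarrow> S k \<in> Obj C) \<Longrightarrow> \<exists>A i p. direct_sum C n S A i p"
    and kernels: "\<lbrakk>A \<in> Obj C; B \<in> Obj C; f \<in> Hom C A B\<rbrakk> \<Longrightarrow> \<exists>K k. is_kernel C A B f K k"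
    and cokernels: "\<lbrakk>A \<in> Obj C; B \<in> Obj C; f \<in> Hom C A B\<rbrakk> \<Longrightarrow> \<exists>Q q. is_cokernel C A B f Q q"
    and mono_is_kernel: "\<lbrakk>A \<in> Obj C; B \<in> Obj C; mono_arrow C A B f\<rbrakk>
      \<Longrightarrow> \<exists>D\<in>Obj C. \<exists>g\<in>Hom C B D. is_kernel C B D g A f"
    and epi_is_cokernel: "\<lbrakk>A \<in> Obj C; B \<in> Obj C; epi_arrow C A B f\<rbrakk>
      \<Longrightarrow> \<exists>D\<in>Obj C. \<exists>g\<in>Hom C D A. is_cokernel C D A g B f"

locale finite_semisimple_category = abelian_category +
  assumes semisimple: "A \<in> Obj C \<Longrightarrow>
      \<exists>n S i p. direct_sum C n S A i p \<and> (\<forall>k<n. simple_object C (S k))"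
    and finitely_many_simples:
      "\<exists>R. finite R \<and> (\<forall>S. simple_object C S \<longrightarrow> (\<exists>T\<in>R. isomorphic C S T))"
    and finite_dimensional_hom: "\<lbrakk>A \<in> Obj C; B \<in> Obj C\<rbrakk>
      \<Longrightarrow> \<exists>U. finite U \<and> module.span (scale C) U = Hom C A B"


section \<open>Monoidal categories with duals\<close>

text \<open>
  \<open>\<otimes>\<close> is the tensor product of objects and \<open>\<odot>\<close> that of morphisms. The primed fields are the
  inverses of the constraints
  \<open>assoc A B D : (A \<otimes> B) \<otimes> D \<rightarrow> A \<otimes> (B \<otimes> D)\<close>, \<open>lunit A : \<one> \<otimes> A \<rightarrow> A\<close> and \<open>runit A : A \<otimes> \<one> \<rightarrow> A\<close>.
\<close>

record ('o, 'm) monoidal_cat = "('o, 'm) lin_cat" +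
  tensor :: "'o \<Rightarrow> 'o \<Rightarrow> 'o"  (infixl "\<otimes>\<index>" 70)
  tensor_arrow :: "'m \<Rightarrow> 'm \<Rightarrow> 'm"  (infixl "\<odot>\<index>" 70)
  unit_obj :: 'o  ("\<one>\<index>")
  assoc :: "'o \<Rightarrow> 'o \<Rightarrow> 'o \<Rightarrow> 'm"
  assoc' :: "'o \<Rightarrow> 'o \<Rightarrow> 'o \<Rightarrow> 'm"
  lunit :: "'o \<Rightarrow> 'm"
  lunit' :: "'o \<Rightarrow> 'm"
  runit :: "'o \<Rightarrow> 'm"
  runit' :: "'o \<Rightarrow> 'm"

locale monoidal_category = category C
  for C :: "('o, 'm, 'z) monoidal_cat_scheme" (structure) +
  assumes unit_obj: "\<one> \<in> Obj C"
    and tensor_obj: "\<lbrakk>A \<in> Obj C; B \<in> Obj C\<rbrakk> \<Longrightarrow> A \<otimes> B \<in> Obj C"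
    and tensor_hom: "\<lbrakk>A \<in> Obj C; B \<in> Obj C; A' \<in> Obj C; B' \<in> Obj C;
      f \<in> Hom C A B; f' \<in> Hom C A' B'\<rbrakk> \<Longrightarrow> f \<odot> f' \<in> Hom C (A \<otimes> A') (B \<otimes> B')"
    and tensor_ide: "\<lbrakk>A \<in> Obj C; B \<in> Obj C\<rbrakk> \<Longrightarrow> ide C A \<odot> ide C B = ide C (A \<otimes> B)"
    and interchange: "\<lbrakk>A \<in> Obj C; B \<in> Obj C; D \<in> Obj C; A' \<in> Obj C; B' \<in> Obj C; D' \<in> Obj C;
      f \<in> Hom C A B; g \<in> Hom C B D; f' \<in> Hom C A' B'; g' \<in> Hom C B' D'\<rbrakk>
      \<Longrightarrow> (g \<cdot> f) \<odot> (g' \<cdot> f') = (g \<odot> g') \<cdot> (f \<odot> f')"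
    and assoc_inverse: "\<lbrakk>A \<in> Obj C; B \<in> Obj C; D \<in> Obj C\<rbrakk>
      \<Longrightarrow> inverse_arrows C ((A \<otimes> B) \<otimes> D) (A \<otimes> (B \<otimes> D)) (assoc C A B D) (assoc' C A B D)"
    and lunit_inverse: "A \<in> Obj C \<Longrightarrow> inverse_arrows C (\<one> \<otimes> A) A (lunit C A) (lunit' C A)"
    and runit_inverse: "A \<in> Obj C \<Longrightarrow> inverse_arrows C (A \<otimes> \<one>) A (runit C A) (runit' C A)"
    and assoc_natural: "\<lbrakk>A \<in> Obj C; B \<in> Obj C; D \<in> Obj C; A' \<in> Obj C; B' \<in> Obj C; D' \<in> Obj C;
      f \<in> Hom C A A'; g \<in> Hom C B B'; h \<in> Hom C D D'\<rbrakk>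
      \<Longrightarrow> assoc C A' B' D' \<cdot> ((f \<odot> g) \<odot> h) = (f \<odot> (g \<odot> h)) \<cdot> assoc C A B D"
    and lunit_natural: "\<lbrakk>A \<in> Obj C; B \<in> Obj C; f \<in> Hom C A B\<rbrakk>
      \<Longrightarrow> lunit C B \<cdot> (ide C \<one> \<odot> f) = f \<cdot> lunit C A"
    and runit_natural: "\<lbrakk>A \<in> Obj C; B \<in> Obj C; f \<in> Hom C A B\<rbrakk>
      \<Longrightarrow> runit C B \<cdot> (f \<odot> ide C \<one>) = f \<cdot> runit C A"
    and pentagon: "\<lbrakk>A \<in> Obj C; B \<in> Obj C; D \<in> Obj C; E \<in> Obj C\<rbrakk>
      \<Longrightarrow> (ide C A \<odot> assoc C B D E) \<cdot> assoc C A (B \<otimes> D) E \<cdot> (assoc C A B D \<odot> ide C E)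
        = assoc C A B (D \<otimes> E) \<cdot> assoc C (A \<otimes> B) D E"
    and triangle: "\<lbrakk>A \<in> Obj C; B \<in> Obj C\<rbrakk>
      \<Longrightarrow> (ide C A \<odot> lunit C B) \<cdot> assoc C A \<one> B = runit C A \<odot> ide C B"

primrec tensor_power :: "('o, 'm, 'z) monoidal_cat_scheme \<Rightarrow> 'o \<Rightarrow> nat \<Rightarrow> 'o" where
  "tensor_power C X 0 = unit_obj C"
| "tensor_power C X (Suc n) = tensor C X (tensor_power C X n)"

text \<open>
  A choice of left duals \<open>dual X\<close> with \<open>ev X : dual X \<otimes> X \<rightarrow> \<one>\<close> and \<open>coev X : \<one> \<rightarrow> X \<otimes> dual X\<close>,
  and the components \<open>piv X : X \<rightarrow> dual (dual X)\<close> of a pivotal structure.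
\<close>

record ('o, 'm) pivotal_cat = "('o, 'm) monoidal_cat" +
  dual :: "'o \<Rightarrow> 'o"
  ev :: "'o \<Rightarrow> 'm"
  coev :: "'o \<Rightarrow> 'm"
  piv :: "'o \<Rightarrow> 'm"

definition is_left_dual ::
    "('o, 'm, 'z) monoidal_cat_scheme \<Rightarrow> 'o \<Rightarrow> 'o \<Rightarrow> 'm \<Rightarrow> 'm \<Rightarrow> bool" where
  "is_left_dual C X X' e c \<longleftrightarrow>
     X' \<in> Obj C \<and> e \<in> Hom C (X' \<otimes>\<^bsub>C\<^esub> X) \<one>\<^bsub>C\<^esub> \<and> c \<in> Hom C \<one>\<^bsub>C\<^esub> (X \<otimes>\<^bsub>C\<^esub> X') \<and>
     runit C X \<cdot>\<^bsub>C\<^esub> (ide C X \<odot>\<^bsub>C\<^esub> e) \<cdot>\<^bsub>C\<^esub> assoc C X X' X \<cdot>\<^bsub>C\<^esub> (c \<odot>\<^bsub>C\<^esub> ide C X) = lunit C X \<and>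
     lunit C X' \<cdot>\<^bsub>C\<^esub> (e \<odot>\<^bsub>C\<^esub> ide C X') \<cdot>\<^bsub>C\<^esub> assoc' C X' X X' \<cdot>\<^bsub>C\<^esub> (ide C X' \<odot>\<^bsub>C\<^esub> c) = runit C X'"

locale rigid_category = monoidal_category C
  for C :: "('o, 'm, 'z) pivotal_cat_scheme" (structure) +
  assumes left_dual: "X \<in> Obj C \<Longrightarrow> is_left_dual C X (dual C X) (ev C X) (coev C X)"
    and right_dual: "X \<in> Obj C \<Longrightarrow> \<exists>X' \<in> Obj C. \<exists>e c. is_left_dual C X' X e c"

context
  fixes C :: "('o, 'm, 'z) pivotal_cat_scheme" (structure)
begin

text \<open>The morphism \<open>B \<rightarrow> dual A\<close> that corresponds to a pairing \<open>e : B \<otimes> A \<rightarrow> \<one>\<close>.\<close>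

definition curry_pairing :: "'o \<Rightarrow> 'o \<Rightarrow> 'm \<Rightarrow> 'm" where
  "curry_pairing B A e =
     lunit C (dual C A) \<cdot> (e \<odot> ide C (dual C A)) \<cdot> assoc' C B A (dual C A) \<cdot>
     (ide C B \<odot> coev C A) \<cdot> runit' C B"

text \<open>The dual \<open>dual Y \<rightarrow> dual X\<close> of \<open>f : X \<rightarrow> Y\<close>.\<close>

definition dual_arrow :: "'o \<Rightarrow> 'o \<Rightarrow> 'm \<Rightarrow> 'm" where
  "dual_arrow X Y f = curry_pairing (dual C Y) X (ev C Y \<cdot> (ide C (dual C Y) \<odot> f))"

text \<open>The canonical isomorphism \<open>dual Y \<otimes> dual X \<rightarrow> dual (X \<otimes> Y)\<close>.\<close>

definition dual_tensor :: "'o \<Rightarrow> 'o \<Rightarrow> 'm" where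
  "dual_tensor X Y = curry_pairing (dual C Y \<otimes> dual C X) (X \<otimes> Y)
     (ev C Y \<cdot> (ide C (dual C Y) \<odot> lunit C Y) \<cdot>
      (ide C (dual C Y) \<odot> (ev C X \<odot> ide C Y)) \<cdot>
      (ide C (dual C Y) \<odot> assoc' C (dual C X) X Y) \<cdot>
      assoc C (dual C Y) (dual C X) (X \<otimes> Y))"

text \<open>The quantum dimension, as an endomorphism of \<open>\<one>\<close>.\<close>

definition qdim :: "'o \<Rightarrow> 'm" where
  "qdim X = ev C (dual C X) \<cdot> (piv C X \<odot> ide C (dual C X)) \<cdot> coev C X"

end

text \<open>
  A pivotal structure is a monoidal natural isomorphism from the identity functor to the double
  dual functor. The monoidal structure of the latter is the composite of \<open>dual_tensor\<close> for the
  duals with the inverse of \<open>dual_arrow\<close> of \<open>dual_tensor\<close>; that inverse has been moved to the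
  other side of the equation.
\<close>

locale pivotal_category = rigid_category +
  assumes piv_iso: "X \<in> Obj C \<Longrightarrow> iso_arrow C X (dual C (dual C X)) (piv C X)"
    and piv_natural: "\<lbrakk>X \<in> Obj C; Y \<in> Obj C; f \<in> Hom C X Y\<rbrakk>
      \<Longrightarrow> dual_arrow C (dual C Y) (dual C X) (dual_arrow C X Y f) \<cdot> piv C X = piv C Y \<cdot> f"
    and piv_tensor: "\<lbrakk>X \<in> Obj C; Y \<in> Obj C\<rbrakk>
      \<Longrightarrow> dual_arrow C (dual C Y \<otimes> dual C X) (dual C (X \<otimes> Y)) (dual_tensor C X Y) \<cdot> piv C (X \<otimes> Y)
        = dual_tensor C (dual C Y) (dual C X) \<cdot> (piv C X \<odot> piv C Y)"

locale spherical_category = pivotal_category +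
  assumes spherical: "X \<in> Obj C \<Longrightarrow> qdim C X = qdim C (dual C X)"

locale spherical_fusion_category =
  finite_semisimple_category C + spherical_category C
  for C :: "('o, 'm::ab_group_add, 'z) pivotal_cat_scheme" (structure) +
  assumes tensor_add_left: "\<lbrakk>A \<in> Obj C; B \<in> Obj C; A' \<in> Obj C; B' \<in> Obj C;
      f \<in> Hom C A B; g \<in> Hom C A B; h \<in> Hom C A' B'\<rbrakk> \<Longrightarrow> (f + g) \<odot> h = (f \<odot> h) + (g \<odot> h)"
    and tensor_add_right: "\<lbrakk>A \<in> Obj C; B \<in> Obj C; A' \<in> Obj C; B' \<in> Obj C;
      f \<in> Hom C A B; g \<in> Hom C A' B'; h \<in> Hom C A' B'\<rbrakk> \<Longrightarrow> f \<odot> (g + h) = (f \<odot> g) + (f \<odot> h)"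
    and tensor_scale_left: "\<lbrakk>A \<in> Obj C; B \<in> Obj C; A' \<in> Obj C; B' \<in> Obj C;
      f \<in> Hom C A B; g \<in> Hom C A' B'\<rbrakk> \<Longrightarrow> scale C c f \<odot> g = scale C c (f \<odot> g)"
    and tensor_scale_right: "\<lbrakk>A \<in> Obj C; B \<in> Obj C; A' \<in> Obj C; B' \<in> Obj C;
      f \<in> Hom C A B; g \<in> Hom C A' B'\<rbrakk> \<Longrightarrow> f \<odot> scale C c g = scale C c (f \<odot> g)"
    and unit_simple: "simple_object C \<one>"


section \<open>Braidings and twists\<close>

record ('o, 'm) braided_pivotal_cat = "('o, 'm) pivotal_cat" +
  braid :: "'o \<Rightarrow> 'o \<Rightarrow> 'm"

context
  fixes B :: "('o, 'm, 'z) braided_pivotal_cat_scheme" (structure)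
begin

text \<open>
  The twist \<open>Y \<rightarrow> Y\<close> determined by the braiding and the pivotal structure: the partial trace, over
  the second tensor factor, of the self-braiding \<open>braid Y Y : Y \<otimes> Y \<rightarrow> Y \<otimes> Y\<close>.
\<close>

definition twist_arrow :: "'o \<Rightarrow> 'm" where
  "twist_arrow Y =
     runit B Y \<cdot> (ide B Y \<odot> ev B (dual B Y)) \<cdot> (ide B Y \<odot> (piv B Y \<odot> ide B (dual B Y))) \<cdot>
     assoc B Y Y (dual B Y) \<cdot> (braid B Y Y \<odot> ide B (dual B Y)) \<cdot> assoc' B Y Y (dual B Y) \<cdot>
     (ide B Y \<odot> coev B Y) \<cdot> runit' B Y"

text \<open>The scalar by which the twist acts on a simple object.\<close>

definition twist :: "'o \<Rightarrow> complex" where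
  "twist Y = (THE t. twist_arrow Y = scale B t (ide B Y))"

end


section \<open>The Drinfeld center\<close>

context
  fixes C :: "('o, 'm, 'z) pivotal_cat_scheme" (structure)
begin

definition half_braiding :: "'o \<Rightarrow> ('o \<Rightarrow> 'm) \<Rightarrow> bool" where
  "half_braiding X \<gamma> \<longleftrightarrow>
     X \<in> Obj C \<and> \<gamma> \<in> extensional (Obj C) \<and>
     (\<forall>A\<in>Obj C. iso_arrow C (X \<otimes> A) (A \<otimes> X) (\<gamma> A)) \<and>
     (\<forall>A\<in>Obj C. \<forall>B\<in>Obj C. \<forall>f\<in>Hom C A B. \<gamma> B \<cdot> (ide C X \<odot> f) = (f \<odot> ide C X) \<cdot> \<gamma> A) \<and>
     (\<forall>A\<in>Obj C. \<forall>B\<in>Obj C. \<gamma> (A \<otimes> B) =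
        assoc' C A B X \<cdot> (ide C A \<odot> \<gamma> B) \<cdot> assoc C A X B \<cdot> (\<gamma> A \<odot> ide C B) \<cdot> assoc' C X A B)"

definition unit_half_braiding :: "'o \<Rightarrow> 'm" where
  "unit_half_braiding = (\<lambda>A\<in>Obj C. runit' C A \<cdot> lunit C A)"

definition tensor_half_braiding :: "'o \<Rightarrow> ('o \<Rightarrow> 'm) \<Rightarrow> 'o \<Rightarrow> ('o \<Rightarrow> 'm) \<Rightarrow> 'o \<Rightarrow> 'm" where
  "tensor_half_braiding X \<gamma> Y \<delta> = (\<lambda>A\<in>Obj C.
     assoc C A X Y \<cdot> (\<gamma> A \<odot> ide C Y) \<cdot> assoc' C X A Y \<cdot> (ide C X \<odot> \<delta> A) \<cdot> assoc C X Y A)"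

text \<open>
  The half-braiding \<open>dual X \<otimes> A \<rightarrow> A \<otimes> dual X\<close> is obtained from
  \<open>dual X \<otimes> A \<rightarrow> ((dual X \<otimes> A) \<otimes> X) \<otimes> dual X \<rightarrow> ((dual X \<otimes> X) \<otimes> A) \<otimes> dual X \<rightarrow> A \<otimes> dual X\<close>,
  with the inverse of \<open>\<gamma> A\<close> in the middle.
\<close>

definition dual_half_braiding :: "'o \<Rightarrow> ('o \<Rightarrow> 'm) \<Rightarrow> 'o \<Rightarrow> 'm" where
  "dual_half_braiding X \<gamma> = (\<lambda>A\<in>Obj C.
     (lunit C A \<odot> ide C (dual C X)) \<cdot>
     ((ev C X \<odot> ide C A) \<odot> ide C (dual C X)) \<cdot>
     (assoc' C (dual C X) X A \<odot> ide C (dual C X)) \<cdot>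
     ((ide C (dual C X) \<odot> inv_arrow C (X \<otimes> A) (A \<otimes> X) (\<gamma> A)) \<odot> ide C (dual C X)) \<cdot>
     (assoc C (dual C X) A X \<odot> ide C (dual C X)) \<cdot>
     assoc' C (dual C X \<otimes> A) X (dual C X) \<cdot>
     (ide C (dual C X \<otimes> A) \<odot> coev C X) \<cdot>
     runit' C (dual C X \<otimes> A))"

text \<open>
  Composition, linear structure, constraints, evaluations, coevaluations and pivotal structure are
  those of \<open>C\<close>; the braiding of \<open>(X, \<gamma>)\<close> with \<open>(Y, \<delta>)\<close> is \<open>\<gamma> Y : X \<otimes> Y \<rightarrow> Y \<otimes> X\<close>.
\<close>

definition drinfeld_center :: "('o \<times> ('o \<Rightarrow> 'm), 'm) braided_pivotal_cat" where
  "drinfeld_center = \<lparr>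
     Obj = {(X, \<gamma>). half_braiding X \<gamma>},
     Hom = (\<lambda>(X, \<gamma>) (Y, \<delta>).
       {f \<in> Hom C X Y. \<forall>A\<in>Obj C. \<delta> A \<cdot> (f \<odot> ide C A) = (ide C A \<odot> f) \<cdot> \<gamma> A}),
     ide = (\<lambda>(X, \<gamma>). ide C X),
     Comp = Comp C,
     scale = scale C,
     tensor = (\<lambda>(X, \<gamma>) (Y, \<delta>). (X \<otimes> Y, tensor_half_braiding X \<gamma> Y \<delta>)),
     tensor_arrow = tensor_arrow C,
     unit_obj = (\<one>, unit_half_braiding),
     assoc = (\<lambda>(X, _) (Y, _) (Z, _). assoc C X Y Z),
     assoc' = (\<lambda>(X, _) (Y, _) (Z, _). assoc' C X Y Z),
     lunit = (\<lambda>(X, _). lunit C X),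
     lunit' = (\<lambda>(X, _). lunit' C X),
     runit = (\<lambda>(X, _). runit C X),
     runit' = (\<lambda>(X, _). runit' C X),
     dual = (\<lambda>(X, \<gamma>). (dual C X, dual_half_braiding X \<gamma>)),
     ev = (\<lambda>(X, _). ev C X),
     coev = (\<lambda>(X, _). coev C X),
     piv = (\<lambda>(X, _). piv C X),
     braid = (\<lambda>(X, \<gamma>) (Y, _). \<gamma> Y)\<rparr>"

end

definition forget_obj :: "'o \<times> ('o \<Rightarrow> 'm) \<Rightarrow> 'o" where
  "forget_obj = fst"

definition forget_arrow :: "'o \<times> ('o \<Rightarrow> 'm) \<Rightarrow> 'o \<times> ('o \<Rightarrow> 'm) \<Rightarrow> 'm \<Rightarrow> 'm" where
  "forget_arrow Y Y' f = f"

end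

theory Submission
  imports Defs "HOL-Computational_Algebra.Fundamental_Theorem_Algebra"
begin

text \<open>
  Why the theorem holds. Let \<open>(W, \<gamma>)\<close> be an object of the center with twist \<open>\<theta>\<close>, and let \<open>p : W \<rightarrow> X\<close> be
  an arrow of \<open>C\<close>. The twist is the partial trace of \<open>\<gamma> W\<close>, and \<open>p\<close> can be slid around the loop, so
  \<open>p \<theta>\<close> is the trace over \<open>X\<close> of \<open>(X \<otimes> p) \<gamma>\<^sub>X : W \<otimes> X \<rightarrow> X \<otimes> X\<close> (\<open>twist_as_trace\<close>). As \<open>X\<close> is invertible,
  this arrow is \<open>s \<otimes> X\<close> for some \<open>s : W \<rightarrow> X\<close> (\<open>strand_removable\<close>), and taking the trace gives
  \<open>p \<theta> = d s\<close> with \<open>d\<close> the dimension of \<open>X\<close>. Iterating, \<open>(X\<^sup>n \<otimes> p) \<gamma>\<close> on \<open>X\<^sup>n\<close> is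
  \<open>d\<^sup>-\<^sup>n p \<theta>\<^sup>n \<otimes> X\<^sup>n\<close>, where \<open>d\<^sup>n = 1\<close> because the dimension is multiplicative. Now compose with an
  isomorphism \<open>\<phi> : X\<^sup>n \<rightarrow> \<one>\<close>. Naturality of \<open>\<gamma>\<close> turns the left-hand side into \<open>p \<otimes> \<phi>\<close>, and the result is
  \<open>p \<theta>\<^sup>n = p\<close>, provided that \<open>X \<otimes> \<phi>\<close> and \<open>\<phi> \<otimes> X\<close> are the same arrow \<open>X\<^sup>n\<^sup>+\<^sup>1 \<rightarrow> X\<close>
  (\<open>twist_power_projection\<close>).

  In general \<open>X \<otimes> \<phi>\<close> and \<open>\<phi> \<otimes> X\<close> differ by a scalar, which measures the associativity constraint
  on the powers of \<open>X\<close>. This is where the fixed point enters: the powers of \<open>X\<close> act on the single simple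
  object \<open>Z\<close>, whose endomorphisms are scalars, and such an action forces the scalar to be \<open>1\<close>
  (\<open>fixed_point_commutes\<close>).

  The rest transports the equation to \<open>Y\<close>. An arrow \<open>X \<rightarrow> W\<close> is detected by the arrows \<open>W \<rightarrow> X\<close>, so
  \<open>\<theta>\<^sup>n\<close> fixes all arrows \<open>X \<rightarrow> W\<close>, in particular the unit \<open>X \<rightarrow> I(X)\<close> of the adjunction for \<open>W = I(X)\<close>.
  Hence \<open>\<theta>\<^sup>n = 1\<close> on \<open>I(X)\<close>, and then also on its subobject \<open>Y\<close>, because the twist is natural. Finally
  \<open>\<theta>\<close> is a scalar on \<open>Y\<close>: as \<open>\<theta>\<^sup>n = 1\<close>, the identity is a sum of eigenprojections; these are arrows of the
  center, where they split, so the simplicity of \<open>Y\<close> makes one of them the identity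
  (\<open>twist_of_center_simple\<close>).

  All equations between composites of tensor products are proved in a strict calculus. A
  diagram between words \<open>a\<close> and \<open>b\<close> of objects is a family of arrows \<open>a D \<rightarrow> b D\<close>, where the word
  \<open>A\<^sub>1 \<dots> A\<^sub>k\<close> acts by \<open>A\<^sub>1 \<otimes> (\<dots> \<otimes> (A\<^sub>k \<otimes> D))\<close>, that is natural in \<open>D\<close> and compatible with tensoring by further
  objects on the right. Placing strands to the left of a diagram means applying their action, placing
  them to the right means evaluating the family at \<open>r D\<close>; both are strictly associative and compatible
  with each other, and the exchange law is the naturality of the family. The tail \<open>D\<close>
  absorbs the associativity constraints. Between one-letter words, diagrams are the same as arrows of
  \<open>C\<close> (\<open>hat_full\<close>, \<open>hat_faithful\<close>), so that results can be carried back.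
\<close>

section \<open>Commuting squares and coherence\<close>

context category
begin

lemma inverse_arrowsD:
  assumes "inverse_arrows C A B f g"
  shows "f \<in> Hom C A B" "g \<in> Hom C B A" "g \<cdot> f = ide C A" "f \<cdot> g = ide C B"
  using assms by (auto simp: inverse_arrows_def)

lemma inverse_unique:
  assumes "A \<in> Obj C" "B \<in> Obj C" "inverse_arrows C A B f g" "inverse_arrows C A B f h"
  shows "g = h"
proof -
  note g = inverse_arrowsD[OF assms(3)] and h = inverse_arrowsD[OF assms(4)]
  have "g = g \<cdot> (f \<cdot> h)" using ide_right assms g h by simp
  also have "\<dots> = h"
    using comp_assoc[OF assms(2,1,2,1) h(2) g(1,2)] g(3) ide_left[OF assms(2,1) h(2)] by simp
  finally show ?thesis .
qed

lemma inv_arrow_eq: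
  assumes "A \<in> Obj C" "B \<in> Obj C" "inverse_arrows C A B f g"
  shows "inv_arrow C A B f = g"
  unfolding inv_arrow_def using assms(3)
  by (rule the_equality) (rule inverse_unique[OF assms(1,2) _ assms(3)])

definition arr :: "'m \<Rightarrow> 'o \<Rightarrow> 'o \<Rightarrow> bool" where
  "arr f A B \<longleftrightarrow> A \<in> Obj C \<and> B \<in> Obj C \<and> f \<in> Hom C A B"

lemma arrI: "\<lbrakk>A \<in> Obj C; B \<in> Obj C; f \<in> Hom C A B\<rbrakk> \<Longrightarrow> arr f A B"
  and arrD: "arr f A B \<Longrightarrow> A \<in> Obj C" "arr f A B \<Longrightarrow> B \<in> Obj C" "arr f A B \<Longrightarrow> f \<in> Hom C A B"
  and arr_ide: "A \<in> Obj C \<Longrightarrow> arr (ide C A) A A"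
  and arr_comp: "\<lbrakk>arr g B D; arr f A B\<rbrakk> \<Longrightarrow> arr (g \<cdot> f) A D"
  by (auto simp: arr_def intro: ide_in comp_in)

lemma arr_comp_assoc: "\<lbrakk>arr f A B; arr g B D; arr h D E\<rbrakk> \<Longrightarrow> (h \<cdot> g) \<cdot> f = h \<cdot> g \<cdot> f"
  by (auto simp: arr_def intro: comp_assoc)

lemma arr_ide_left: "arr f A B \<Longrightarrow> ide C B \<cdot> f = f"
  and arr_ide_right: "arr f A B \<Longrightarrow> f \<cdot> ide C A = f"
  by (auto simp: arr_def intro: ide_left ide_right)

text \<open>
  For the families of arrows below, naturality and compatibility with tensoring on the right are both
  commuting squares, so that their closure properties are instances of pasting and reversal.
\<close>

lemma paste_squares:
  assumes "arr p A B" "arr q B D" "arr p' A' B'" "arr q' B' D'" "arr a A A'" "arr b B B'" "arr d D D'"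
    and "p' \<cdot> a = b \<cdot> p" "q' \<cdot> b = d \<cdot> q"
  shows "(q' \<cdot> p') \<cdot> a = d \<cdot> (q \<cdot> p)"
proof -
  have "(q' \<cdot> p') \<cdot> a = q' \<cdot> b \<cdot> p"
    using arr_comp_assoc[OF assms(5,3,4)] assms(8) by simp
  also have "\<dots> = (d \<cdot> q) \<cdot> p"
    using arr_comp_assoc[OF assms(1,6,4)] assms(9) by simp
  also have "\<dots> = d \<cdot> (q \<cdot> p)"
    by (rule arr_comp_assoc[OF assms(1,2,7)])
  finally show ?thesis .
qed

lemma reverse_square:
  assumes "inverse_arrows C A B p p'" "inverse_arrows C A' B' q q'" "arr a A A'" "arr b B B'" "q \<cdot> a = b \<cdot> p"
  shows "q' \<cdot> b = a \<cdot> p'"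
proof -
  note p = inverse_arrowsD[OF assms(1)] and q = inverse_arrowsD[OF assms(2)]
  note o = arrD(1,2)[OF assms(3)] arrD(1,2)[OF assms(4)]
  have arrs: "arr p A B" "arr p' B A" "arr q A' B'" "arr q' B' A'"
    using o p q by (auto intro: arrI)
  have "q' \<cdot> b = (q' \<cdot> b) \<cdot> (p \<cdot> p')"
    using p(4) arr_ide_right[OF arr_comp[OF arrs(4) assms(4)]] by simp
  also have "\<dots> = q' \<cdot> (b \<cdot> p) \<cdot> p'"
    using arr_comp_assoc[OF arr_comp[OF arrs(1,2)] assms(4) arrs(4)] arr_comp_assoc[OF arrs(2,1) assms(4)] by simp
  also have "\<dots> = (q' \<cdot> q) \<cdot> (a \<cdot> p')"
    using arr_comp_assoc[OF arrs(2) assms(3) arrs(3)] arr_comp_assoc[OF arr_comp[OF assms(3) arrs(2)] arrs(3,4)] assms(5) by simp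
  finally show ?thesis
    using q(3) arr_ide_left[OF arr_comp[OF assms(3) arrs(2)]] by simp
qed

lemma cancel_iso_right:
  assumes "arr h B D" "arr k B D" "inverse_arrows C A B f g" "A \<in> Obj C" "h \<cdot> f = k \<cdot> f"
  shows "h = k"
proof -
  note f = inverse_arrowsD[OF assms(3)]
  have fg: "arr f A B" "arr g B A" using f assms(1,4) by (auto simp: arr_def)
  have x: "(x \<cdot> f) \<cdot> g = x" if x: "arr x B D" for x
    using arr_comp_assoc[OF fg(2,1) x] f(4) arr_ide_right[OF x] by simp
  have "h = (h \<cdot> f) \<cdot> g" by (rule x[OF assms(1), symmetric])
  also have "\<dots> = k" unfolding assms(5) by (rule x[OF assms(2)])
  finally show ?thesis .
qed

end

context monoidal_category
begin

lemma assoc_hom: "\<lbrakk>A \<in> Obj C; B \<in> Obj C; D \<in> Obj C\<rbrakk> \<Longrightarrow> assoc C A B D \<in> Hom C ((A \<otimes> B) \<otimes> D) (A \<otimes> (B \<otimes> D))"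
  and assoc'_hom: "\<lbrakk>A \<in> Obj C; B \<in> Obj C; D \<in> Obj C\<rbrakk> \<Longrightarrow> assoc' C A B D \<in> Hom C (A \<otimes> (B \<otimes> D)) ((A \<otimes> B) \<otimes> D)"
  and assoc_assoc': "\<lbrakk>A \<in> Obj C; B \<in> Obj C; D \<in> Obj C\<rbrakk> \<Longrightarrow> assoc C A B D \<cdot> assoc' C A B D = ide C (A \<otimes> (B \<otimes> D))"
  and assoc'_assoc: "\<lbrakk>A \<in> Obj C; B \<in> Obj C; D \<in> Obj C\<rbrakk> \<Longrightarrow> assoc' C A B D \<cdot> assoc C A B D = ide C ((A \<otimes> B) \<otimes> D)"
  by (rule inverse_arrowsD[OF assoc_inverse]; assumption)+

lemma lunit_hom: "A \<in> Obj C \<Longrightarrow> lunit C A \<in> Hom C (\<one> \<otimes> A) A"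
  and lunit'_hom: "A \<in> Obj C \<Longrightarrow> lunit' C A \<in> Hom C A (\<one> \<otimes> A)"
  and lunit_lunit': "A \<in> Obj C \<Longrightarrow> lunit C A \<cdot> lunit' C A = ide C A"
  and lunit'_lunit: "A \<in> Obj C \<Longrightarrow> lunit' C A \<cdot> lunit C A = ide C (\<one> \<otimes> A)"
  and runit_hom: "A \<in> Obj C \<Longrightarrow> runit C A \<in> Hom C (A \<otimes> \<one>) A"
  and runit'_hom: "A \<in> Obj C \<Longrightarrow> runit' C A \<in> Hom C A (A \<otimes> \<one>)"
  and runit'_runit: "A \<in> Obj C \<Longrightarrow> runit' C A \<cdot> runit C A = ide C (A \<otimes> \<one>)"
  by (rule inverse_arrowsD[OF lunit_inverse] inverse_arrowsD[OF runit_inverse]; assumption)+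

lemmas structure_homs = ide_in unit_obj tensor_obj tensor_hom assoc_hom assoc'_hom lunit_hom lunit'_hom
  runit_hom runit'_hom

lemma tensor_ide_comp_right: "\<lbrakk>A \<in> Obj C; B \<in> Obj C; D \<in> Obj C; E \<in> Obj C; f \<in> Hom C A B; g \<in> Hom C B D\<rbrakk>
   \<Longrightarrow> ide C E \<odot> (g \<cdot> f) = (ide C E \<odot> g) \<cdot> (ide C E \<odot> f)"
  using interchange[of E E E A B D "ide C E" "ide C E" f g] ide_left[of E E "ide C E"] ide_in by simp

lemma tensor_ide_comp_left: "\<lbrakk>A \<in> Obj C; B \<in> Obj C; D \<in> Obj C; E \<in> Obj C; f \<in> Hom C A B; g \<in> Hom C B D\<rbrakk>
   \<Longrightarrow> (g \<cdot> f) \<odot> ide C E = (g \<odot> ide C E) \<cdot> (f \<odot> ide C E)"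
  using interchange[of A B D E E E f g "ide C E" "ide C E"] ide_left[of E E "ide C E"] ide_in by simp

lemma tensor_inverse:
  assumes "A \<in> Obj C" "B \<in> Obj C" "A' \<in> Obj C" "B' \<in> Obj C"
    and "inverse_arrows C A B f g" "inverse_arrows C A' B' f' g'"
  shows "inverse_arrows C (A \<otimes> A') (B \<otimes> B') (f \<odot> f') (g \<odot> g')"
proof -
  note f = inverse_arrowsD[OF assms(5)] and f' = inverse_arrowsD[OF assms(6)]
  show ?thesis
    unfolding inverse_arrows_def
    using assms(1-4) f f'
    by (simp add: tensor_hom tensor_ide interchange[of A B A A' B' A', symmetric]
        interchange[of B A B B' A' B', symmetric])
qed

lemma ide_inverse: "A \<in> Obj C \<Longrightarrow> inverse_arrows C A A (ide C A) (ide C A)"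
  by (simp add: inverse_arrows_def ide_in ide_left)

lemma arr_tensor: "\<lbrakk>arr f A B; arr f' A' B'\<rbrakk> \<Longrightarrow> arr (f \<odot> f') (A \<otimes> A') (B \<otimes> B')"
  by (simp add: arr_def tensor_obj tensor_hom)

lemma arr_structure:
  "\<lbrakk>A \<in> Obj C; B \<in> Obj C; D \<in> Obj C\<rbrakk> \<Longrightarrow> arr (assoc C A B D) ((A \<otimes> B) \<otimes> D) (A \<otimes> (B \<otimes> D))"
  "A \<in> Obj C \<Longrightarrow> arr (lunit C A) (\<one> \<otimes> A) A" "A \<in> Obj C \<Longrightarrow> arr (runit C A) (A \<otimes> \<one>) A"
  "A \<in> Obj C \<Longrightarrow> arr (runit' C A) A (A \<otimes> \<one>)"
  by (simp_all add: arr_def structure_homs)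

lemmas arr_intros = arr_comp arr_tensor arr_ide arr_structure

lemma tensor_unit_faithful:
  assumes f: "arr f A B" and g: "arr g A B" and eq: "ide C \<one> \<odot> f = ide C \<one> \<odot> g"
  shows "f = g"
  by (rule cancel_iso_right[OF f g lunit_inverse])
     (use f g eq lunit_natural[of A B f] lunit_natural[of A B g] in \<open>auto simp: arr_def structure_homs\<close>)

lemma unit_tensor_faithful:
  assumes f: "arr f A B" and g: "arr g A B" and eq: "f \<odot> ide C \<one> = g \<odot> ide C \<one>"
  shows "f = g"
  by (rule cancel_iso_right[OF f g runit_inverse])
     (use f g eq runit_natural[of A B f] runit_natural[of A B g] in \<open>auto simp: arr_def structure_homs\<close>)

text \<open>
  The unit constraint of a tensor product, after Kelly. Tensoring with \<open>\<one>\<close> on the left is faithful, and once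
  that is done the equation can be read off the pentagon for \<open>\<one>, \<one>, A, B\<close>: the triangle axiom turns both ways
  of removing the second \<open>\<one>\<close> into the same arrow.
\<close>

lemma lunit_tensor:
  assumes [simp]: "A \<in> Obj C" "B \<in> Obj C"
  shows "lunit C (A \<otimes> B) \<cdot> assoc C \<one> A B = lunit C A \<odot> ide C B"
proof -
  note [simp] = unit_obj tensor_obj
  let ?i = "ide C \<one>" and ?a = "assoc C \<one> (\<one> \<otimes> A) B" and ?b = "assoc C \<one> \<one> A \<odot> ide C B"
  let ?l = "lunit C (A \<otimes> B) \<cdot> assoc C \<one> A B" and ?r = "lunit C A \<odot> ide C B"
  let ?il = "?i \<odot> lunit C (A \<otimes> B)"
  have l: "arr ?l ((\<one> \<otimes> A) \<otimes> B) (A \<otimes> B)" and r: "arr ?r ((\<one> \<otimes> A) \<otimes> B) (A \<otimes> B)"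
    by (rule arr_intros | simp)+
  have inv_b: "inverse_arrows C (((\<one> \<otimes> \<one>) \<otimes> A) \<otimes> B) ((\<one> \<otimes> (\<one> \<otimes> A)) \<otimes> B) ?b (assoc' C \<one> \<one> A \<odot> ide C B)"
    by (rule tensor_inverse) (auto intro: assoc_inverse ide_inverse)
  have il: "?i \<odot> ?l = ?il \<cdot> (?i \<odot> assoc C \<one> A B)"
    by (rule tensor_ide_comp_right[of "(\<one> \<otimes> A) \<otimes> B" "\<one> \<otimes> (A \<otimes> B)" "A \<otimes> B"]) (simp_all add: structure_homs)
  have "((?i \<odot> ?l) \<cdot> ?a) \<cdot> ?b = (?i \<odot> ?l) \<cdot> (?a \<cdot> ?b)"
    by (rule arr_comp_assoc) (rule arr_intros | simp)+
  also have "\<dots> = (?il \<cdot> (?i \<odot> assoc C \<one> A B)) \<cdot> (?a \<cdot> ?b)" by (simp only: il)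
  also have "\<dots> = ?il \<cdot> ((?i \<odot> assoc C \<one> A B) \<cdot> ?a \<cdot> ?b)"
    by (rule arr_comp_assoc) (rule arr_intros | simp)+
  also have "\<dots> = ?il \<cdot> (assoc C \<one> \<one> (A \<otimes> B) \<cdot> assoc C (\<one> \<otimes> \<one>) A B)"
    using pentagon[of \<one> \<one> A B] by simp
  also have "\<dots> = (?il \<cdot> assoc C \<one> \<one> (A \<otimes> B)) \<cdot> assoc C (\<one> \<otimes> \<one>) A B"
    by (rule arr_comp_assoc[symmetric]) (rule arr_intros | simp)+
  also have "\<dots> = (runit C \<one> \<odot> ide C (A \<otimes> B)) \<cdot> assoc C (\<one> \<otimes> \<one>) A B"
    using triangle[of \<one> "A \<otimes> B"] by simp
  also have "\<dots> = assoc C \<one> A B \<cdot> ((runit C \<one> \<odot> ide C A) \<odot> ide C B)"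
    using assoc_natural[of "\<one> \<otimes> \<one>" A B \<one> A B "runit C \<one>" "ide C A" "ide C B"]
    by (simp add: tensor_ide structure_homs)
  also have "\<dots> = assoc C \<one> A B \<cdot> (((?i \<odot> lunit C A) \<cdot> assoc C \<one> \<one> A) \<odot> ide C B)"
    using triangle[of \<one> A] by simp
  also have "((?i \<odot> lunit C A) \<cdot> assoc C \<one> \<one> A) \<odot> ide C B = ((?i \<odot> lunit C A) \<odot> ide C B) \<cdot> ?b"
    by (rule tensor_ide_comp_left[of "(\<one> \<otimes> \<one>) \<otimes> A" "\<one> \<otimes> (\<one> \<otimes> A)" "\<one> \<otimes> A"]) (simp_all add: structure_homs)
  also have "assoc C \<one> A B \<cdot> \<dots> = (assoc C \<one> A B \<cdot> ((?i \<odot> lunit C A) \<odot> ide C B)) \<cdot> ?b"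
    by (rule arr_comp_assoc[symmetric]) (rule arr_intros | simp)+
  also have "\<dots> = ((?i \<odot> ?r) \<cdot> ?a) \<cdot> ?b"
    using assoc_natural[of \<one> "\<one> \<otimes> A" B \<one> A B ?i "lunit C A" "ide C B"] by (simp add: structure_homs)
  finally have "((?i \<odot> ?l) \<cdot> ?a) \<cdot> ?b = ((?i \<odot> ?r) \<cdot> ?a) \<cdot> ?b" .
  then have "(?i \<odot> ?l) \<cdot> ?a = (?i \<odot> ?r) \<cdot> ?a"
    by (rule cancel_iso_right[OF _ _ inv_b, rotated 3]) (rule arr_intros | simp)+
  then have "?i \<odot> ?l = ?i \<odot> ?r"
    by (rule cancel_iso_right[OF _ _ assoc_inverse, rotated -1]) (rule arr_intros | simp)+
  then show ?thesis by (rule tensor_unit_faithful[OF l r])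
qed

end

section \<open>Words of objects acting on objects\<close>

text \<open>
  In \<open>Diag a F b\<close>, the arrow \<open>F D\<close> goes from \<open>a\<close> acting on \<open>D\<close> to \<open>b\<close> acting on \<open>D\<close>. \<open>Null\<close> stands for
  an ill-typed diagram. With it the operations are total, and associativity of
  composition, functoriality of whiskering and the mixed laws become unconditional rewrite rules.
\<close>

datatype ('o, 'm) diag = Null | Diag "'o list" "'o \<Rightarrow> 'm" "'o list"

fun src :: "('o, 'm) diag \<Rightarrow> 'o list" where
  "src (Diag a F b) = a"
| "src Null = []"

fun tgt :: "('o, 'm) diag \<Rightarrow> 'o list" where
  "tgt (Diag a F b) = b"
| "tgt Null = []"

context monoidal_category
begin

definition act :: "'o list \<Rightarrow> 'o \<Rightarrow> 'o" where
  "act a D = foldr (tensor C) a D"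

definition act_arrow :: "'o list \<Rightarrow> 'm \<Rightarrow> 'm" where
  "act_arrow a f = foldr (\<lambda>A g. ide C A \<odot> g) a f"

text \<open>
  The canonical isomorphism that moves a tensor factor \<open>E\<close> into the tail of the action.
\<close>

primrec shift :: "'o list \<Rightarrow> 'o \<Rightarrow> 'o \<Rightarrow> 'm" where
  "shift [] D E = ide C (D \<otimes> E)"
| "shift (A # a) D E = (ide C A \<odot> shift a D E) \<cdot> assoc C A (act a D) E"

lemma act_simps [simp]: "act [] D = D" "act (A # a) D = A \<otimes> act a D" "act (a @ b) D = act a (act b D)"
  by (simp_all add: act_def)

lemma act_arrow_simps [simp]: "act_arrow [] f = f" "act_arrow (A # a) f = ide C A \<odot> act_arrow a f"
  "act_arrow (a @ b) f = act_arrow a (act_arrow b f)"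
  by (simp_all add: act_arrow_def)

lemma act_obj: "\<lbrakk>set a \<subseteq> Obj C; D \<in> Obj C\<rbrakk> \<Longrightarrow> act a D \<in> Obj C"
  by (induction a) (auto intro: tensor_obj)

lemma act_arrow_hom: "\<lbrakk>set a \<subseteq> Obj C; D \<in> Obj C; E \<in> Obj C; f \<in> Hom C D E\<rbrakk>
    \<Longrightarrow> act_arrow a f \<in> Hom C (act a D) (act a E)"
  by (induction a) (auto intro: tensor_hom ide_in act_obj)

lemma act_arrow_ide: "\<lbrakk>set a \<subseteq> Obj C; D \<in> Obj C\<rbrakk> \<Longrightarrow> act_arrow a (ide C D) = ide C (act a D)"
  by (induction a) (auto simp: tensor_ide act_obj)

lemma act_arrow_comp: "\<lbrakk>set a \<subseteq> Obj C; D \<in> Obj C; E \<in> Obj C; G \<in> Obj C; f \<in> Hom C D E; g \<in> Hom C E G\<rbrakk>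
    \<Longrightarrow> act_arrow a (g \<cdot> f) = act_arrow a g \<cdot> act_arrow a f"
proof (induction a)
  case (Cons A a)
  then show ?case
    by (auto intro!: tensor_ide_comp_right[where A = "act a D" and B = "act a E" and D = "act a G"] act_obj act_arrow_hom)
qed auto

lemma shift_hom: "\<lbrakk>set a \<subseteq> Obj C; D \<in> Obj C; E \<in> Obj C\<rbrakk>
    \<Longrightarrow> shift a D E \<in> Hom C (act a D \<otimes> E) (act a (D \<otimes> E))"
proof (induction a)
  case (Cons A a)
  then show ?case
    by (auto intro!: comp_in[where B = "A \<otimes> (act a D \<otimes> E)"] tensor_hom structure_homs act_obj)
qed (auto intro: structure_homs)

lemma shift_append: "\<lbrakk>set a \<subseteq> Obj C; set b \<subseteq> Obj C; D \<in> Obj C; E \<in> Obj C\<rbrakk>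
    \<Longrightarrow> shift (a @ b) D E = act_arrow a (shift b D E) \<cdot> shift a (act b D) E"
proof (induction a)
  case Nil
  then show ?case
    using ide_right[OF _ _ shift_hom[of b D E]] act_obj tensor_obj by simp
next
  case (Cons A a)
  then have [simp]: "A \<in> Obj C" "set a \<subseteq> Obj C" by auto
  note [simp] = Cons.prems(2-) act_obj structure_homs shift_hom act_arrow_hom
  show ?case
    using Cons
    by (simp add: tensor_ide_comp_right[where A = "act a (act b D) \<otimes> E" and B = "act a (act b D \<otimes> E)" and D = "act a (act b (D \<otimes> E))"]
       comp_assoc[where A = "(A \<otimes> act a (act b D)) \<otimes> E" and B = "A \<otimes> (act a (act b D) \<otimes> E)" and
         D = "A \<otimes> act a (act b D \<otimes> E)" and E = "A \<otimes> act a (act b (D \<otimes> E))"])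
qed

text \<open>
  The last clause says that the family commutes with the action of the category on itself by tensoring on
  the right. Together with naturality it makes the family determined by its component at \<open>\<one>\<close>.
\<close>

definition family :: "'o list \<Rightarrow> 'o list \<Rightarrow> ('o \<Rightarrow> 'm) \<Rightarrow> bool" where
  "family a b F \<longleftrightarrow> set a \<subseteq> Obj C \<and> set b \<subseteq> Obj C \<and> F \<in> extensional (Obj C) \<and>
     (\<forall>D\<in>Obj C. F D \<in> Hom C (act a D) (act b D)) \<and>
     (\<forall>D\<in>Obj C. \<forall>E\<in>Obj C. \<forall>f\<in>Hom C D E. F E \<cdot> act_arrow a f = act_arrow b f \<cdot> F D) \<and>
     (\<forall>D\<in>Obj C. \<forall>E\<in>Obj C. F (D \<otimes> E) \<cdot> shift a D E = shift b D E \<cdot> (F D \<odot> ide C E))"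

lemma family_obj: "family a b F \<Longrightarrow> set a \<subseteq> Obj C" "family a b F \<Longrightarrow> set b \<subseteq> Obj C"
  and family_hom: "\<lbrakk>family a b F; D \<in> Obj C\<rbrakk> \<Longrightarrow> F D \<in> Hom C (act a D) (act b D)"
  and family_natural: "\<lbrakk>family a b F; D \<in> Obj C; E \<in> Obj C; f \<in> Hom C D E\<rbrakk>
      \<Longrightarrow> F E \<cdot> act_arrow a f = act_arrow b f \<cdot> F D"
  and family_shift: "\<lbrakk>family a b F; D \<in> Obj C; E \<in> Obj C\<rbrakk>
      \<Longrightarrow> F (D \<otimes> E) \<cdot> shift a D E = shift b D E \<cdot> (F D \<odot> ide C E)"
  and family_extensional: "family a b F \<Longrightarrow> F \<in> extensional (Obj C)"
  by (auto simp: family_def)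

lemma family_ide:
  assumes "set a \<subseteq> Obj C"
  shows "family a a (\<lambda>D\<in>Obj C. ide C (act a D))"
  unfolding family_def
proof (intro conjI ballI)
  fix D E f assume [simp]: "D \<in> Obj C" "E \<in> Obj C" and f: "f \<in> Hom C D E"
  show "(\<lambda>D\<in>Obj C. ide C (act a D)) E \<cdot> act_arrow a f = act_arrow a f \<cdot> (\<lambda>D\<in>Obj C. ide C (act a D)) D"
    using act_arrow_hom[OF assms _ _ f] ide_left[of "act a D" "act a E"] ide_right[of "act a D" "act a E"]
    by (simp add: act_obj assms)
next
  fix D E assume [simp]: "D \<in> Obj C" "E \<in> Obj C"
  show "(\<lambda>D\<in>Obj C. ide C (act a D)) (D \<otimes> E) \<cdot> shift a D E = shift a D E \<cdot> ((\<lambda>D\<in>Obj C. ide C (act a D)) D \<odot> ide C E)"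
    using shift_hom[OF assms, of D E] ide_left[of "act a D \<otimes> E" "act a (D \<otimes> E)"] ide_right[of "act a D \<otimes> E" "act a (D \<otimes> E)"]
    by (simp add: act_obj assms tensor_obj tensor_ide)
qed (use assms in \<open>auto intro: ide_in act_obj\<close>)

lemma family_arr: "\<lbrakk>family a b F; D \<in> Obj C\<rbrakk> \<Longrightarrow> arr (F D) (act a D) (act b D)"
  using family_obj[of a b F] by (simp add: arr_def family_hom act_obj)

lemma arr_act: "\<lbrakk>set a \<subseteq> Obj C; D \<in> Obj C; E \<in> Obj C; f \<in> Hom C D E\<rbrakk> \<Longrightarrow> arr (act_arrow a f) (act a D) (act a E)"
  and arr_shift: "\<lbrakk>set a \<subseteq> Obj C; D \<in> Obj C; E \<in> Obj C\<rbrakk> \<Longrightarrow> arr (shift a D E) (act a D \<otimes> E) (act a (D \<otimes> E))"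
  by (simp_all add: arr_def act_obj act_arrow_hom shift_hom tensor_obj)

lemma tensor_square:
  assumes "arr p A B" "arr p' A' B'" "arr a A A'" "arr b B B'" "p' \<cdot> a = b \<cdot> p" "D \<in> Obj C"
  shows "(ide C D \<odot> p') \<cdot> (ide C D \<odot> a) = (ide C D \<odot> b) \<cdot> (ide C D \<odot> p)"
  using assms tensor_ide_comp_right[of A A' B' D a p'] tensor_ide_comp_right[of A B B' D p b] by (simp add: arr_def)

lemma family_comp:
  assumes F: "family a b F" and G: "family b c G"
  shows "family a c (\<lambda>D\<in>Obj C. G D \<cdot> F D)"
  unfolding family_def
proof (intro conjI ballI)
  note o[simp] = family_obj[OF F] family_obj[OF G]
  fix D E f assume [simp]: "D \<in> Obj C" "E \<in> Obj C" and f[simp]: "f \<in> Hom C D E"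
  have "(G E \<cdot> F E) \<cdot> act_arrow a f = act_arrow c f \<cdot> (G D \<cdot> F D)"
    by (rule paste_squares[OF family_arr[OF F] family_arr[OF G] family_arr[OF F] family_arr[OF G] arr_act arr_act arr_act])
       (auto intro: family_natural F G)
  then show "(\<lambda>D\<in>Obj C. G D \<cdot> F D) E \<cdot> act_arrow a f = act_arrow c f \<cdot> (\<lambda>D\<in>Obj C. G D \<cdot> F D) D"
    by simp
next
  note o[simp] = family_obj[OF F] family_obj[OF G]
  fix D E assume [simp]: "D \<in> Obj C" "E \<in> Obj C"
  have "(G (D \<otimes> E) \<cdot> F (D \<otimes> E)) \<cdot> shift a D E = shift c D E \<cdot> ((G D \<odot> ide C E) \<cdot> (F D \<odot> ide C E))"
    by (rule paste_squares[OF arr_tensor[OF family_arr[OF F] arr_ide] arr_tensor[OF family_arr[OF G] arr_ide]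
          family_arr[OF F] family_arr[OF G] arr_shift arr_shift arr_shift])
       (auto intro: family_shift F G tensor_obj)
  then show "(\<lambda>D\<in>Obj C. G D \<cdot> F D) (D \<otimes> E) \<cdot> shift a D E
      = shift c D E \<cdot> ((\<lambda>D\<in>Obj C. G D \<cdot> F D) D \<odot> ide C E)"
    using family_hom[OF F] family_hom[OF G]
    by (simp add: tensor_obj tensor_ide_comp_left[of "act a D" "act b D" "act c D"] act_obj)
qed (use family_obj[OF F] family_obj[OF G] arr_comp[OF family_arr[OF G] family_arr[OF F], THEN arrD(3)] in auto)

lemma family_left:
  assumes F: "family a b F" and A[simp]: "A \<in> Obj C"
  shows "family (A # a) (A # b) (\<lambda>D\<in>Obj C. ide C A \<odot> F D)"
  unfolding family_def
proof (intro conjI ballI)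
  note o[simp] = family_obj[OF F]
  fix D E f assume [simp]: "D \<in> Obj C" "E \<in> Obj C" and f[simp]: "f \<in> Hom C D E"
  have "(ide C A \<odot> F E) \<cdot> (ide C A \<odot> act_arrow a f) = (ide C A \<odot> act_arrow b f) \<cdot> (ide C A \<odot> F D)"
    by (rule tensor_square[OF family_arr[OF F] family_arr[OF F] arr_act arr_act]) (auto intro: family_natural F)
  then show "(\<lambda>D\<in>Obj C. ide C A \<odot> F D) E \<cdot> act_arrow (A # a) f = act_arrow (A # b) f \<cdot> (\<lambda>D\<in>Obj C. ide C A \<odot> F D) D"
    by simp
next
  note o[simp] = family_obj[OF F]
  fix D E assume [simp]: "D \<in> Obj C" "E \<in> Obj C"
  note [simp] = tensor_obj act_obj
  note FD = arr_tensor[OF family_arr[OF F] arr_ide, of D E]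
  have square: "(ide C A \<odot> F (D \<otimes> E)) \<cdot> (ide C A \<odot> shift a D E) = (ide C A \<odot> shift b D E) \<cdot> (ide C A \<odot> (F D \<odot> ide C E))"
    by (rule tensor_square[OF FD family_arr[OF F] arr_shift arr_shift]) (auto intro: family_shift F)
  have "((ide C A \<odot> shift b D E) \<cdot> assoc C A (act b D) E) \<cdot> ((ide C A \<odot> F D) \<odot> ide C E)
      = (ide C A \<odot> F (D \<otimes> E)) \<cdot> ((ide C A \<odot> shift a D E) \<cdot> assoc C A (act a D) E)"
    by (rule paste_squares[OF _ _ _ _ arr_tensor[OF arr_tensor[OF arr_ide family_arr[OF F]] arr_ide] arr_tensor[OF arr_ide FD]
          arr_tensor[OF arr_ide family_arr[OF F]]])
       (rule arr_structure arr_tensor arr_ide arr_shift assoc_natural square[symmetric] | simp add: family_hom[OF F] ide_in)+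
  then show "(\<lambda>D\<in>Obj C. ide C A \<odot> F D) (D \<otimes> E) \<cdot> shift (A # a) D E
      = shift (A # b) D E \<cdot> ((\<lambda>D\<in>Obj C. ide C A \<odot> F D) D \<odot> ide C E)"
    by simp
qed (use family_obj[OF F] family_hom[OF F] in \<open>auto intro!: tensor_hom ide_in act_obj\<close>)

lemma family_act:
  assumes F: "family a b F" and l: "set l \<subseteq> Obj C"
  shows "family (l @ a) (l @ b) (\<lambda>D\<in>Obj C. act_arrow l (F D))"
  using l
proof (induction l)
  case Nil
  have "(\<lambda>D\<in>Obj C. F D) = F"
    using family_extensional[OF F] by (rule extensional_restrict)
  then show ?case using F by simp
next
  case (Cons A l)
  then have A: "A \<in> Obj C" by simp
  have fam: "family (l @ a) (l @ b) (\<lambda>D\<in>Obj C. act_arrow l (F D))"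
    by (rule Cons.IH) (use Cons.prems in simp)
  have "(\<lambda>D\<in>Obj C. act_arrow (A # l) (F D))
      = (\<lambda>D\<in>Obj C. ide C A \<odot> (\<lambda>D\<in>Obj C. act_arrow l (F D)) D)"
    by (simp cong: restrict_cong)
  then show ?case
    using family_left[OF fam A]
    by (simp only: append_Cons)
qed

lemma family_right:
  assumes F: "family a b F" and r[simp]: "set r \<subseteq> Obj C"
  shows "family (a @ r) (b @ r) (\<lambda>D\<in>Obj C. F (act r D))"
  unfolding family_def
proof (intro conjI ballI)
  note o[simp] = family_obj[OF F]
  fix D E f assume [simp]: "D \<in> Obj C" "E \<in> Obj C" and f[simp]: "f \<in> Hom C D E"
  show "(\<lambda>D\<in>Obj C. F (act r D)) E \<cdot> act_arrow (a @ r) f = act_arrow (b @ r) f \<cdot> (\<lambda>D\<in>Obj C. F (act r D)) D"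
    using family_natural[OF F _ _ act_arrow_hom[OF r _ _ f]] by (simp add: act_obj)
next
  note o[simp] = family_obj[OF F]
  fix D E assume [simp]: "D \<in> Obj C" "E \<in> Obj C"
  note [simp] = family_hom[OF F] act_obj shift_hom structure_homs act_arrow_hom
  let ?D = "act r D"
  have "(act_arrow b (shift r D E) \<cdot> shift b ?D E) \<cdot> (F ?D \<odot> ide C E)
      = F (act r (D \<otimes> E)) \<cdot> (act_arrow a (shift r D E) \<cdot> shift a ?D E)"
    by (rule paste_squares[OF arr_shift arr_act arr_shift arr_act arr_tensor[OF family_arr[OF F] arr_ide]
          family_arr[OF F] family_arr[OF F]])
       (auto simp: family_shift[OF F] intro: family_natural[OF F, symmetric])
  then show "(\<lambda>D\<in>Obj C. F (act r D)) (D \<otimes> E) \<cdot> shift (a @ r) D E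
      = shift (b @ r) D E \<cdot> ((\<lambda>D\<in>Obj C. F (act r D)) D \<odot> ide C E)"
    by (simp add: shift_append)
qed (use r family_obj[OF F] family_hom[OF F] in \<open>auto simp: act_obj[OF r]\<close>)

section \<open>Diagrams\<close>

fun valid :: "('o, 'm) diag \<Rightarrow> bool" where
  "valid (Diag a F b) = family a b F"
| "valid Null = False"

fun comp :: "('o, 'm) diag \<Rightarrow> ('o, 'm) diag \<Rightarrow> ('o, 'm) diag"  (infixr "\<bullet>" 55) where
  "comp (Diag b' G c) (Diag a F b) =
     (if b = b' \<and> family a b F \<and> family b c G then Diag a (\<lambda>D\<in>Obj C. G D \<cdot> F D) c else Null)"
| "comp _ _ = Null"

fun lwhisk :: "'o list \<Rightarrow> ('o, 'm) diag \<Rightarrow> ('o, 'm) diag"  (infixr "\<rhd>" 60) where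
  "lwhisk l (Diag a F b) = (if family a b F \<and> set l \<subseteq> Obj C
     then Diag (l @ a) (\<lambda>D\<in>Obj C. act_arrow l (F D)) (l @ b) else Null)"
| "lwhisk l Null = Null"

fun rwhisk :: "('o, 'm) diag \<Rightarrow> 'o list \<Rightarrow> ('o, 'm) diag"  (infixl "\<lhd>" 61) where
  "rwhisk (Diag a F b) r = (if family a b F \<and> set r \<subseteq> Obj C
     then Diag (a @ r) (\<lambda>D\<in>Obj C. F (act r D)) (b @ r) else Null)"
| "rwhisk Null r = Null"

definition idn :: "'o list \<Rightarrow> ('o, 'm) diag" where
  "idn a = (if set a \<subseteq> Obj C then Diag a (\<lambda>D\<in>Obj C. ide C (act a D)) a else Null)"

definition hom :: "('o, 'm) diag \<Rightarrow> 'o list \<Rightarrow> 'o list \<Rightarrow> bool" where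
  "hom f a b \<longleftrightarrow> valid f \<and> src f = a \<and> tgt f = b"

lemma hom_valid: "hom f a b \<Longrightarrow> valid f" and hom_src: "hom f a b \<Longrightarrow> src f = a"
  and hom_tgt: "hom f a b \<Longrightarrow> tgt f = b"
  by (auto simp: hom_def)

lemmas hom_simps = hom_valid hom_src hom_tgt

lemma hom_obj: assumes "hom f a b" shows "set a \<subseteq> Obj C" "set b \<subseteq> Obj C"
  using assms by (cases f; auto simp: hom_def dest: family_obj)+

lemma valid_obj: "valid f \<Longrightarrow> set (src f) \<subseteq> Obj C" "valid f \<Longrightarrow> set (tgt f) \<subseteq> Obj C"
  by (cases f; auto dest: family_obj)+

lemma valid_comp [simp]: "valid (g \<bullet> f) \<longleftrightarrow> valid g \<and> valid f \<and> tgt f = src g"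
  by (cases g; cases f) (auto intro: family_comp)

lemma src_comp [simp]: "\<lbrakk>valid g; valid f; tgt f = src g\<rbrakk> \<Longrightarrow> src (g \<bullet> f) = src f"
  and tgt_comp [simp]: "\<lbrakk>valid g; valid f; tgt f = src g\<rbrakk> \<Longrightarrow> tgt (g \<bullet> f) = tgt g"
  by (cases g; cases f; simp)+

lemma valid_lwhisk [simp]: "valid (l \<rhd> f) \<longleftrightarrow> valid f \<and> set l \<subseteq> Obj C"
  by (cases f) (auto intro: family_act)

lemma src_lwhisk [simp]: "\<lbrakk>valid f; set l \<subseteq> Obj C\<rbrakk> \<Longrightarrow> src (l \<rhd> f) = l @ src f"
  and tgt_lwhisk [simp]: "\<lbrakk>valid f; set l \<subseteq> Obj C\<rbrakk> \<Longrightarrow> tgt (l \<rhd> f) = l @ tgt f"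
  by (cases f; simp)+

lemma valid_rwhisk [simp]: "valid (f \<lhd> r) \<longleftrightarrow> valid f \<and> set r \<subseteq> Obj C"
  by (cases f) (auto intro: family_right)

lemma src_rwhisk [simp]: "\<lbrakk>valid f; set r \<subseteq> Obj C\<rbrakk> \<Longrightarrow> src (f \<lhd> r) = src f @ r"
  and tgt_rwhisk [simp]: "\<lbrakk>valid f; set r \<subseteq> Obj C\<rbrakk> \<Longrightarrow> tgt (f \<lhd> r) = tgt f @ r"
  by (cases f; simp)+

lemma valid_idn [simp]: "valid (idn a) \<longleftrightarrow> set a \<subseteq> Obj C"
  by (simp add: idn_def family_ide)

lemma src_idn [simp]: "set a \<subseteq> Obj C \<Longrightarrow> src (idn a) = a"
  and tgt_idn [simp]: "set a \<subseteq> Obj C \<Longrightarrow> tgt (idn a) = a"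
  by (simp_all add: idn_def)

fun component :: "('o, 'm) diag \<Rightarrow> 'o \<Rightarrow> 'm" where
  "component (Diag a F b) D = F D"
| "component Null D = undefined"

lemma diag_eqI:
  assumes "valid f" "valid g" "src f = src g" "tgt f = tgt g" "\<And>D. D \<in> Obj C \<Longrightarrow> component f D = component g D"
  shows "f = g"
  using assms by (cases f; cases g) (auto intro!: extensionalityI[of _ "Obj C"] dest: family_extensional)

lemma component_hom: "\<lbrakk>valid f; D \<in> Obj C\<rbrakk> \<Longrightarrow> component f D \<in> Hom C (act (src f) D) (act (tgt f) D)"
  by (cases f) (auto intro: family_hom)

lemma component_comp [simp]: "\<lbrakk>valid g; valid f; tgt f = src g; D \<in> Obj C\<rbrakk> \<Longrightarrow> component (g \<bullet> f) D = component g D \<cdot> component f D"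
  by (cases g; cases f) auto

lemma component_lwhisk [simp]: "\<lbrakk>valid f; set l \<subseteq> Obj C; D \<in> Obj C\<rbrakk> \<Longrightarrow> component (l \<rhd> f) D = act_arrow l (component f D)"
  by (cases f) auto

lemma component_rwhisk [simp]: "\<lbrakk>valid f; set r \<subseteq> Obj C; D \<in> Obj C\<rbrakk> \<Longrightarrow> component (f \<lhd> r) D = component f (act r D)"
  by (cases f) auto

lemma component_idn [simp]: "\<lbrakk>set a \<subseteq> Obj C; D \<in> Obj C\<rbrakk> \<Longrightarrow> component (idn a) D = ide C (act a D)"
  by (simp add: idn_def)

lemma component_natural: "\<lbrakk>valid f; D \<in> Obj C; E \<in> Obj C; h \<in> Hom C D E\<rbrakk>
    \<Longrightarrow> component f E \<cdot> act_arrow (src f) h = act_arrow (tgt f) h \<cdot> component f D"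
  by (cases f) (auto intro: family_natural)

lemma component_shift: "\<lbrakk>valid f; D \<in> Obj C; E \<in> Obj C\<rbrakk>
    \<Longrightarrow> component f (D \<otimes> E) \<cdot> shift (src f) D E = shift (tgt f) D E \<cdot> (component f D \<odot> ide C E)"
  by (cases f) (auto intro: family_shift)

lemma comp_Null [simp]: "f \<bullet> Null = Null" "Null \<bullet> f = Null"
  by (cases f; simp)+

lemma invalid_comp: "\<not> valid (g \<bullet> f) \<Longrightarrow> g \<bullet> f = Null"
  by (cases g; cases f) (auto simp: family_comp)

lemma invalid_lwhisk: "\<not> valid (l \<rhd> f) \<Longrightarrow> l \<rhd> f = Null"
  by (cases f) (auto simp: family_act split: if_splits)

lemma invalid_rwhisk: "\<not> valid (f \<lhd> r) \<Longrightarrow> f \<lhd> r = Null"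
  by (cases f) (auto simp: family_right split: if_splits)

lemma comp_assoc_diag: "(h \<bullet> g) \<bullet> f = h \<bullet> (g \<bullet> f)"
proof (cases "valid ((h \<bullet> g) \<bullet> f)")
  case True
  then obtain a b c d F G H where eq: "f = Diag a F b" "g = Diag b G c" "h = Diag c H d"
    and fam: "family a b F" "family b c G" "family c d H"
    by (cases f; cases g; cases h) (auto split: if_splits)
  have "H D \<cdot> (G D \<cdot> F D) = (H D \<cdot> G D) \<cdot> F D" if "D \<in> Obj C" for D
    by (rule comp_assoc[symmetric, where A = "act a D" and B = "act b D" and D = "act c D" and E = "act d D"])
       (use fam that in \<open>auto intro: act_obj family_hom dest: family_obj\<close>)
  then show ?thesis
    using fam unfolding eq by (auto simp: family_comp cong: restrict_cong)
next
  case False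
  moreover have "\<not> valid (h \<bullet> (g \<bullet> f))" using False by auto
  ultimately show ?thesis by (metis invalid_comp)
qed

lemma comp_idn [simp]: "\<lbrakk>valid f; src f = a\<rbrakk> \<Longrightarrow> f \<bullet> idn a = f"
  and idn_comp [simp]: "\<lbrakk>valid f; tgt f = a\<rbrakk> \<Longrightarrow> idn a \<bullet> f = f"
  using component_hom[of f] valid_obj[of f]
  by (auto intro!: diag_eqI ide_right[of "act (src f) D" "act (tgt f) D" for D] ide_left[of "act (src f) D" "act (tgt f) D" for D] simp: act_obj)

lemma lwhisk_comp:  "l \<rhd> (g \<bullet> f) = (l \<rhd> g) \<bullet> (l \<rhd> f)"
proof (cases "valid (l \<rhd> (g \<bullet> f))")
  case True
  then obtain a b c F G where eq: "f = Diag a F b" "g = Diag b G c"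
    and fam: "family a b F" "family b c G" and l: "set l \<subseteq> Obj C"
    by (cases f; cases g) (auto split: if_splits)
  have "act_arrow l (G D \<cdot> F D) = act_arrow l (G D) \<cdot> act_arrow l (F D)" if "D \<in> Obj C" for D
    by (rule act_arrow_comp[where D = "act a D" and E = "act b D" and G = "act c D"])
       (use fam that l in \<open>auto intro: act_obj family_hom dest: family_obj\<close>)
  then show ?thesis
    using fam l unfolding eq by (auto simp: family_comp family_act cong: restrict_cong)
next
  case False
  moreover have "\<not> valid ((l \<rhd> g) \<bullet> (l \<rhd> f))" using False by auto
  ultimately show ?thesis by (metis invalid_comp invalid_lwhisk)
qed

lemma rwhisk_comp:  "(g \<bullet> f) \<lhd> r = (g \<lhd> r) \<bullet> (f \<lhd> r)"
proof (cases "valid ((g \<bullet> f) \<lhd> r)")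
  case True
  then obtain a b c F G where eq: "f = Diag a F b" "g = Diag b G c"
    and fam: "family a b F" "family b c G" and r: "set r \<subseteq> Obj C"
    by (cases f; cases g) (auto split: if_splits)
  show ?thesis
    using fam r unfolding eq by (auto simp: family_comp family_right act_obj cong: restrict_cong)
next
  case False
  moreover have "\<not> valid ((g \<lhd> r) \<bullet> (f \<lhd> r))" using False by auto
  ultimately show ?thesis by (metis invalid_comp invalid_rwhisk)
qed

lemma lwhisk_lwhisk: "l \<rhd> m \<rhd> f = (l @ m) \<rhd> f"
  by (cases f) (auto simp: family_act cong: restrict_cong)

lemma rwhisk_rwhisk: "f \<lhd> r \<lhd> s = f \<lhd> (r @ s)"
  by (cases f) (auto simp: family_right act_obj cong: restrict_cong)

lemma lwhisk_rwhisk: "(l \<rhd> f) \<lhd> r = l \<rhd> (f \<lhd> r)"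
  by (cases f) (auto simp: family_right family_act act_obj cong: restrict_cong)

lemma lwhisk_Nil [simp]: "valid f \<Longrightarrow> [] \<rhd> f = f"
  by (cases f) (auto simp: extensional_restrict dest: family_extensional)

lemma rwhisk_Nil [simp]: "valid f \<Longrightarrow> f \<lhd> [] = f"
  by (cases f) (auto simp: extensional_restrict dest: family_extensional)

lemma lwhisk_idn [simp]: "l \<rhd> idn a = idn (l @ a)"
  by (auto simp: idn_def family_ide act_arrow_ide act_obj cong: restrict_cong)

lemma rwhisk_idn [simp]: "idn a \<lhd> r = idn (a @ r)"
  by (auto simp: idn_def family_ide act_obj cong: restrict_cong)

text \<open>
  Both sides compose a component of \<open>f\<close> with a component of \<open>g\<close> in its tail, in the two possible orders. They agree
  because the family \<open>f\<close> is natural.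
\<close>

lemma exchange:
  assumes "hom f a b" "hom g c d"
  shows "(b \<rhd> g) \<bullet> (f \<lhd> c) = (f \<lhd> d) \<bullet> (a \<rhd> g)"
proof -
  obtain F G where eq: "f = Diag a F b" "g = Diag c G d" and fam: "family a b F" "family c d G"
    using assms by (cases f; cases g) (auto simp: hom_def)
  note o = family_obj[OF fam(1)] family_obj[OF fam(2)]
  have "act_arrow b (G D) \<cdot> F (act c D) = F (act d D) \<cdot> act_arrow a (G D)" if "D \<in> Obj C" for D
    using family_natural[OF fam(1) _ _ family_hom[OF fam(2) that]] o that by (simp add: act_obj)
  then show ?thesis
    using fam o unfolding eq by (auto simp: family_act family_right cong: restrict_cong)
qed

section \<open>Arrows of the category as diagrams\<close>

text \<open>
  The inverse of a commuting square commutes, so componentwise inverses form a family again.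
\<close>

lemma family_inverse:
  assumes F: "family a b F" and G: "G \<in> extensional (Obj C)"
    and inv: "\<And>D. D \<in> Obj C \<Longrightarrow> inverse_arrows C (act a D) (act b D) (F D) (G D)"
  shows "family b a G"
  unfolding family_def
proof (intro conjI ballI)
  note o[simp] = family_obj[OF F]
  fix D E f assume [simp]: "D \<in> Obj C" "E \<in> Obj C" and f[simp]: "f \<in> Hom C D E"
  show "G E \<cdot> act_arrow b f = act_arrow a f \<cdot> G D"
    by (rule reverse_square[OF inv inv arr_act arr_act]) (auto intro: family_natural[OF F])
next
  note o[simp] = family_obj[OF F]
  fix D E assume [simp]: "D \<in> Obj C" "E \<in> Obj C"
  note [simp] = act_obj tensor_obj
  show "G (D \<otimes> E) \<cdot> shift b D E = shift a D E \<cdot> (G D \<odot> ide C E)"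
    by (rule reverse_square[OF tensor_inverse[OF _ _ _ _ inv ide_inverse] inv arr_shift arr_shift])
       (auto intro: family_shift[OF F])
qed (use family_obj[OF F] G inverse_arrowsD(2)[OF inv] in auto)

lemma shift_singleton [simp]: "\<lbrakk>A \<in> Obj C; D \<in> Obj C; E \<in> Obj C\<rbrakk> \<Longrightarrow> shift [A] D E = assoc C A D E"
  using ide_left[OF _ _ assoc_hom[of A D E]] by (simp add: tensor_ide tensor_obj)

text \<open>
  Tensoring with the tail embeds the category into the diagrams between one-letter words.
\<close>

definition hat :: "'o \<Rightarrow> 'o \<Rightarrow> 'm \<Rightarrow> ('o, 'm) diag" where
  "hat A B f = (if A \<in> Obj C \<and> B \<in> Obj C \<and> f \<in> Hom C A B
     then Diag [A] (\<lambda>D\<in>Obj C. f \<odot> ide C D) [B] else Null)"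

lemma family_hat:
  assumes [simp]: "A \<in> Obj C" "B \<in> Obj C" "f \<in> Hom C A B"
  shows "family [A] [B] (\<lambda>D\<in>Obj C. f \<odot> ide C D)"
  unfolding family_def
proof (intro conjI ballI)
  fix D E h assume [simp]: "D \<in> Obj C" "E \<in> Obj C" "h \<in> Hom C D E"
  have "(f \<odot> ide C E) \<cdot> (ide C A \<odot> h) = (ide C B \<odot> h) \<cdot> (f \<odot> ide C D)"
    using interchange[of A A B D E E "ide C A" f h "ide C E"] interchange[of A B B D D E f "ide C B" "ide C D" h]
      ide_left[of D E h] ide_right[of D E h] ide_left[of A B f] ide_right[of A B f] ide_in by simp
  then show "(\<lambda>D\<in>Obj C. f \<odot> ide C D) E \<cdot> act_arrow [A] h = act_arrow [B] h \<cdot> (\<lambda>D\<in>Obj C. f \<odot> ide C D) D"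
    by simp
next
  fix D E assume [simp]: "D \<in> Obj C" "E \<in> Obj C"
  show "(\<lambda>D\<in>Obj C. f \<odot> ide C D) (D \<otimes> E) \<cdot> shift [A] D E = shift [B] D E \<cdot> ((\<lambda>D\<in>Obj C. f \<odot> ide C D) D \<odot> ide C E)"
    using assoc_natural[of A D E B D E f "ide C D" "ide C E"]
    by (simp add: ide_in tensor_obj tensor_ide del: shift.simps)
qed (auto intro: tensor_hom ide_in)

lemma valid_hat [simp]: "valid (hat A B f) \<longleftrightarrow> A \<in> Obj C \<and> B \<in> Obj C \<and> f \<in> Hom C A B"
  by (auto simp: hat_def family_hat)

lemma hat_simps [simp]:
  assumes "A \<in> Obj C" "B \<in> Obj C" "f \<in> Hom C A B"
  shows "src (hat A B f) = [A]" "tgt (hat A B f) = [B]" "D \<in> Obj C \<Longrightarrow> component (hat A B f) D = f \<odot> ide C D"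
  using assms by (auto simp: hat_def)

lemma hat_comp: "\<lbrakk>A \<in> Obj C; B \<in> Obj C; D \<in> Obj C; f \<in> Hom C A B; g \<in> Hom C B D\<rbrakk>
    \<Longrightarrow> hat A D (g \<cdot> f) = hat B D g \<bullet> hat A B f"
  using comp_in[of A B D f g]
  by (intro diag_eqI) (auto simp: tensor_ide_comp_left[where A = A and B = B and D = D])

lemma hat_ide [simp]: "A \<in> Obj C \<Longrightarrow> hat A A (ide C A) = idn [A]"
  by (rule diag_eqI) (auto simp: ide_in tensor_ide)

lemma hat_faithful: "\<lbrakk>A \<in> Obj C; B \<in> Obj C; f \<in> Hom C A B; g \<in> Hom C A B; hat A B f = hat A B g\<rbrakk> \<Longrightarrow> f = g"
  using unit_tensor_faithful[of f A B g] hat_simps(3)[of A B f \<one>] hat_simps(3)[of A B g \<one>] unit_obj by (simp add: arr_def)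

text \<open>
  The arrow is read off from the component at \<open>\<one>\<close>. Compatibility with tensoring on the right gives the
  component at \<open>\<one> \<otimes> D\<close>, and naturality along \<open>lunit D\<close> gives the one at \<open>D\<close>.
\<close>

lemma hat_full:
  assumes F: "valid F" and src: "src F = [A]" and tgt: "tgt F = [B]"
  obtains f where "f \<in> Hom C A B" "F = hat A B f"
proof -
  note o[simp] = structure_homs
  have [simp]: "A \<in> Obj C" "B \<in> Obj C" using valid_obj[OF F] src tgt by auto
  have F_hom[simp]: "component F D \<in> Hom C (A \<otimes> D) (B \<otimes> D)" if "D \<in> Obj C" for D
    using component_hom[OF F that] src tgt by simp
  have F_arr: "arr (component F D) (A \<otimes> D) (B \<otimes> D)" if "D \<in> Obj C" for D
    using that by (simp add: arr_def)
  note intros = arr_intros F_arr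
  let ?f = "runit C B \<cdot> component F \<one> \<cdot> runit' C A"
  have "arr ?f A B" by (rule intros | simp)+
  then have f[simp]: "?f \<in> Hom C A B" by (rule arrD)
  note F1 = F_arr[OF unit_obj] and u = arr_structure(3)[OF \<open>A \<in> Obj C\<close>] and u' = arr_structure(4)[OF \<open>A \<in> Obj C\<close>]
  have f_runit: "?f \<cdot> runit C A = runit C B \<cdot> component F \<one>"
    using arr_comp_assoc[OF u arr_comp[OF F1 u'] arr_structure(3)] arr_comp_assoc[OF u u' F1] arr_ide_right[OF F1]
    by (simp add: runit'_runit)
  have eq: "component F D = ?f \<odot> ide C D" if [simp]: "D \<in> Obj C" for D
  proof -
    have inv: "inverse_arrows C ((A \<otimes> \<one>) \<otimes> D) (A \<otimes> D) (runit C A \<odot> ide C D) (runit' C A \<odot> ide C D)"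
      by (rule tensor_inverse) (auto intro: runit_inverse ide_inverse)
    have "((ide C B \<odot> lunit C D) \<cdot> assoc C B \<one> D) \<cdot> (component F \<one> \<odot> ide C D)
        = component F D \<cdot> ((ide C A \<odot> lunit C D) \<cdot> assoc C A \<one> D)"
    proof (rule paste_squares)
      show "assoc C B \<one> D \<cdot> (component F \<one> \<odot> ide C D) = component F (\<one> \<otimes> D) \<cdot> assoc C A \<one> D"
        using component_shift[OF F, of \<one> D] src tgt by (simp del: shift.simps)
      show "(ide C B \<odot> lunit C D) \<cdot> component F (\<one> \<otimes> D) = component F D \<cdot> (ide C A \<odot> lunit C D)"
        using component_natural[OF F, of "\<one> \<otimes> D" D "lunit C D"] src tgt by simp
    qed (rule intros | simp)+
    then have "component F D \<cdot> (runit C A \<odot> ide C D) = (runit C B \<odot> ide C D) \<cdot> (component F \<one> \<odot> ide C D)"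
      by (simp add: triangle)
    also have "\<dots> = (runit C B \<cdot> component F \<one>) \<odot> ide C D"
      by (rule tensor_ide_comp_left[symmetric, of "A \<otimes> \<one>" "B \<otimes> \<one>" B]) auto
    also have "\<dots> = (?f \<odot> ide C D) \<cdot> (runit C A \<odot> ide C D)"
      unfolding f_runit[symmetric] by (rule tensor_ide_comp_left[of "A \<otimes> \<one>" A B]) (use f in auto)
    finally show ?thesis
      by (rule cancel_iso_right[OF _ _ inv, rotated -1]) (rule intros | simp)+
  qed
  have "F = hat A B ?f"
  proof (rule diag_eqI)
    show "component F D = component (hat A B ?f) D" if "D \<in> Obj C" for D
      using eq[OF that] hat_simps(3)[OF _ _ f that] by simp
  qed (use F src tgt in auto)
  with f show ?thesis by (rule that)
qed

text \<open>
  The associativity constraint, read as a diagram that splits the strand \<open>A \<otimes> B\<close> into two.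
\<close>

definition split :: "'o \<Rightarrow> 'o \<Rightarrow> ('o, 'm) diag" where
  "split A B = (if A \<in> Obj C \<and> B \<in> Obj C then Diag [A \<otimes> B] (\<lambda>D\<in>Obj C. assoc C A B D) [A, B] else Null)"

definition merge :: "'o \<Rightarrow> 'o \<Rightarrow> ('o, 'm) diag" where
  "merge A B = (if A \<in> Obj C \<and> B \<in> Obj C then Diag [A, B] (\<lambda>D\<in>Obj C. assoc' C A B D) [A \<otimes> B] else Null)"

text \<open>
  The left unit constraint, read as a diagram that erases the strand \<open>\<one>\<close>.
\<close>

definition unt :: "('o, 'm) diag" where
  "unt = Diag [\<one>] (\<lambda>D\<in>Obj C. lunit C D) []"

definition unt' :: "('o, 'm) diag" where
  "unt' = Diag [] (\<lambda>D\<in>Obj C. lunit' C D) [\<one>]"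

text \<open>
  Compatibility with tensoring on the right is the pentagon.
\<close>

lemma family_split:
  assumes [simp]: "A \<in> Obj C" "B \<in> Obj C"
  shows "family [A \<otimes> B] [A, B] (\<lambda>D\<in>Obj C. assoc C A B D)"
  unfolding family_def
proof (intro conjI ballI)
  note [simp] = structure_homs
  fix D E h assume [simp]: "D \<in> Obj C" "E \<in> Obj C" "h \<in> Hom C D E"
  show "(\<lambda>D\<in>Obj C. assoc C A B D) E \<cdot> act_arrow [A \<otimes> B] h = act_arrow [A, B] h \<cdot> (\<lambda>D\<in>Obj C. assoc C A B D) D"
    using assoc_natural[of A B D A B E "ide C A" "ide C B" h] by (simp add: tensor_ide)
next
  note [simp] = structure_homs
  fix D E assume [simp]: "D \<in> Obj C" "E \<in> Obj C"
  have "assoc C A B (D \<otimes> E) \<cdot> assoc C (A \<otimes> B) D E =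
      ((ide C A \<odot> assoc C B D E) \<cdot> assoc C A (B \<otimes> D) E) \<cdot> (assoc C A B D \<odot> ide C E)"
    by (subst comp_assoc[where A = "((A \<otimes> B) \<otimes> D) \<otimes> E" and B = "(A \<otimes> (B \<otimes> D)) \<otimes> E" and D = "A \<otimes> ((B \<otimes> D) \<otimes> E)"
          and E = "A \<otimes> (B \<otimes> (D \<otimes> E))"]) (auto simp: pentagon)
  then show "(\<lambda>D\<in>Obj C. assoc C A B D) (D \<otimes> E) \<cdot> shift [A \<otimes> B] D E
      = shift [A, B] D E \<cdot> ((\<lambda>D\<in>Obj C. assoc C A B D) D \<odot> ide C E)"
    by (simp add: shift.simps(2)[of A "[B]"] del: shift.simps)
qed (auto intro: structure_homs)

lemma family_merge:
  assumes "A \<in> Obj C" "B \<in> Obj C"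
  shows "family [A, B] [A \<otimes> B] (\<lambda>D\<in>Obj C. assoc' C A B D)"
  by (rule family_inverse[OF family_split[OF assms]])
     (use assms assoc_inverse in auto)

text \<open>
  Compatibility with tensoring on the right is \<open>lunit_tensor\<close>.
\<close>

lemma family_unt: "family [\<one>] [] (\<lambda>D\<in>Obj C. lunit C D)"
  unfolding family_def
proof (intro conjI ballI)
  note [simp] = structure_homs
  fix D E assume [simp]: "D \<in> Obj C" "E \<in> Obj C"
  show "(\<lambda>D\<in>Obj C. lunit C D) (D \<otimes> E) \<cdot> shift [\<one>] D E = shift [] D E \<cdot> ((\<lambda>D\<in>Obj C. lunit C D) D \<odot> ide C E)"
    using lunit_tensor[of D E] ide_left[of "(\<one> \<otimes> D) \<otimes> E" "D \<otimes> E" "lunit C D \<odot> ide C E"]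
    by (simp del: shift.simps(2))
qed (auto intro: structure_homs lunit_natural)

lemma family_unt': "family [] [\<one>] (\<lambda>D\<in>Obj C. lunit' C D)"
  by (rule family_inverse[OF family_unt]) (use lunit_inverse in auto)

lemma valid_structure [simp]:
  "valid (split A B) \<longleftrightarrow> A \<in> Obj C \<and> B \<in> Obj C"
  "valid (merge A B) \<longleftrightarrow> A \<in> Obj C \<and> B \<in> Obj C"
  "valid unt" "valid unt'"
  by (auto simp: split_def merge_def unt_def unt'_def family_split family_merge family_unt family_unt')

lemma structure_simps [simp]:
  "src unt = [\<one>]" "tgt unt = []" "src unt' = []" "tgt unt' = [\<one>]"
  "D \<in> Obj C \<Longrightarrow> component unt D = lunit C D"
  "D \<in> Obj C \<Longrightarrow> component unt' D = lunit' C D"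
  "\<lbrakk>A \<in> Obj C; B \<in> Obj C\<rbrakk> \<Longrightarrow> src (split A B) = [A \<otimes> B]"
  "\<lbrakk>A \<in> Obj C; B \<in> Obj C\<rbrakk> \<Longrightarrow> tgt (split A B) = [A, B]"
  "\<lbrakk>A \<in> Obj C; B \<in> Obj C\<rbrakk> \<Longrightarrow> src (merge A B) = [A, B]"
  "\<lbrakk>A \<in> Obj C; B \<in> Obj C\<rbrakk> \<Longrightarrow> tgt (merge A B) = [A \<otimes> B]"
  "\<lbrakk>A \<in> Obj C; B \<in> Obj C; D \<in> Obj C\<rbrakk> \<Longrightarrow> component (split A B) D = assoc C A B D"
  "\<lbrakk>A \<in> Obj C; B \<in> Obj C; D \<in> Obj C\<rbrakk> \<Longrightarrow> component (merge A B) D = assoc' C A B D"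
  by (auto simp: split_def merge_def unt_def unt'_def)

lemma split_merge: "\<lbrakk>A \<in> Obj C; B \<in> Obj C\<rbrakk> \<Longrightarrow> split A B \<bullet> merge A B = idn [A, B]"
  and merge_split: "\<lbrakk>A \<in> Obj C; B \<in> Obj C\<rbrakk> \<Longrightarrow> merge A B \<bullet> split A B = idn [A \<otimes> B]"
  and unt_unt': "unt \<bullet> unt' = idn []"
  and unt'_unt: "unt' \<bullet> unt = idn [\<one>]"
  by (rule diag_eqI; simp add: structure_homs assoc_assoc' assoc'_assoc lunit_lunit' lunit'_lunit)+

text \<open>
  Composites are kept associated to the right; this form of an equation rewrites inside a longer composite.
\<close>

lemma pre: "g \<bullet> f = h \<Longrightarrow> g \<bullet> (f \<bullet> x) = h \<bullet> x"
  by (simp add: comp_assoc_diag[symmetric])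

lemma whisk: "g \<bullet> f = h \<Longrightarrow> (l \<rhd> g \<lhd> r) \<bullet> (l \<rhd> f \<lhd> r) = l \<rhd> h \<lhd> r"
  by (metis lwhisk_comp rwhisk_comp)

lemmas whisk_simps = lwhisk_comp rwhisk_comp lwhisk_lwhisk rwhisk_rwhisk lwhisk_rwhisk comp_assoc_diag

lemma pre_inverse: "\<lbrakk>g \<bullet> f = idn a; valid x; tgt x = a\<rbrakk> \<Longrightarrow> g \<bullet> (f \<bullet> x) = x"
  by (simp add: comp_assoc_diag[symmetric])

lemma solve_left: "\<lbrakk>f \<bullet> x = y; g \<bullet> f = idn a; valid x; tgt x = a\<rbrakk> \<Longrightarrow> x = g \<bullet> y"
  using pre_inverse by metis

lemma solve_right: "\<lbrakk>x \<bullet> f = y; f \<bullet> g = idn a; valid x; src x = a\<rbrakk> \<Longrightarrow> x = y \<bullet> g"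
  by (metis comp_assoc_diag comp_idn)

lemma inverse_diag_unique: "\<lbrakk>g \<bullet> f = idn a; f \<bullet> h = idn b; valid g; valid h; src g = b; tgt h = a\<rbrakk> \<Longrightarrow> g = h"
  by (metis comp_assoc_diag comp_idn idn_comp)

lemma hat_tensor_left:
  assumes [simp]: "A \<in> Obj C" "A' \<in> Obj C" "B \<in> Obj C" "f \<in> Hom C A A'"
  shows "hat (A \<otimes> B) (A' \<otimes> B) (f \<odot> ide C B) = merge A' B \<bullet> (hat A A' f \<lhd> [B]) \<bullet> split A B"
proof -
  note [simp] = structure_homs
  have "split A' B \<bullet> hat (A \<otimes> B) (A' \<otimes> B) (f \<odot> ide C B) = (hat A A' f \<lhd> [B]) \<bullet> split A B"
    by (rule diag_eqI) (use assoc_natural[of A B _ A' B _ f "ide C B" "ide C _"] in \<open>auto simp: tensor_ide\<close>)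
  then show ?thesis by (rule solve_left[OF _ merge_split]) auto
qed

lemma hat_tensor_right:
  assumes [simp]: "B \<in> Obj C" "B' \<in> Obj C" "A \<in> Obj C" "f \<in> Hom C B B'"
  shows "hat (A \<otimes> B) (A \<otimes> B') (ide C A \<odot> f) = merge A B' \<bullet> ([A] \<rhd> hat B B' f) \<bullet> split A B"
proof -
  note [simp] = structure_homs
  have "split A B' \<bullet> hat (A \<otimes> B) (A \<otimes> B') (ide C A \<odot> f) = ([A] \<rhd> hat B B' f) \<bullet> split A B"
    by (rule diag_eqI) (use assoc_natural[of A B _ A B' _ "ide C A" f "ide C _"] in auto)
  then show ?thesis by (rule solve_left[OF _ merge_split]) auto
qed

lemma hat_tensor:
  assumes [simp]: "A \<in> Obj C" "A' \<in> Obj C" "B \<in> Obj C" "B' \<in> Obj C" "f \<in> Hom C A A'" "g \<in> Hom C B B'"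
  shows "hat (A \<otimes> B) (A' \<otimes> B') (f \<odot> g) = merge A' B' \<bullet> (hat A A' f \<lhd> [B']) \<bullet> ([A] \<rhd> hat B B' g) \<bullet> split A B"
proof -
  note [simp] = structure_homs
  have "f \<odot> g = (f \<odot> ide C B') \<cdot> (ide C A \<odot> g)"
    using interchange[of A A A' B B' B' "ide C A" f g "ide C B'"] ide_right[of A A' f] ide_left[of B B' g] by simp
  then show ?thesis
    using pre_inverse[OF split_merge[of A B']]
    by (simp add: hat_comp[where A = "A \<otimes> B" and B = "A \<otimes> B'" and D = "A' \<otimes> B'"] hat_tensor_left hat_tensor_right comp_assoc_diag)
qed

text \<open>
  The pentagon again, now with its last object as the tail.
\<close>

lemma hat_assoc:
  assumes [simp]: "A \<in> Obj C" "B \<in> Obj C" "E \<in> Obj C"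
  shows "hat ((A \<otimes> B) \<otimes> E) (A \<otimes> (B \<otimes> E)) (assoc C A B E) =
    merge A (B \<otimes> E) \<bullet> ([A] \<rhd> merge B E) \<bullet> (split A B \<lhd> [E]) \<bullet> split (A \<otimes> B) E" (is "?h = _")
proof -
  note [simp] = structure_homs
  have "([A] \<rhd> split B E) \<bullet> (split A (B \<otimes> E) \<bullet> ?h) = (split A B \<lhd> [E]) \<bullet> split (A \<otimes> B) E"
    by (rule diag_eqI) (auto simp: pentagon)
  moreover have "([A] \<rhd> merge B E) \<bullet> ([A] \<rhd> split B E) = idn [A, B \<otimes> E]"
    by (simp add: lwhisk_comp[symmetric] merge_split)
  ultimately have "split A (B \<otimes> E) \<bullet> ?h = ([A] \<rhd> merge B E) \<bullet> (split A B \<lhd> [E]) \<bullet> split (A \<otimes> B) E"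
    by (rule solve_left) auto
  then show ?thesis by (rule solve_left[OF _ merge_split]) auto
qed

lemma hat_inverse:
  assumes "A \<in> Obj C" "B \<in> Obj C" "inverse_arrows C A B f g" "hat A B f \<bullet> x = idn [B]" "valid x" "tgt x = [A]"
  shows "hat B A g = x"
proof -
  note f = inverse_arrowsD[OF assms(3)]
  have "hat B A g \<bullet> hat A B f = idn [A]"
    using hat_comp[OF assms(1,2,1) f(1,2)] f(3) assms(1) by simp
  then show ?thesis
    by (rule inverse_diag_unique[OF _ assms(4)]) (use assms f in auto)
qed

lemma hat_assoc':
  assumes [simp]: "A \<in> Obj C" "B \<in> Obj C" "E \<in> Obj C"
  shows "hat (A \<otimes> (B \<otimes> E)) ((A \<otimes> B) \<otimes> E) (assoc' C A B E) =
    merge (A \<otimes> B) E \<bullet> (merge A B \<lhd> [E]) \<bullet> ([A] \<rhd> split B E) \<bullet> split A (B \<otimes> E)"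
proof (rule hat_inverse[OF _ _ assoc_inverse])
  note [simp] = structure_homs
  have 1: "([A] \<rhd> merge B E) \<bullet> ([A] \<rhd> split B E) = idn [A, B \<otimes> E]"
    and 2: "(split A B \<lhd> [E]) \<bullet> (merge A B \<lhd> [E]) = idn [A, B, E]"
    by (simp_all add: lwhisk_comp[symmetric] rwhisk_comp[symmetric] merge_split split_merge)
  show "hat ((A \<otimes> B) \<otimes> E) (A \<otimes> (B \<otimes> E)) (assoc C A B E) \<bullet>
      merge (A \<otimes> B) E \<bullet> (merge A B \<lhd> [E]) \<bullet> ([A] \<rhd> split B E) \<bullet> split A (B \<otimes> E) = idn [A \<otimes> (B \<otimes> E)]"
    by (simp add: hat_assoc comp_assoc_diag pre_inverse[OF split_merge] pre_inverse[OF 1] pre_inverse[OF 2] merge_split)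
qed (simp_all add: structure_homs)

lemma hat_lunit: "A \<in> Obj C \<Longrightarrow> hat (\<one> \<otimes> A) A (lunit C A) = (unt \<lhd> [A]) \<bullet> split \<one> A"
  by (rule diag_eqI) (auto simp: structure_homs lunit_tensor)

lemma hat_runit: "A \<in> Obj C \<Longrightarrow> hat (A \<otimes> \<one>) A (runit C A) = ([A] \<rhd> unt) \<bullet> split A \<one>"
  by (rule diag_eqI) (auto simp: structure_homs triangle)

lemma whisk_unt:
  "set l \<subseteq> Obj C \<Longrightarrow> (l \<rhd> unt) \<bullet> (l \<rhd> unt') = idn l"
  "set l \<subseteq> Obj C \<Longrightarrow> (unt \<lhd> l) \<bullet> (unt' \<lhd> l) = idn l"
  by (simp_all add: lwhisk_comp[symmetric] rwhisk_comp[symmetric] unt_unt')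

lemma hat_runit': "A \<in> Obj C \<Longrightarrow> hat A (A \<otimes> \<one>) (runit' C A) = merge A \<one> \<bullet> ([A] \<rhd> unt')"
  by (rule hat_inverse[OF _ _ runit_inverse])
     (auto simp: structure_homs hat_runit comp_assoc_diag pre_inverse[OF split_merge] whisk_unt)

section \<open>Translating composites into diagrams\<close>

text \<open>
  The rules for this relation follow the syntax of \<open>f\<close>. Resolution with them checks the type of a composite of
  structure arrows and produces its diagram, without the intermediate objects having to be named.
\<close>

definition repr :: "'o \<Rightarrow> 'o \<Rightarrow> 'm \<Rightarrow> ('o, 'm) diag \<Rightarrow> bool" where
  "repr A B f F \<longleftrightarrow> A \<in> Obj C \<and> B \<in> Obj C \<and> f \<in> Hom C A B \<and> hat A B f = F"

lemma reprD: "repr A B f F \<Longrightarrow> A \<in> Obj C" "repr A B f F \<Longrightarrow> B \<in> Obj C" "repr A B f F \<Longrightarrow> f \<in> Hom C A B"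
  "repr A B f F \<Longrightarrow> hat A B f = F"
  by (auto simp: repr_def)

lemma repr_hat: "\<lbrakk>A \<in> Obj C; B \<in> Obj C; f \<in> Hom C A B\<rbrakk> \<Longrightarrow> repr A B f (hat A B f)"
  by (simp add: repr_def)

lemma repr_comp: "\<lbrakk>repr B D g G; repr A B f F\<rbrakk> \<Longrightarrow> repr A D (g \<cdot> f) (G \<bullet> F)"
  using comp_in[of A B D f g] by (auto simp: repr_def hat_comp)

lemma repr_left: "\<lbrakk>repr A A' f F; B \<in> Obj C\<rbrakk>
    \<Longrightarrow> repr (A \<otimes> B) (A' \<otimes> B) (f \<odot> ide C B) (merge A' B \<bullet> (F \<lhd> [B]) \<bullet> split A B)"
  by (auto simp: repr_def hat_tensor_left structure_homs)

lemma repr_right: "\<lbrakk>repr B B' f F; A \<in> Obj C\<rbrakk>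
    \<Longrightarrow> repr (A \<otimes> B) (A \<otimes> B') (ide C A \<odot> f) (merge A B' \<bullet> ([A] \<rhd> F) \<bullet> split A B)"
  by (auto simp: repr_def hat_tensor_right structure_homs)

lemma repr_tensor: "\<lbrakk>repr A A' f F; repr B B' g G\<rbrakk>
    \<Longrightarrow> repr (A \<otimes> B) (A' \<otimes> B') (f \<odot> g) (merge A' B' \<bullet> (F \<lhd> [B']) \<bullet> ([A] \<rhd> G) \<bullet> split A B)"
  by (auto simp: repr_def hat_tensor structure_homs)

lemma repr_assoc: "\<lbrakk>A \<in> Obj C; B \<in> Obj C; E \<in> Obj C\<rbrakk> \<Longrightarrow> repr ((A \<otimes> B) \<otimes> E) (A \<otimes> (B \<otimes> E)) (assoc C A B E)
    (merge A (B \<otimes> E) \<bullet> ([A] \<rhd> merge B E) \<bullet> (split A B \<lhd> [E]) \<bullet> split (A \<otimes> B) E)"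
  and repr_assoc': "\<lbrakk>A \<in> Obj C; B \<in> Obj C; E \<in> Obj C\<rbrakk> \<Longrightarrow> repr (A \<otimes> (B \<otimes> E)) ((A \<otimes> B) \<otimes> E) (assoc' C A B E)
    (merge (A \<otimes> B) E \<bullet> (merge A B \<lhd> [E]) \<bullet> ([A] \<rhd> split B E) \<bullet> split A (B \<otimes> E))"
  and repr_lunit: "A \<in> Obj C \<Longrightarrow> repr (\<one> \<otimes> A) A (lunit C A) ((unt \<lhd> [A]) \<bullet> split \<one> A)"
  and repr_runit: "A \<in> Obj C \<Longrightarrow> repr (A \<otimes> \<one>) A (runit C A) (([A] \<rhd> unt) \<bullet> split A \<one>)"
  and repr_runit': "A \<in> Obj C \<Longrightarrow> repr A (A \<otimes> \<one>) (runit' C A) (merge A \<one> \<bullet> ([A] \<rhd> unt'))"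
  by (auto simp: repr_def hat_assoc hat_assoc' hat_lunit hat_runit hat_runit' structure_homs)

lemma hom_hat: "\<lbrakk>A \<in> Obj C; B \<in> Obj C; f \<in> Hom C A B\<rbrakk> \<Longrightarrow> hom (hat A B f) [A] [B]"
  by (simp add: hom_def)

text \<open>
  Two boxes side by side can be passed along their strands even if they are separated by strands \<open>k\<close> and
  flanked by strands \<open>l\<close> and \<open>r\<close>.
\<close>

lemma exch:
  assumes "hom f a b" "hom g c d"
  shows "((l @ b @ k) \<rhd> (g \<lhd> r)) \<bullet> (l \<rhd> (f \<lhd> (k @ c @ r))) = (l \<rhd> (f \<lhd> (k @ d @ r))) \<bullet> ((l @ a @ k) \<rhd> (g \<lhd> r))"
proof (cases "set k \<subseteq> Obj C")
  case True
  have "hom (k \<rhd> g) (k @ c) (k @ d)" using assms(2) True by (simp add: hom_def)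
  from whisk[OF exchange[OF assms(1) this], of l r]
  show ?thesis by (simp add: whisk_simps)
next
  case False
  have "(l @ b @ k) \<rhd> g \<lhd> r = Null" "(l @ a @ k) \<rhd> g \<lhd> r = Null"
    using False by (simp_all add: invalid_lwhisk)
  then show ?thesis by simp
qed

lemma split_merge_whisk [simp]:
  assumes "A \<in> Obj C" "B \<in> Obj C"
  shows "(l \<rhd> (split A B \<lhd> r)) \<bullet> (l \<rhd> (merge A B \<lhd> r)) = idn (l @ [A, B] @ r)"
    "(l \<rhd> split A B) \<bullet> (l \<rhd> merge A B) = idn (l @ [A, B])"
    "(split A B \<lhd> r) \<bullet> (merge A B \<lhd> r) = idn ([A, B] @ r)"
    "split A B \<bullet> merge A B = idn [A, B]"
  using whisk[OF split_merge[OF assms]] 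
  by (simp_all add: lwhisk_comp[symmetric] rwhisk_comp[symmetric] split_merge[OF assms])

lemma merge_split_whisk [simp]:
  assumes "A \<in> Obj C" "B \<in> Obj C"
  shows "(l \<rhd> (merge A B \<lhd> r)) \<bullet> (l \<rhd> (split A B \<lhd> r)) = idn (l @ [A \<otimes> B] @ r)"
    "(l \<rhd> merge A B) \<bullet> (l \<rhd> split A B) = idn (l @ [A \<otimes> B])"
    "(merge A B \<lhd> r) \<bullet> (split A B \<lhd> r) = idn ([A \<otimes> B] @ r)"
    "merge A B \<bullet> split A B = idn [A \<otimes> B]"
  using whisk[OF merge_split[OF assms]]
  by (simp_all add: lwhisk_comp[symmetric] rwhisk_comp[symmetric] merge_split[OF assms])

lemma unt_whisk [simp]:
  "(l \<rhd> (unt \<lhd> r)) \<bullet> (l \<rhd> (unt' \<lhd> r)) = idn (l @ r)"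
  "(l \<rhd> unt) \<bullet> (l \<rhd> unt') = idn l" "(unt \<lhd> r) \<bullet> (unt' \<lhd> r) = idn r" "unt \<bullet> unt' = idn []"
  by (simp_all add: lwhisk_comp[symmetric] rwhisk_comp[symmetric] unt_unt')

lemma unt'_whisk [simp]:
  "(l \<rhd> (unt' \<lhd> r)) \<bullet> (l \<rhd> (unt \<lhd> r)) = idn (l @ [\<one>] @ r)"
  "(l \<rhd> unt') \<bullet> (l \<rhd> unt) = idn (l @ [\<one>])" "(unt' \<lhd> r) \<bullet> (unt \<lhd> r) = idn ([\<one>] @ r)" "unt' \<bullet> unt = idn [\<one>]"
  by (simp_all add: lwhisk_comp[symmetric] rwhisk_comp[symmetric] unt'_unt)

lemmas cancel_whisk = split_merge_whisk[THEN pre_inverse] merge_split_whisk[THEN pre_inverse]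
  unt_whisk[THEN pre_inverse] unt'_whisk[THEN pre_inverse]

definition pairing :: "'o \<Rightarrow> 'o \<Rightarrow> 'm \<Rightarrow> ('o, 'm) diag" where
  "pairing B A e = unt \<bullet> hat (B \<otimes> A) \<one> e \<bullet> merge B A"

lemma pairing_simps [simp]:
  assumes "A \<in> Obj C" "B \<in> Obj C" "e \<in> Hom C (B \<otimes> A) \<one>"
  shows "valid (pairing B A e)" "src (pairing B A e) = [B, A]" "tgt (pairing B A e) = []"
  using assms by (simp_all add: pairing_def structure_homs)

end

section \<open>Duals\<close>

context rigid_category
begin

lemma dual_obj [simp]: "X \<in> Obj C \<Longrightarrow> dual C X \<in> Obj C"
  and ev_hom: "X \<in> Obj C \<Longrightarrow> ev C X \<in> Hom C (dual C X \<otimes> X) \<one>"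
  and coev_hom: "X \<in> Obj C \<Longrightarrow> coev C X \<in> Hom C \<one> (X \<otimes> dual C X)"
  using left_dual by (auto simp: is_left_dual_def)

definition cap :: "'o \<Rightarrow> ('o, 'm) diag" where
  "cap X = pairing (dual C X) X (ev C X)"

definition cup :: "'o \<Rightarrow> ('o, 'm) diag" where
  "cup X = split X (dual C X) \<bullet> hat \<one> (X \<otimes> dual C X) (coev C X) \<bullet> unt'"

lemma cap_cup_simps [simp]:
  assumes "X \<in> Obj C"
  shows "valid (cap X)" "src (cap X) = [dual C X, X]" "tgt (cap X) = []"
    "valid (cup X)" "src (cup X) = []" "tgt (cup X) = [X, dual C X]"
  using assms by (simp_all add: cap_def cup_def ev_hom coev_hom structure_homs)

lemma hom_cap: "X \<in> Obj C \<Longrightarrow> hom (cap X) [dual C X, X] []"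
  and hom_cup: "X \<in> Obj C \<Longrightarrow> hom (cup X) [] [X, dual C X]"
  by (simp_all add: hom_def)

text \<open>
  The associativity and unit constraints of the duality axiom disappear under translation.
\<close>

lemma zigzag_object:
  assumes [simp]: "X \<in> Obj C"
  shows "([X] \<rhd> cap X) \<bullet> (cup X \<lhd> [X]) = idn [X]"
proof -
  note [simp] = structure_homs ev_hom coev_hom
  let ?D = "dual C X"
  have "runit C X \<cdot> (ide C X \<odot> ev C X) \<cdot> assoc C X ?D X \<cdot> (coev C X \<odot> ide C X) = lunit C X"
    using left_dual[of X] by (simp add: is_left_dual_def)
  moreover have "repr (\<one> \<otimes> X) X (runit C X \<cdot> (ide C X \<odot> ev C X) \<cdot> assoc C X ?D X \<cdot> (coev C X \<odot> ide C X)) 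
      (([X] \<rhd> cap X) \<bullet> (cup X \<lhd> [X]) \<bullet> (unt \<lhd> [X]) \<bullet> split \<one> X)" (is "repr _ _ ?f ?F")
  proof -
    have "repr (\<one> \<otimes> X) X ?f ((([X] \<rhd> unt) \<bullet> split X \<one>) \<bullet>
      (merge X \<one> \<bullet> ([X] \<rhd> hat (?D \<otimes> X) \<one> (ev C X)) \<bullet> split X (?D \<otimes> X)) \<bullet>
      (merge X (?D \<otimes> X) \<bullet> ([X] \<rhd> merge ?D X) \<bullet> (split X ?D \<lhd> [X]) \<bullet> split (X \<otimes> ?D) X) \<bullet>
      (merge (X \<otimes> ?D) X \<bullet> (hat \<one> (X \<otimes> ?D) (coev C X) \<lhd> [X]) \<bullet> split \<one> X))" (is "repr _ _ _ ?G")
      by (rule repr_comp repr_runit repr_right repr_assoc repr_left repr_hat | simp)+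
    also have "?G = ?F"
      by (simp add: whisk_simps cancel_whisk cap_def cup_def pairing_def)
    finally show ?thesis .
  qed
  ultimately have "(([X] \<rhd> cap X) \<bullet> (cup X \<lhd> [X])) \<bullet> ((unt \<lhd> [X]) \<bullet> split \<one> X) = (unt \<lhd> [X]) \<bullet> split \<one> X"
    using repr_lunit[of X] by (simp add: repr_def comp_assoc_diag)
  from solve_right[OF this, of "merge \<one> X \<bullet> (unt' \<lhd> [X])" "[X]"]
  show ?thesis by (simp add: comp_assoc_diag cancel_whisk)
qed

lemma zigzag_dual:
  assumes [simp]: "X \<in> Obj C"
  shows "(cap X \<lhd> [dual C X]) \<bullet> ([dual C X] \<rhd> cup X) = idn [dual C X]"
proof -
  note [simp] = structure_homs ev_hom coev_hom
  let ?D = "dual C X"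
  have "lunit C ?D \<cdot> (ev C X \<odot> ide C ?D) \<cdot> assoc' C ?D X ?D \<cdot> (ide C ?D \<odot> coev C X) = runit C ?D"
    using left_dual[of X] by (simp add: is_left_dual_def)
  moreover have "repr (?D \<otimes> \<one>) ?D (lunit C ?D \<cdot> (ev C X \<odot> ide C ?D) \<cdot> assoc' C ?D X ?D \<cdot> (ide C ?D \<odot> coev C X)) 
      ((cap X \<lhd> [?D]) \<bullet> ([?D] \<rhd> cup X) \<bullet> ([?D] \<rhd> unt) \<bullet> split ?D \<one>)" (is "repr _ _ ?f ?F")
  proof -
    have "repr (?D \<otimes> \<one>) ?D ?f (((unt \<lhd> [?D]) \<bullet> split \<one> ?D) \<bullet>
      (merge \<one> ?D \<bullet> (hat (?D \<otimes> X) \<one> (ev C X) \<lhd> [?D]) \<bullet> split (?D \<otimes> X) ?D) \<bullet>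
      (merge (?D \<otimes> X) ?D \<bullet> (merge ?D X \<lhd> [?D]) \<bullet> ([?D] \<rhd> split X ?D) \<bullet> split ?D (X \<otimes> ?D)) \<bullet>
      (merge ?D (X \<otimes> ?D) \<bullet> ([?D] \<rhd> hat \<one> (X \<otimes> ?D) (coev C X)) \<bullet> split ?D \<one>))" (is "repr _ _ _ ?G")
      by (rule repr_comp repr_lunit repr_right repr_assoc' repr_left repr_hat | simp)+
    also have "?G = ?F"
      by (simp add: whisk_simps cancel_whisk cap_def cup_def pairing_def)
    finally show ?thesis .
  qed
  ultimately have "((cap X \<lhd> [?D]) \<bullet> ([?D] \<rhd> cup X)) \<bullet> (([?D] \<rhd> unt) \<bullet> split ?D \<one>) = ([?D] \<rhd> unt) \<bullet> split ?D \<one>"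
    using repr_runit[of ?D] by (simp add: repr_def comp_assoc_diag)
  from solve_right[OF this, of "merge ?D \<one> \<bullet> ([?D] \<rhd> unt')" "[?D]"]
  show ?thesis by (simp add: comp_assoc_diag cancel_whisk)
qed

text \<open>
  Bends the last input of a pairing around to become an output.
\<close>

definition curry :: "'o \<Rightarrow> 'o \<Rightarrow> ('o, 'm) diag \<Rightarrow> ('o, 'm) diag" where
  "curry B A e = (e \<lhd> [dual C A]) \<bullet> ([B] \<rhd> cup A)"

lemma repr_curry_pairing:
  assumes [simp]: "A \<in> Obj C" "B \<in> Obj C" "e \<in> Hom C (B \<otimes> A) \<one>"
  shows "repr B (dual C A) (curry_pairing C B A e) (curry B A (pairing B A e))" (is "repr _ _ _ ?F")
proof -
  note [simp] = structure_homs ev_hom coev_hom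
  let ?D = "dual C A"
  have "repr B ?D (curry_pairing C B A e) (((unt \<lhd> [?D]) \<bullet> split \<one> ?D) \<bullet>
      (merge \<one> ?D \<bullet> (hat (B \<otimes> A) \<one> e \<lhd> [?D]) \<bullet> split (B \<otimes> A) ?D) \<bullet>
      (merge (B \<otimes> A) ?D \<bullet> (merge B A \<lhd> [?D]) \<bullet> ([B] \<rhd> split A ?D) \<bullet> split B (A \<otimes> ?D)) \<bullet>
      (merge B (A \<otimes> ?D) \<bullet> ([B] \<rhd> hat \<one> (A \<otimes> ?D) (coev C A)) \<bullet> split B \<one>) \<bullet>
      (merge B \<one> \<bullet> ([B] \<rhd> unt')))" (is "repr _ _ _ ?G")
    unfolding curry_pairing_def
    by (rule repr_comp repr_lunit repr_right repr_assoc' repr_left repr_hat repr_runit' | simp)+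
  also have "?G = ?F"
    by (simp add: whisk_simps cancel_whisk curry_def cup_def pairing_def)
  finally show ?thesis .
qed

lemma curry_simps [simp]:
  assumes "A \<in> Obj C" "hom e [B, A] []"
  shows "valid (curry B A e)" "src (curry B A e) = [B]" "tgt (curry B A e) = [dual C A]"
  using assms hom_obj[OF assms(2)] by (simp_all add: curry_def hom_def)

text \<open>
  The bent strand is pulled straight.
\<close>

lemma cap_curry:
  assumes [simp]: "A \<in> Obj C" and e: "hom e [B, A] []"
  shows "cap A \<bullet> (curry B A e \<lhd> [A]) = e"
proof -
  note [simp] = hom_simps[OF e]
  have [simp]: "B \<in> Obj C" using hom_obj[OF e] by simp
  have "cap A \<bullet> (curry B A e \<lhd> [A]) = (cap A \<bullet> (e \<lhd> [dual C A, A])) \<bullet> ([B] \<rhd> cup A \<lhd> [A])"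
    by (simp add: curry_def whisk_simps)
  also have "cap A \<bullet> (e \<lhd> [dual C A, A]) = e \<bullet> ([B, A] \<rhd> cap A)"
    using exch[OF e hom_cap[of A], of "[]" "[]" "[]"] by simp
  also have "(e \<bullet> ([B, A] \<rhd> cap A)) \<bullet> ([B] \<rhd> cup A \<lhd> [A]) = e \<bullet> ([B] \<rhd> (([A] \<rhd> cap A) \<bullet> (cup A \<lhd> [A])))"
    by (simp add: whisk_simps)
  finally show ?thesis by (simp add: zigzag_object)
qed

text \<open>
  Compose \<open>cup V\<close> with the straightened strand \<open>V\<close> and exchange it with \<open>c\<close>; then it straightens against the
  \<open>cap V\<close> inside \<open>e\<close>.
\<close>

lemma cup_unique:
  assumes [simp]: "V \<in> Obj C" and t: "hom t b [dual C V]" and c: "hom c [] ([V] @ b)"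
    and e: "hom e (b @ [V]) []"
    and zig: "([V] \<rhd> e) \<bullet> (c \<lhd> [V]) = idn [V]" and te: "cap V \<bullet> (t \<lhd> [V]) = e"
  shows "([V] \<rhd> t) \<bullet> c = cup V"
proof -
  let ?D = "dual C V"
  note [simp] = hom_simps[OF t] hom_simps[OF c]
    hom_simps[OF e] hom_obj[OF t]
  have "cup V = (([V] \<rhd> e \<lhd> [?D]) \<bullet> (c \<lhd> [V, ?D])) \<bullet> cup V"
    using arg_cong[OF zig, of "\<lambda>x. x \<lhd> [?D]"] by (simp add: whisk_simps)
  also have "\<dots> = ([V] \<rhd> e \<lhd> [?D]) \<bullet> ((c \<lhd> [V, ?D]) \<bullet> cup V)"
    by (simp add: whisk_simps)
  also have "(c \<lhd> [V, ?D]) \<bullet> cup V = (([V] @ b) \<rhd> cup V) \<bullet> c"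
    using exch[OF c hom_cup[of V], of "[]" "[]" "[]"] by simp
  also have "[V] \<rhd> e \<lhd> [?D] = ([V] \<rhd> cap V \<lhd> [?D]) \<bullet> ([V] \<rhd> t \<lhd> [V, ?D])"
    unfolding te[symmetric] by (simp add: whisk_simps)
  also have "\<dots> \<bullet> (([V] @ b) \<rhd> cup V) \<bullet> c = ([V] \<rhd> cap V \<lhd> [?D]) \<bullet> (([V] \<rhd> t \<lhd> [V, ?D]) \<bullet> (([V] @ b) \<rhd> cup V)) \<bullet> c"
    by (simp add: whisk_simps)
  also have "([V] \<rhd> t \<lhd> [V, ?D]) \<bullet> (([V] @ b) \<rhd> cup V) = ([V, ?D] \<rhd> cup V) \<bullet> ([V] \<rhd> t)"
    using exch[OF t hom_cup[of V], of "[V]" "[]" "[]"] by simp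
  also have "([V] \<rhd> cap V \<lhd> [?D]) \<bullet> (([V, ?D] \<rhd> cup V) \<bullet> ([V] \<rhd> t)) \<bullet> c
      = ([V] \<rhd> ((cap V \<lhd> [?D]) \<bullet> ([?D] \<rhd> cup V))) \<bullet> ([V] \<rhd> t) \<bullet> c"
    by (simp add: whisk_simps)
  finally show ?thesis by (simp add: zigzag_dual)
qed

definition dual_diag :: "'o \<Rightarrow> 'o \<Rightarrow> ('o, 'm) diag \<Rightarrow> ('o, 'm) diag" where
  "dual_diag V W g = curry (dual C W) V (cap W \<bullet> ([dual C W] \<rhd> g))"

lemma repr_dual_arrow:
  assumes [simp]: "V \<in> Obj C" "W \<in> Obj C" "g \<in> Hom C V W"
  shows "repr (dual C W) (dual C V) (dual_arrow C V W g) (dual_diag V W (hat V W g))"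
proof -
  note [simp] = structure_homs ev_hom coev_hom
  let ?e = "ev C W \<cdot> (ide C (dual C W) \<odot> g)"
  have "repr (dual C W \<otimes> V) \<one> ?e (hat (dual C W \<otimes> W) \<one> (ev C W) \<bullet> merge (dual C W) W \<bullet> ([dual C W] \<rhd> hat V W g) \<bullet> split (dual C W) V)"
    by (rule repr_comp repr_right repr_hat | simp)+
  then have "?e \<in> Hom C (dual C W \<otimes> V) \<one>" "pairing (dual C W) V ?e = cap W \<bullet> ([dual C W] \<rhd> hat V W g)"
    by (simp_all add: repr_def pairing_def cap_def whisk_simps)
  then show ?thesis
    using repr_curry_pairing[of V "dual C W" ?e] by (simp add: dual_arrow_def dual_diag_def)
qed

lemma dual_diag_simps [simp]:
  assumes "hom g [V] [W]"
  shows "valid (dual_diag V W g)" "src (dual_diag V W g) = [dual C W]" "tgt (dual_diag V W g) = [dual C V]"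
  using assms hom_obj[OF assms] by (simp_all add: dual_diag_def hom_def)

lemma cap_dual:
  assumes "hom g [V] [W]"
  shows "cap V \<bullet> (dual_diag V W g \<lhd> [V]) = cap W \<bullet> ([dual C W] \<rhd> g)"
  using assms hom_obj[OF assms] unfolding dual_diag_def by (intro cap_curry) (simp_all add: hom_def)

text \<open>
  The dual box is \<open>g\<close> with both ends bent; next to \<open>cup W\<close> one of the bends is pulled straight.
\<close>

lemma cup_dual:
  assumes g: "hom g [V] [W]"
  shows "(g \<lhd> [dual C V]) \<bullet> cup V = ([W] \<rhd> dual_diag V W g) \<bullet> cup W"
proof -
  note [simp] = hom_simps[OF g]
  have [simp]: "V \<in> Obj C" "W \<in> Obj C" using hom_obj[OF g] by auto
  let ?V = "dual C V" and ?W = "dual C W"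
  have "([W] \<rhd> dual_diag V W g) \<bullet> cup W = ([W] \<rhd> cap W \<lhd> [?V]) \<bullet> ([W, ?W] \<rhd> g \<lhd> [?V]) \<bullet> (([W, ?W] \<rhd> cup V) \<bullet> cup W)"
    by (simp add: dual_diag_def curry_def whisk_simps)
  also have "([W, ?W] \<rhd> cup V) \<bullet> cup W = (cup W \<lhd> [V, ?V]) \<bullet> cup V"
    using exch[OF hom_cup[of W] hom_cup[of V], of "[]" "[]" "[]"] by simp
  also have "([W, ?W] \<rhd> g \<lhd> [?V]) \<bullet> (cup W \<lhd> [V, ?V]) \<bullet> cup V = (([W, ?W] \<rhd> g \<lhd> [?V]) \<bullet> (cup W \<lhd> [V, ?V])) \<bullet> cup V"
    by (simp add: whisk_simps)
  also have "([W, ?W] \<rhd> g \<lhd> [?V]) \<bullet> (cup W \<lhd> [V, ?V]) = (cup W \<lhd> [W, ?V]) \<bullet> (g \<lhd> [?V])"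
    using exch[OF hom_cup[of W] g, of "[]" "[]" "[?V]"] by simp
  also have "([W] \<rhd> cap W \<lhd> [?V]) \<bullet> ((cup W \<lhd> [W, ?V]) \<bullet> (g \<lhd> [?V])) \<bullet> cup V
      = ((([W] \<rhd> cap W) \<bullet> (cup W \<lhd> [W])) \<lhd> [?V]) \<bullet> (g \<lhd> [?V]) \<bullet> cup V"
    by (simp add: whisk_simps)
  finally show ?thesis by (simp add: zigzag_object)
qed

end

section \<open>The pivotal structure\<close>

context pivotal_category
begin

definition piv_diag :: "'a \<Rightarrow> ('a, 'b) diag" where
  "piv_diag X = hat X (dual C (dual C X)) (piv C X)"

lemma piv_hom: "X \<in> Obj C \<Longrightarrow> piv C X \<in> Hom C X (dual C (dual C X))"
  using piv_iso by (auto simp: iso_arrow_def inverse_arrows_def)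

lemma piv_diag_simps [simp]:
  assumes "X \<in> Obj C"
  shows "valid (piv_diag X)" "src (piv_diag X) = [X]" "tgt (piv_diag X) = [dual C (dual C X)]"
  using assms by (simp_all add: piv_diag_def piv_hom)

lemma hom_piv_diag: "X \<in> Obj C \<Longrightarrow> hom (piv_diag X) [X] [dual C (dual C X)]"
  by (simp add: hom_def)

text \<open>
  The right-hand cap, with the strand \<open>X\<close> to the left of its dual. It exists thanks to the pivotal structure.
\<close>

definition cap' :: "'a \<Rightarrow> ('a, 'b) diag" where
  "cap' X = cap (dual C X) \<bullet> (piv_diag X \<lhd> [dual C X])"

lemma cap'_simps [simp]:
  assumes "X \<in> Obj C"
  shows "valid (cap' X)" "src (cap' X) = [X, dual C X]" "tgt (cap' X) = []"
  using assms by (simp_all add: cap'_def)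

lemma hom_cap': "X \<in> Obj C \<Longrightarrow> hom (cap' X) [X, dual C X] []"
  by (simp add: hom_def)

lemma piv_diag_natural:
  assumes g: "hom g [V] [W]"
  shows "dual_diag (dual C W) (dual C V) (dual_diag V W g) \<bullet> piv_diag V = piv_diag W \<bullet> g"
proof -
  have [simp]: "V \<in> Obj C" "W \<in> Obj C" using hom_obj[OF g] by auto
  obtain g0 where g0[simp]: "g0 \<in> Hom C V W" and g_eq: "g = hat V W g0"
    using hat_full[of g V W] g by (auto simp: hom_def)
  note r1 = repr_dual_arrow[of V W g0, simplified]
  note r2 = repr_dual_arrow[OF _ _ reprD(3)[OF r1], simplified, unfolded reprD(4)[OF r1]]
  have "repr V (dual C (dual C W)) (dual_arrow C (dual C W) (dual C V) (dual_arrow C V W g0) \<cdot> piv C V)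
     (dual_diag (dual C W) (dual C V) (dual_diag V W g) \<bullet> piv_diag V)"
    unfolding g_eq piv_diag_def by (rule repr_comp[OF r2 repr_hat]) (auto simp: piv_hom)
  moreover have "repr V (dual C (dual C W)) (piv C W \<cdot> g0) (piv_diag W \<bullet> g)"
    unfolding g_eq piv_diag_def by (rule repr_comp[OF repr_hat repr_hat]) (auto simp: piv_hom)
  ultimately show ?thesis
    using piv_natural[of V W g0] by (simp add: repr_def)
qed

text \<open>
  Sliding a box over a right-hand cap goes through its double dual, so it is the naturality of the pivotal
  structure.
\<close>

lemma cap'_dual:
  assumes g: "hom g [V] [W]"
  shows "cap' V \<bullet> ([V] \<rhd> dual_diag V W g) = cap' W \<bullet> (g \<lhd> [dual C W])"
proof -
  have [simp]: "V \<in> Obj C" "W \<in> Obj C" using hom_obj[OF g] by auto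
  let ?g = "dual_diag V W g" and ?V = "dual C V" and ?W = "dual C W"
  note [simp] = dual_diag_simps[OF g]
  have hg: "hom ?g [?W] [?V]" by (simp add: hom_def)
  have "cap' V \<bullet> ([V] \<rhd> ?g) = cap ?V \<bullet> ((piv_diag V \<lhd> [?V]) \<bullet> ([V] \<rhd> ?g))"
    by (simp add: cap'_def whisk_simps)
  also have "(piv_diag V \<lhd> [?V]) \<bullet> ([V] \<rhd> ?g) = ([dual C ?V] \<rhd> ?g) \<bullet> (piv_diag V \<lhd> [?W])"
    using exch[OF hom_piv_diag[of V] hg, of "[]" "[]" "[]"] by simp
  also have "cap ?V \<bullet> ([dual C ?V] \<rhd> ?g) \<bullet> (piv_diag V \<lhd> [?W]) = (cap ?V \<bullet> ([dual C ?V] \<rhd> ?g)) \<bullet> (piv_diag V \<lhd> [?W])"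
    by (simp add: whisk_simps)
  also have "cap ?V \<bullet> ([dual C ?V] \<rhd> ?g) = cap ?W \<bullet> (dual_diag ?W ?V ?g \<lhd> [?W])"
    by (rule cap_dual[OF hg, symmetric])
  also have "(cap ?W \<bullet> (dual_diag ?W ?V ?g \<lhd> [?W])) \<bullet> (piv_diag V \<lhd> [?W]) = cap ?W \<bullet> ((dual_diag ?W ?V ?g \<bullet> piv_diag V) \<lhd> [?W])"
    by (simp add: whisk_simps)
  finally show ?thesis by (simp add: piv_diag_natural[OF g] cap'_def whisk_simps)
qed

text \<open>
  The missing cup is the cup of \<open>dual X\<close> with the inverse pivotal arrow on its second leg.
\<close>

lemma cap'_zigzag:
  assumes [simp]: "X \<in> Obj C"
  shows "\<exists>c. hom c [] [dual C X, X] \<and> (cap' X \<lhd> [X]) \<bullet> ([X] \<rhd> c) = idn [X]"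
proof -
  let ?D = "dual C X" and ?E = "dual C (dual C X)"
  obtain q0 where q0: "inverse_arrows C X ?E (piv C X) q0"
    using piv_iso[of X] by (auto simp: iso_arrow_def)
  define q where "q = hat ?E X q0"
  note q0_hom[simp] = inverse_arrowsD(1,2)[OF q0]
  have q: "hom q [?E] [X]" by (simp add: q_def hom_def)
  note [simp] = hom_simps[OF q]
  have pq: "q \<bullet> piv_diag X = idn [X]"
    using hat_comp[of X ?E X "piv C X" q0] inverse_arrowsD(3)[OF q0] by (simp add: q_def piv_diag_def)
  let ?c = "([?D] \<rhd> q) \<bullet> cup ?D"
  have "(cap' X \<lhd> [X]) \<bullet> ([X] \<rhd> ?c) = (cap ?D \<lhd> [X]) \<bullet> ((piv_diag X \<lhd> [?D, X]) \<bullet> ([X, ?D] \<rhd> q)) \<bullet> ([X] \<rhd> cup ?D)"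
    by (simp add: cap'_def whisk_simps)
  also have "(piv_diag X \<lhd> [?D, X]) \<bullet> ([X, ?D] \<rhd> q) = ([?E, ?D] \<rhd> q) \<bullet> (piv_diag X \<lhd> [?D, ?E])"
    using exch[OF hom_piv_diag[of X] q, of "[]" "[?D]" "[]"] by simp
  also have "(cap ?D \<lhd> [X]) \<bullet> (([?E, ?D] \<rhd> q) \<bullet> (piv_diag X \<lhd> [?D, ?E])) \<bullet> ([X] \<rhd> cup ?D)
      = ((cap ?D \<lhd> [X]) \<bullet> ([?E, ?D] \<rhd> q)) \<bullet> ((piv_diag X \<lhd> [?D, ?E]) \<bullet> ([X] \<rhd> cup ?D))"
    by (simp add: whisk_simps)
  also have "(cap ?D \<lhd> [X]) \<bullet> ([?E, ?D] \<rhd> q) = q \<bullet> (cap ?D \<lhd> [?E])"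
    using exch[OF hom_cap[of ?D] q, of "[]" "[]" "[]"] by simp
  also have "(piv_diag X \<lhd> [?D, ?E]) \<bullet> ([X] \<rhd> cup ?D) = ([?E] \<rhd> cup ?D) \<bullet> piv_diag X"
    using exch[OF hom_piv_diag[of X] hom_cup[of ?D], of "[]" "[]" "[]"] by simp
  also have "(q \<bullet> (cap ?D \<lhd> [?E])) \<bullet> (([?E] \<rhd> cup ?D) \<bullet> piv_diag X) = q \<bullet> ((cap ?D \<lhd> [?E]) \<bullet> ([?E] \<rhd> cup ?D)) \<bullet> piv_diag X"
    by (simp add: whisk_simps)
  also have "\<dots> = idn [X]"
    using zigzag_dual[of "?D"] by (simp add: pq)
  finally have "(cap' X \<lhd> [X]) \<bullet> ([X] \<rhd> ?c) = idn [X]" .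
  moreover have "hom ?c [] [?D, X]" by (simp add: hom_def)
  ultimately show ?thesis by blast
qed

section \<open>Partial traces\<close>

text \<open>
  Closes the last strand of \<open>f : l X \<rightarrow> m X\<close> into a loop. The words \<open>l\<close> and \<open>m\<close> are arguments, so that
  the source and the target of \<open>f\<close> need not be taken apart.
\<close>

definition trace :: "'a \<Rightarrow> 'a list \<Rightarrow> 'a list \<Rightarrow> ('a, 'b) diag \<Rightarrow> ('a, 'b) diag" where
  "trace X l m f = (m \<rhd> cap' X) \<bullet> (f \<lhd> [dual C X]) \<bullet> (l \<rhd> cup X)"

lemma trace_hom:
  assumes "hom f (l @ [X]) (m @ [X])"
  shows "hom (trace X l m f) l m"
  using assms hom_obj[OF assms] by (auto simp: hom_def trace_def)

lemma trace_whisk: "trace X (a @ l) (a @ m) (a \<rhd> f) = a \<rhd> trace X l m f"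
  by (simp add: trace_def whisk_simps)

lemma trace_natural_right:
  assumes X[simp]: "X \<in> Obj C" and g: "hom g k l"
  shows "trace X k m (f \<bullet> (g \<lhd> [X])) = trace X l m f \<bullet> g"
proof -
  note [simp] = hom_simps[OF g]
  have "(g \<lhd> [X, dual C X]) \<bullet> (k \<rhd> cup X) = (l \<rhd> cup X) \<bullet> g"
    using exch[OF g hom_cup[OF X], of "[]" "[]" "[]"] by simp
  then show ?thesis by (simp add: trace_def whisk_simps)
qed

lemma trace_natural_left:
  assumes X[simp]: "X \<in> Obj C" and g: "hom g m n"
  shows "trace X l n ((g \<lhd> [X]) \<bullet> f) = g \<bullet> trace X l m f"
proof -
  note [simp] = hom_simps[OF g]
  have "(n \<rhd> cap' X) \<bullet> (g \<lhd> [X, dual C X]) = g \<bullet> (m \<rhd> cap' X)"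
    using exch[OF g hom_cap'[OF X], of "[]" "[]" "[]"] by simp
  from pre[OF this] show ?thesis by (simp add: trace_def whisk_simps)
qed

text \<open>
  The box \<open>g\<close> travels around the loop: over the cup it becomes its dual, which passes \<open>f\<close> along the returning
  strand, and over the cap it becomes \<open>g\<close> again.
\<close>

lemma trace_slide:
  assumes g: "hom g [V] [W]" and f: "hom f (l @ [W]) (m @ [V])"
  shows "trace V l m (f \<bullet> (l \<rhd> g)) = trace W l m ((m \<rhd> g) \<bullet> f)"
proof -
  let ?g = "dual_diag V W g" and ?V = "dual C V" and ?W = "dual C W"
  have [simp]: "V \<in> Obj C" "W \<in> Obj C" using hom_obj[OF g] by auto
  have hg: "hom ?g [?W] [?V]" using dual_diag_simps[OF g] by (simp add: hom_def)
  have "trace V l m (f \<bullet> (l \<rhd> g)) = (m \<rhd> cap' V) \<bullet> (f \<lhd> [?V]) \<bullet> (l \<rhd> ((g \<lhd> [?V]) \<bullet> cup V))"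
    by (simp add: trace_def whisk_simps)
  also have "\<dots> = (m \<rhd> cap' V) \<bullet> ((f \<lhd> [?V]) \<bullet> ((l @ [W]) \<rhd> ?g)) \<bullet> (l \<rhd> cup W)"
    by (simp add: cup_dual[OF g] whisk_simps)
  also have "(f \<lhd> [?V]) \<bullet> ((l @ [W]) \<rhd> ?g) = ((m @ [V]) \<rhd> ?g) \<bullet> (f \<lhd> [?W])"
    using exchange[OF f hg] by simp
  also have "(m \<rhd> cap' V) \<bullet> (((m @ [V]) \<rhd> ?g) \<bullet> (f \<lhd> [?W])) \<bullet> (l \<rhd> cup W)
      = (m \<rhd> (cap' V \<bullet> ([V] \<rhd> ?g))) \<bullet> (f \<lhd> [?W]) \<bullet> (l \<rhd> cup W)"
    by (simp add: whisk_simps)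
  also have "\<dots> = trace W l m ((m \<rhd> g) \<bullet> f)"
    by (simp add: cap'_dual[OF g] trace_def whisk_simps)
  finally show ?thesis .
qed

text \<open>
  Testing with \<open>k = X \<rhd> cap X\<close> is enough. The loop then opens up to the strand of \<open>u\<close> bent by
  \<open>cap' X\<close>, and bending is invertible.
\<close>

lemma trace_detects:
  assumes X[simp]: "X \<in> Obj C" and u: "hom u (l @ [X]) (m @ [X])" and v: "hom v (l @ [X]) (m @ [X])"
    and eq: "\<And>B k. hom k (B @ [X]) [X] \<Longrightarrow> trace X (l @ B) m (u \<bullet> (l \<rhd> k)) = trace X (l @ B) m (v \<bullet> (l \<rhd> k))"
  shows "u = v"
proof -
  let ?D = "dual C X"
  obtain c where c: "hom c [] [?D, X]" and zig: "(cap' X \<lhd> [X]) \<bullet> ([X] \<rhd> c) = idn [X]"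
    using cap'_zigzag[OF X] by auto
  let ?k = "[X] \<rhd> cap X"
  have k: "hom ?k ([X, ?D] @ [X]) [X]" by (simp add: hom_def)
  have *: "trace X (l @ [X, ?D]) m (w \<bullet> (l \<rhd> ?k)) = (m \<rhd> cap' X) \<bullet> (w \<lhd> [?D])"
    and **: "((m \<rhd> cap' X \<lhd> [X]) \<bullet> (w \<lhd> [?D, X])) \<bullet> ((l @ [X]) \<rhd> c) = w"
    if w: "hom w (l @ [X]) (m @ [X])" for w
  proof -
    note [simp] = hom_simps[OF w]
    have [simp]: "set l \<subseteq> Obj C" "set m \<subseteq> Obj C" using hom_obj[OF w] by auto
    have "trace X (l @ [X, ?D]) m (w \<bullet> (l \<rhd> ?k)) = (m \<rhd> cap' X) \<bullet> (w \<lhd> [?D]) \<bullet> ((l @ [X]) \<rhd> ((cap X \<lhd> [?D]) \<bullet> ([?D] \<rhd> cup X)))"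
      by (simp add: trace_def whisk_simps)
    then show "trace X (l @ [X, ?D]) m (w \<bullet> (l \<rhd> ?k)) = (m \<rhd> cap' X) \<bullet> (w \<lhd> [?D])"
      by (simp add: zigzag_dual)
    have "(w \<lhd> [?D, X]) \<bullet> ((l @ [X]) \<rhd> c) = ((m @ [X]) \<rhd> c) \<bullet> w"
      using exchange[OF w c] by simp
    then have "((m \<rhd> cap' X \<lhd> [X]) \<bullet> (w \<lhd> [?D, X])) \<bullet> ((l @ [X]) \<rhd> c) = (m \<rhd> ((cap' X \<lhd> [X]) \<bullet> ([X] \<rhd> c))) \<bullet> w"
      by (simp add: whisk_simps)
    then show "((m \<rhd> cap' X \<lhd> [X]) \<bullet> (w \<lhd> [?D, X])) \<bullet> ((l @ [X]) \<rhd> c) = w"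
      by (simp add: zig)
  qed
  have "((m \<rhd> cap' X) \<bullet> (u \<lhd> [?D])) \<lhd> [X] = ((m \<rhd> cap' X) \<bullet> (v \<lhd> [?D])) \<lhd> [X]"
    using eq[OF k] *[OF u] *[OF v] by simp
  then have "((m \<rhd> cap' X \<lhd> [X]) \<bullet> (u \<lhd> [?D, X])) \<bullet> ((l @ [X]) \<rhd> c)
      = ((m \<rhd> cap' X \<lhd> [X]) \<bullet> (v \<lhd> [?D, X])) \<bullet> ((l @ [X]) \<rhd> c)"
    by (simp add: whisk_simps)
  then show "u = v" using **[OF u] **[OF v] by simp
qed

section \<open>Traces over tensor products\<close>

text \<open>
  The comparison of the dual of \<open>X \<otimes> Y\<close> with the duals of its factors.
\<close>

definition dual_merge :: "'a \<Rightarrow> 'a \<Rightarrow> ('a, 'b) diag" where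
  "dual_merge X Y = hat (dual C Y \<otimes> dual C X) (dual C (X \<otimes> Y)) (dual_tensor C X Y) \<bullet> merge (dual C Y) (dual C X)"

text \<open>
  The comparison is defined by currying nested caps, so capping it recovers them.
\<close>

lemma dual_tensor_cap:
  assumes [simp]: "X \<in> Obj C" "Y \<in> Obj C"
  shows "dual_tensor C X Y \<in> Hom C (dual C Y \<otimes> dual C X) (dual C (X \<otimes> Y))"
    and "cap (X \<otimes> Y) \<bullet> (dual_merge X Y \<lhd> [X \<otimes> Y]) =
      cap Y \<bullet> ([dual C Y] \<rhd> cap X \<lhd> [Y]) \<bullet> ([dual C Y, dual C X] \<rhd> split X Y)"
proof -
  note [simp] = structure_homs ev_hom coev_hom
  let ?X = "dual C X" and ?Y = "dual C Y"
  let ?P = "?Y \<otimes> ?X" and ?V = "X \<otimes> Y"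
  let ?e = "ev C Y \<cdot> (ide C ?Y \<odot> lunit C Y) \<cdot> (ide C ?Y \<odot> (ev C X \<odot> ide C Y)) \<cdot>
      (ide C ?Y \<odot> assoc' C ?X X Y) \<cdot> assoc C ?Y ?X ?V"
  have r: "repr (?P \<otimes> ?V) \<one> ?e (hat (?Y \<otimes> Y) \<one> (ev C Y) \<bullet>
     (merge ?Y Y \<bullet> ([?Y] \<rhd> ((unt \<lhd> [Y]) \<bullet> split \<one> Y)) \<bullet> split ?Y (\<one> \<otimes> Y)) \<bullet>
     (merge ?Y (\<one> \<otimes> Y) \<bullet> ([?Y] \<rhd> (merge \<one> Y \<bullet> (hat (?X \<otimes> X) \<one> (ev C X) \<lhd> [Y]) \<bullet> split (?X \<otimes> X) Y)) \<bullet> split ?Y ((?X \<otimes> X) \<otimes> Y)) \<bullet>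
     (merge ?Y ((?X \<otimes> X) \<otimes> Y) \<bullet> ([?Y] \<rhd> (merge (?X \<otimes> X) Y \<bullet> (merge ?X X \<lhd> [Y]) \<bullet> ([?X] \<rhd> split X Y) \<bullet> split ?X (X \<otimes> Y))) \<bullet> split ?Y (?X \<otimes> (X \<otimes> Y))) \<bullet>
     (merge ?Y (?X \<otimes> ?V) \<bullet> ([?Y] \<rhd> merge ?X ?V) \<bullet> (split ?Y ?X \<lhd> [?V]) \<bullet> split ?P ?V))"
    by (rule repr_comp repr_lunit repr_right repr_assoc repr_assoc' repr_left repr_hat | simp)+
  note e = reprD(3)[OF r]
  have rt: "repr ?P (dual C ?V) (dual_tensor C X Y) (curry ?P ?V (pairing ?P ?V ?e))"
    unfolding dual_tensor_def by (rule repr_curry_pairing) (use e in auto)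
  from reprD(3)[OF this] show "dual_tensor C X Y \<in> Hom C ?P (dual C ?V)" .
  have h: "hom (pairing ?P ?V ?e) [?P, ?V] []" using e by (simp add: hom_def)
  have "cap ?V \<bullet> (dual_merge X Y \<lhd> [?V]) = (cap ?V \<bullet> (curry ?P ?V (pairing ?P ?V ?e) \<lhd> [?V])) \<bullet> (merge ?Y ?X \<lhd> [?V])"
    by (simp add: dual_merge_def reprD(4)[OF rt] whisk_simps)
  also have "\<dots> = pairing ?P ?V ?e \<bullet> (merge ?Y ?X \<lhd> [?V])"
    using cap_curry[OF _ h] by simp
  also have "\<dots> = cap Y \<bullet> ([?Y] \<rhd> cap X \<lhd> [Y]) \<bullet> ([?Y, ?X] \<rhd> split X Y)"
    by (simp add: pairing_def reprD(4)[OF r] cap_def whisk_simps cancel_whisk)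
  finally show "cap ?V \<bullet> (dual_merge X Y \<lhd> [?V]) = cap Y \<bullet> ([?Y] \<rhd> cap X \<lhd> [Y]) \<bullet> ([?Y, ?X] \<rhd> split X Y)" .
qed

lemma dual_merge_hom:
  assumes [simp]: "X \<in> Obj C" "Y \<in> Obj C"
  shows "hom (dual_merge X Y) [dual C Y, dual C X] [dual C (X \<otimes> Y)]"
  using dual_tensor_cap(1)[OF assms] by (simp add: hom_def dual_merge_def structure_homs)

text \<open>
  By uniqueness of cups: nested cups straighten nested caps.
\<close>

lemma cup_tensor:
  assumes [simp]: "X \<in> Obj C" "Y \<in> Obj C"
  shows "cup (X \<otimes> Y) = ([X \<otimes> Y] \<rhd> dual_merge X Y) \<bullet> (merge X Y \<lhd> [dual C Y, dual C X]) \<bullet>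
    ([X] \<rhd> cup Y \<lhd> [dual C X]) \<bullet> cup X"
proof -
  note [simp] = structure_homs
  let ?X = "dual C X" and ?Y = "dual C Y" and ?V = "X \<otimes> Y"
  let ?c = "(merge X Y \<lhd> [?Y, ?X]) \<bullet> ([X] \<rhd> cup Y \<lhd> [?X]) \<bullet> cup X"
  let ?e = "cap Y \<bullet> ([?Y] \<rhd> cap X \<lhd> [Y]) \<bullet> ([?Y, ?X] \<rhd> split X Y)"
  have hm: "hom (merge X Y) [X, Y] [?V]" and hs: "hom (split X Y) [?V] [X, Y]" by (simp_all add: hom_def)
  have "([?V] \<rhd> ?e) \<bullet> (?c \<lhd> [?V]) = ([?V] \<rhd> cap Y) \<bullet> ([?V, ?Y] \<rhd> cap X \<lhd> [Y]) \<bullet>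
     (([?V, ?Y, ?X] \<rhd> split X Y) \<bullet> (merge X Y \<lhd> [?Y, ?X, ?V])) \<bullet> ([X] \<rhd> cup Y \<lhd> [?X, ?V]) \<bullet> (cup X \<lhd> [?V])"
    by (simp add: whisk_simps)
  also have "([?V, ?Y, ?X] \<rhd> split X Y) \<bullet> (merge X Y \<lhd> [?Y, ?X, ?V]) = (merge X Y \<lhd> [?Y, ?X, X, Y]) \<bullet> ([X, Y, ?Y, ?X] \<rhd> split X Y)"
    using exch[OF hm hs, of "[]" "[?Y, ?X]" "[]"] by simp
  also have "([?V] \<rhd> cap Y) \<bullet> ([?V, ?Y] \<rhd> cap X \<lhd> [Y]) \<bullet>
     ((merge X Y \<lhd> [?Y, ?X, X, Y]) \<bullet> ([X, Y, ?Y, ?X] \<rhd> split X Y)) \<bullet> ([X] \<rhd> cup Y \<lhd> [?X, ?V]) \<bullet> (cup X \<lhd> [?V])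
    = ([?V] \<rhd> cap Y) \<bullet> (([?V, ?Y] \<rhd> cap X \<lhd> [Y]) \<bullet>
     (merge X Y \<lhd> [?Y, ?X, X, Y])) \<bullet> (([X, Y, ?Y, ?X] \<rhd> split X Y) \<bullet> ([X] \<rhd> cup Y \<lhd> [?X, ?V])) \<bullet> (cup X \<lhd> [?V])"
    by (simp add: whisk_simps)
  also have "([?V, ?Y] \<rhd> cap X \<lhd> [Y]) \<bullet> (merge X Y \<lhd> [?Y, ?X, X, Y]) = (merge X Y \<lhd> [?Y, Y]) \<bullet> ([X, Y, ?Y] \<rhd> cap X \<lhd> [Y])"
    using exch[OF hm hom_cap[of X], of "[]" "[?Y]" "[Y]"] by simp
  also have "([X, Y, ?Y, ?X] \<rhd> split X Y) \<bullet> ([X] \<rhd> cup Y \<lhd> [?X, ?V]) = ([X] \<rhd> cup Y \<lhd> [?X, X, Y]) \<bullet> ([X, ?X] \<rhd> split X Y)"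
    using exch[OF hom_cup[of Y] hs, of "[X]" "[?X]" "[]"] by simp
  also have "([?V] \<rhd> cap Y) \<bullet> ((merge X Y \<lhd> [?Y, Y]) \<bullet> ([X, Y, ?Y] \<rhd> cap X \<lhd> [Y])) \<bullet>
     (([X] \<rhd> cup Y \<lhd> [?X, X, Y]) \<bullet> ([X, ?X] \<rhd> split X Y)) \<bullet> (cup X \<lhd> [?V])
    = (([?V] \<rhd> cap Y) \<bullet> (merge X Y \<lhd> [?Y, Y])) \<bullet> (([X, Y, ?Y] \<rhd> cap X \<lhd> [Y]) \<bullet>
     ([X] \<rhd> cup Y \<lhd> [?X, X, Y])) \<bullet> (([X, ?X] \<rhd> split X Y) \<bullet> (cup X \<lhd> [?V]))"
    by (simp add: whisk_simps)
  also have "([?V] \<rhd> cap Y) \<bullet> (merge X Y \<lhd> [?Y, Y]) = merge X Y \<bullet> ([X, Y] \<rhd> cap Y)"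
    using exch[OF hm hom_cap[of Y], of "[]" "[]" "[]"] by simp
  also have "([X, ?X] \<rhd> split X Y) \<bullet> (cup X \<lhd> [?V]) = (cup X \<lhd> [X, Y]) \<bullet> split X Y"
    using exch[OF hom_cup[of X] hs, of "[]" "[]" "[]"] by simp
  also have "([X, Y, ?Y] \<rhd> cap X \<lhd> [Y]) \<bullet> ([X] \<rhd> cup Y \<lhd> [?X, X, Y]) = ([X] \<rhd> cup Y \<lhd> [Y]) \<bullet> ([X] \<rhd> cap X \<lhd> [Y])"
    using exch[OF hom_cup[of Y] hom_cap[of X], of "[X]" "[]" "[Y]"] by simp
  also have "(merge X Y \<bullet> ([X, Y] \<rhd> cap Y)) \<bullet> (([X] \<rhd> cup Y \<lhd> [Y]) \<bullet> ([X] \<rhd> cap X \<lhd> [Y])) \<bullet> ((cup X \<lhd> [X, Y]) \<bullet> split X Y)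
    = merge X Y \<bullet> ([X] \<rhd> (([Y] \<rhd> cap Y) \<bullet> (cup Y \<lhd> [Y]))) \<bullet> ((([X] \<rhd> cap X) \<bullet> (cup X \<lhd> [X])) \<lhd> [Y]) \<bullet> split X Y"
    by (simp add: whisk_simps)
  also have "\<dots> = idn [?V]" by (simp add: zigzag_object)
  finally have zig: "([?V] \<rhd> ?e) \<bullet> (?c \<lhd> [?V]) = idn [?V]" .
  have "([?V] \<rhd> dual_merge X Y) \<bullet> ?c = cup ?V"
    by (rule cup_unique[OF _ dual_merge_hom _ _ zig dual_tensor_cap(2)]) (auto simp: hom_def)
  then show ?thesis by simp
qed

text \<open>
  This is where the pivotal structure has to be monoidal. Dualising the comparison exchanges
  \<open>piv (X \<otimes> Y)\<close> for \<open>piv X \<odot> piv Y\<close>, up to the comparison for the dual objects, and that one turns the cap of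
  \<open>dual Y \<otimes> dual X\<close> into nested caps.
\<close>

lemma cap'_tensor:
  assumes [simp]: "X \<in> Obj C" "Y \<in> Obj C"
  shows "cap' (X \<otimes> Y) \<bullet> ([X \<otimes> Y] \<rhd> dual_merge X Y) \<bullet> (merge X Y \<lhd> [dual C Y, dual C X]) =
    cap' X \<bullet> ([X] \<rhd> cap' Y \<lhd> [dual C X])"
proof -
  note [simp] = structure_homs piv_hom dual_tensor_cap(1)
  let ?X = "dual C X" and ?Y = "dual C Y" and ?V = "X \<otimes> Y"
  let ?XX = "dual C ?X" and ?YY = "dual C ?Y"
  let ?P = "?Y \<otimes> ?X"
  let ?t = "hat ?P (dual C ?V) (dual_tensor C X Y)"
  have t: "hom ?t [?P] [dual C ?V]" by (simp add: hom_def)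
  note [simp] = hom_simps[OF t]
  let ?tt = "dual_diag ?P (dual C ?V) ?t"
  note [simp] = dual_diag_simps[OF t]
  have rt: "repr (dual C (dual C ?V)) (dual C ?P) (dual_arrow C ?P (dual C ?V) (dual_tensor C X Y)) ?tt"
    by (rule repr_dual_arrow) auto
  have "repr ?V (dual C ?P) (dual_arrow C ?P (dual C ?V) (dual_tensor C X Y) \<cdot> piv C ?V) (?tt \<bullet> piv_diag ?V)"
    unfolding piv_diag_def by (rule repr_comp[OF rt repr_hat]) auto
  moreover have "repr ?V (dual C ?P) (dual_tensor C ?Y ?X \<cdot> (piv C X \<odot> piv C Y))
     (hat (?XX \<otimes> ?YY) (dual C ?P) (dual_tensor C ?Y ?X) \<bullet>
      (merge ?XX ?YY \<bullet> (piv_diag X \<lhd> [?YY]) \<bullet> ([X] \<rhd> piv_diag Y) \<bullet> split X Y))"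
    unfolding piv_diag_def by (rule repr_comp repr_tensor repr_hat | simp)+
  ultimately have tpiv: "?tt \<bullet> piv_diag ?V = dual_merge ?Y ?X \<bullet> (piv_diag X \<lhd> [?YY]) \<bullet> ([X] \<rhd> piv_diag Y) \<bullet> split X Y"
    using piv_tensor[of X Y] by (simp add: repr_def dual_merge_def whisk_simps)
  have hm: "hom (merge X Y) [X, Y] [?V]" and hs: "hom (split X Y) [?V] [X, Y]"
    and hm': "hom (merge ?Y ?X) [?Y, ?X] [?P]"  and hs': "hom (split ?Y ?X) [?P] [?Y, ?X]" by (simp_all add: hom_def)
  note [simp] = hom_simps[OF dual_merge_hom]
  have "cap' ?V \<bullet> ([?V] \<rhd> dual_merge X Y) = (cap' ?V \<bullet> ([?V] \<rhd> ?t)) \<bullet> ([?V] \<rhd> merge ?Y ?X)"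
    by (simp add: dual_merge_def whisk_simps)
  also have "cap' ?V \<bullet> ([?V] \<rhd> ?t) = cap (dual C ?V) \<bullet> ((piv_diag ?V \<lhd> [dual C ?V]) \<bullet> ([?V] \<rhd> ?t))"
    by (simp add: cap'_def whisk_simps)
  also have "(piv_diag ?V \<lhd> [dual C ?V]) \<bullet> ([?V] \<rhd> ?t) = ([dual C (dual C ?V)] \<rhd> ?t) \<bullet> (piv_diag ?V \<lhd> [?P])"
    using exch[OF hom_piv_diag[of ?V] t, of "[]" "[]" "[]"] by simp
  also have "cap (dual C ?V) \<bullet> (([dual C (dual C ?V)] \<rhd> ?t) \<bullet> (piv_diag ?V \<lhd> [?P]))
      = (cap (dual C ?V) \<bullet> ([dual C (dual C ?V)] \<rhd> ?t)) \<bullet> (piv_diag ?V \<lhd> [?P])"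
    by (simp add: whisk_simps)
  also have "cap (dual C ?V) \<bullet> ([dual C (dual C ?V)] \<rhd> ?t) = cap ?P \<bullet> (?tt \<lhd> [?P])"
    by (rule cap_dual[OF t, symmetric])
  also have "((cap ?P \<bullet> (?tt \<lhd> [?P])) \<bullet> (piv_diag ?V \<lhd> [?P])) \<bullet> ([?V] \<rhd> merge ?Y ?X)
      = cap ?P \<bullet> ((?tt \<bullet> piv_diag ?V) \<lhd> [?P]) \<bullet> ([?V] \<rhd> merge ?Y ?X)"
    by (simp add: whisk_simps)
  also have "\<dots> = (cap ?P \<bullet> (dual_merge ?Y ?X \<lhd> [?P])) \<bullet> (((piv_diag X \<lhd> [?YY]) \<bullet> ([X] \<rhd> piv_diag Y) \<bullet> split X Y) \<lhd> [?P]) \<bullet> ([?V] \<rhd> merge ?Y ?X)"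
    unfolding tpiv by (simp add: whisk_simps)
  also have "cap ?P \<bullet> (dual_merge ?Y ?X \<lhd> [?P]) = cap ?X \<bullet> ([?XX] \<rhd> cap ?Y \<lhd> [?X]) \<bullet> ([?XX, ?YY] \<rhd> split ?Y ?X)"
    by (rule dual_tensor_cap(2)) auto
  finally have 1: "cap' ?V \<bullet> ([?V] \<rhd> dual_merge X Y) = (cap ?X \<bullet> ([?XX] \<rhd> cap ?Y \<lhd> [?X]) \<bullet> ([?XX, ?YY] \<rhd> split ?Y ?X)) \<bullet>
      (((piv_diag X \<lhd> [?YY]) \<bullet> ([X] \<rhd> piv_diag Y) \<bullet> split X Y) \<lhd> [?P]) \<bullet> ([?V] \<rhd> merge ?Y ?X)" .
  have hpp: "hom ((piv_diag X \<lhd> [?YY]) \<bullet> ([X] \<rhd> piv_diag Y) \<bullet> split X Y) [?V] [?XX, ?YY]" (is "hom ?pp _ _")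
    by (simp add: hom_def)
  have 2: "(?pp \<lhd> [?P]) \<bullet> ([?V] \<rhd> merge ?Y ?X) = ([?XX, ?YY] \<rhd> merge ?Y ?X) \<bullet> (?pp \<lhd> [?Y, ?X])"
    using exchange[OF hpp hm'] by simp
  have "cap' ?V \<bullet> ([?V] \<rhd> dual_merge X Y) \<bullet> (merge X Y \<lhd> [?Y, ?X]) =
     (cap' ?V \<bullet> ([?V] \<rhd> dual_merge X Y)) \<bullet> (merge X Y \<lhd> [?Y, ?X])"
    by (simp add: whisk_simps)
  also have "\<dots> = cap ?X \<bullet> ([?XX] \<rhd> cap ?Y \<lhd> [?X]) \<bullet> ([?XX, ?YY] \<rhd> split ?Y ?X) \<bullet> ([?XX, ?YY] \<rhd> merge ?Y ?X) \<bullet>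
     (?pp \<lhd> [?Y, ?X]) \<bullet> (merge X Y \<lhd> [?Y, ?X])"
    unfolding 1 2 by (simp only: comp_assoc_diag)
  also have "\<dots> = cap ?X \<bullet> (([?XX] \<rhd> cap ?Y \<lhd> [?X]) \<bullet> (piv_diag X \<lhd> [?YY, ?Y, ?X])) \<bullet> ([X] \<rhd> piv_diag Y \<lhd> [?Y, ?X])"
    by (simp add: whisk_simps cancel_whisk)
  also have "([?XX] \<rhd> cap ?Y \<lhd> [?X]) \<bullet> (piv_diag X \<lhd> [?YY, ?Y, ?X]) = (piv_diag X \<lhd> [?X]) \<bullet> ([X] \<rhd> cap ?Y \<lhd> [?X])"
    using exch[OF hom_piv_diag[of X] hom_cap[of ?Y], of "[]" "[]" "[?X]"] by simp
  finally show ?thesis by (simp add: cap'_def whisk_simps)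
qed

text \<open>
  In the trace over \<open>A \<otimes> B\<close>, the cup and the cap are nested ones up to the comparison arrow, which slides once
  around the loop and meets its counterpart.
\<close>

lemma trace_tensor:
  assumes [simp]: "A \<in> Obj C" "B \<in> Obj C" and f: "hom f (l @ [A, B]) (m @ [A, B])"
  shows "trace A l m (trace B (l @ [A]) (m @ [A]) f) = trace (A \<otimes> B) l m ((m \<rhd> merge A B) \<bullet> f \<bullet> (l \<rhd> split A B))"
proof -
  note [simp] = structure_homs hom_simps[OF f] hom_simps[OF dual_merge_hom]
  have [simp]: "set l \<subseteq> Obj C" "set m \<subseteq> Obj C" using hom_obj[OF f] by auto
  let ?A = "dual C A" and ?B = "dual C B" and ?V = "A \<otimes> B"
  let ?D = "dual C ?V"
  let ?f = "(m \<rhd> merge A B) \<bullet> f \<bullet> (l \<rhd> split A B)"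
  have hf: "hom ?f (l @ [?V]) (m @ [?V])" by (simp add: hom_def)
  have "trace ?V l m ?f = (m \<rhd> cap' ?V) \<bullet> ((?f \<lhd> [?D]) \<bullet> ((l @ [?V]) \<rhd> dual_merge A B)) \<bullet>
       (l \<rhd> merge A B \<lhd> [?B, ?A]) \<bullet> ((l @ [A]) \<rhd> cup B \<lhd> [?A]) \<bullet> (l \<rhd> cup A)"
    by (simp add: trace_def cup_tensor whisk_simps)
  also have "(?f \<lhd> [?D]) \<bullet> ((l @ [?V]) \<rhd> dual_merge A B) = ((m @ [?V]) \<rhd> dual_merge A B) \<bullet> (?f \<lhd> [?B, ?A])"
    using exchange[OF hf dual_merge_hom[of A B]] by simp
  also have "(m \<rhd> cap' ?V) \<bullet> (((m @ [?V]) \<rhd> dual_merge A B) \<bullet> (?f \<lhd> [?B, ?A])) \<bullet>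
       (l \<rhd> merge A B \<lhd> [?B, ?A]) \<bullet> ((l @ [A]) \<rhd> cup B \<lhd> [?A]) \<bullet> (l \<rhd> cup A)
     = (m \<rhd> (cap' ?V \<bullet> ([?V] \<rhd> dual_merge A B) \<bullet> (merge A B \<lhd> [?B, ?A]))) \<bullet> (f \<lhd> [?B, ?A]) \<bullet>
       ((l @ [A]) \<rhd> cup B \<lhd> [?A]) \<bullet> (l \<rhd> cup A)"
    by (simp add: whisk_simps cancel_whisk)
  also have "\<dots> = trace A l m (trace B (l @ [A]) (m @ [A]) f)"
    unfolding cap'_tensor[of A B, simplified] by (simp add: trace_def whisk_simps)
  finally show ?thesis ..
qed

text \<open>
  Merge the two strands, slide over the merged loop, and split again.
\<close>

lemma trace_slide2:
  assumes g: "hom g [A, B] [D, E]" and f: "hom f (l @ [D, E]) (m @ [A, B])"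
  shows "trace A l m (trace B (l @ [A]) (m @ [A]) (f \<bullet> (l \<rhd> g))) =
    trace D l m (trace E (l @ [D]) (m @ [D]) ((m \<rhd> g) \<bullet> f))"
proof -
  note [simp] = structure_homs hom_simps[OF f] hom_simps[OF g]
  have [simp]: "A \<in> Obj C" "B \<in> Obj C" "D \<in> Obj C" "E \<in> Obj C" "set l \<subseteq> Obj C" "set m \<subseteq> Obj C"
    using hom_obj[OF f] hom_obj[OF g] by auto
  let ?g = "merge D E \<bullet> g \<bullet> split A B" and ?f = "(m \<rhd> merge A B) \<bullet> f \<bullet> (l \<rhd> split D E)"
  have "trace A l m (trace B (l @ [A]) (m @ [A]) (f \<bullet> (l \<rhd> g))) =
      trace (A \<otimes> B) l m ((m \<rhd> merge A B) \<bullet> (f \<bullet> (l \<rhd> g)) \<bullet> (l \<rhd> split A B))"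
    by (rule trace_tensor) (auto simp: hom_def)
  also have "(m \<rhd> merge A B) \<bullet> (f \<bullet> (l \<rhd> g)) \<bullet> (l \<rhd> split A B) = ?f \<bullet> (l \<rhd> ?g)"
    by (simp add: whisk_simps cancel_whisk)
  also have "trace (A \<otimes> B) l m (?f \<bullet> (l \<rhd> ?g)) = trace (D \<otimes> E) l m ((m \<rhd> ?g) \<bullet> ?f)"
    by (rule trace_slide) (auto simp: hom_def)
  also have "(m \<rhd> ?g) \<bullet> ?f = (m \<rhd> merge D E) \<bullet> ((m \<rhd> g) \<bullet> f) \<bullet> (l \<rhd> split D E)"
    by (simp add: whisk_simps cancel_whisk)
  also have "trace (D \<otimes> E) l m \<dots> = trace D l m (trace E (l @ [D]) (m @ [D]) ((m \<rhd> g) \<bullet> f))"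
    by (rule trace_tensor[symmetric]) (auto simp: hom_def)
  finally show ?thesis .
qed

end

section \<open>Half-braidings\<close>

context rigid_category
begin

lemma half_braidingD:
  assumes "half_braiding C W \<gamma>"
  shows "W \<in> Obj C"
    "A \<in> Obj C \<Longrightarrow> inverse_arrows C (W \<otimes> A) (A \<otimes> W) (\<gamma> A) (inv_arrow C (W \<otimes> A) (A \<otimes> W) (\<gamma> A))"
    "\<lbrakk>A \<in> Obj C; B \<in> Obj C; f \<in> Hom C A B\<rbrakk> \<Longrightarrow> \<gamma> B \<cdot> (ide C W \<odot> f) = (f \<odot> ide C W) \<cdot> \<gamma> A"
    "\<lbrakk>A \<in> Obj C; B \<in> Obj C\<rbrakk> \<Longrightarrow> \<gamma> (A \<otimes> B) =
        assoc' C A B W \<cdot> (ide C A \<odot> \<gamma> B) \<cdot> assoc C A W B \<cdot> (\<gamma> A \<odot> ide C B) \<cdot> assoc' C W A B"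
proof -
  show W: "W \<in> Obj C" using assms by (simp add: half_braiding_def)
  show "inverse_arrows C (W \<otimes> A) (A \<otimes> W) (\<gamma> A) (inv_arrow C (W \<otimes> A) (A \<otimes> W) (\<gamma> A))" if A: "A \<in> Obj C"
  proof -
    obtain g where "inverse_arrows C (W \<otimes> A) (A \<otimes> W) (\<gamma> A) g"
      using assms A by (auto simp: half_braiding_def iso_arrow_def)
    then show ?thesis using inv_arrow_eq[of "W \<otimes> A" "A \<otimes> W" "\<gamma> A" g] W A tensor_obj by simp
  qed
qed (use assms in \<open>auto simp: half_braiding_def\<close>)

lemma half_braiding_hom: "\<lbrakk>half_braiding C W \<gamma>; A \<in> Obj C\<rbrakk> \<Longrightarrow> \<gamma> A \<in> Hom C (W \<otimes> A) (A \<otimes> W)"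
  using half_braidingD(2) inverse_arrowsD(1) by blast

text \<open>
  The half-braiding as a crossing of two strands.
\<close>

definition hb :: "'o \<Rightarrow> ('o \<Rightarrow> 'm) \<Rightarrow> 'o \<Rightarrow> ('o, 'm) diag" where
  "hb W \<gamma> A = split A W \<bullet> hat (W \<otimes> A) (A \<otimes> W) (\<gamma> A) \<bullet> merge W A"

definition hb' :: "'o \<Rightarrow> ('o \<Rightarrow> 'm) \<Rightarrow> 'o \<Rightarrow> ('o, 'm) diag" where
  "hb' W \<gamma> A = split W A \<bullet> hat (A \<otimes> W) (W \<otimes> A) (inv_arrow C (W \<otimes> A) (A \<otimes> W) (\<gamma> A)) \<bullet> merge A W"

lemma hb_simps:
  assumes "half_braiding C W \<gamma>" "A \<in> Obj C"
  shows "valid (hb W \<gamma> A)" "src (hb W \<gamma> A) = [W, A]" "tgt (hb W \<gamma> A) = [A, W]"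
    "valid (hb' W \<gamma> A)" "src (hb' W \<gamma> A) = [A, W]" "tgt (hb' W \<gamma> A) = [W, A]"
  using half_braidingD(1)[OF assms(1)] inverse_arrowsD(1,2)[OF half_braidingD(2)[OF assms]] assms(2)
  by (simp_all add: hb_def hb'_def structure_homs)

lemma hom_hb: "\<lbrakk>half_braiding C W \<gamma>; A \<in> Obj C\<rbrakk> \<Longrightarrow> hom (hb W \<gamma> A) [W, A] [A, W]"
  by (simp add: hom_def hb_simps)

lemma hb_inverse:
  assumes "half_braiding C W \<gamma>" "A \<in> Obj C"
  shows "hb' W \<gamma> A \<bullet> hb W \<gamma> A = idn [W, A]" "hb W \<gamma> A \<bullet> hb' W \<gamma> A = idn [A, W]"
proof -
  note inv = inverse_arrowsD[OF half_braidingD(2)[OF assms]]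
  note [simp] = half_braidingD(1)[OF assms(1)] assms(2) structure_homs inv(1,2)
  let ?f = "hat (W \<otimes> A) (A \<otimes> W) (\<gamma> A)"
  let ?g = "hat (A \<otimes> W) (W \<otimes> A) (inv_arrow C (W \<otimes> A) (A \<otimes> W) (\<gamma> A))"
  have 1: "?g \<bullet> ?f = idn [W \<otimes> A]" and 2: "?f \<bullet> ?g = idn [A \<otimes> W]"
    using hat_comp[OF _ _ _ inv(1,2)] hat_comp[OF _ _ _ inv(2,1)] inv(3,4) by simp_all
  show "hb' W \<gamma> A \<bullet> hb W \<gamma> A = idn [W, A]" "hb W \<gamma> A \<bullet> hb' W \<gamma> A = idn [A, W]"
    by (simp_all add: hb_def hb'_def whisk_simps cancel_whisk pre_inverse[OF 1] pre_inverse[OF 2])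
qed

lemma hb_natural:
  assumes hb: "half_braiding C W \<gamma>" and [simp]: "A \<in> Obj C" "B \<in> Obj C" and f[simp]: "f \<in> Hom C A B"
  shows "hb W \<gamma> B \<bullet> ([W] \<rhd> hat A B f) = (hat A B f \<lhd> [W]) \<bullet> hb W \<gamma> A"
proof -
  note [simp] = half_braidingD(1)[OF hb] structure_homs half_braiding_hom[OF hb]
  have "repr (W \<otimes> A) (B \<otimes> W) (\<gamma> B \<cdot> (ide C W \<odot> f))
      (hat (W \<otimes> B) (B \<otimes> W) (\<gamma> B) \<bullet> merge W B \<bullet> ([W] \<rhd> hat A B f) \<bullet> split W A)"
    by (rule repr_comp repr_right repr_hat | simp)+
  moreover have "repr (W \<otimes> A) (B \<otimes> W) ((f \<odot> ide C W) \<cdot> \<gamma> A)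
      ((merge B W \<bullet> (hat A B f \<lhd> [W]) \<bullet> split A W) \<bullet> hat (W \<otimes> A) (A \<otimes> W) (\<gamma> A))"
    by (rule repr_comp repr_left repr_hat | simp)+
  ultimately have "hat (W \<otimes> B) (B \<otimes> W) (\<gamma> B) \<bullet> merge W B \<bullet> ([W] \<rhd> hat A B f) \<bullet> split W A =
     (merge B W \<bullet> (hat A B f \<lhd> [W]) \<bullet> split A W) \<bullet> hat (W \<otimes> A) (A \<otimes> W) (\<gamma> A)"
    using half_braidingD(3)[OF hb _ _ f] by (simp add: repr_def)
  then have "split B W \<bullet> (hat (W \<otimes> B) (B \<otimes> W) (\<gamma> B) \<bullet> merge W B \<bullet> ([W] \<rhd> hat A B f) \<bullet> split W A) \<bullet> merge W A =
     split B W \<bullet> ((merge B W \<bullet> (hat A B f \<lhd> [W]) \<bullet> split A W) \<bullet> hat (W \<otimes> A) (A \<otimes> W) (\<gamma> A)) \<bullet> merge W A"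
    by simp
  then show ?thesis
    by (simp add: hb_def whisk_simps cancel_whisk)
qed

text \<open>
  Without the constraints, the hexagon says that \<open>W\<close> crosses \<open>A\<close> and \<open>B\<close> one after the other. It is stated for
  arbitrary arrows \<open>\<gamma> A\<close> and \<open>\<gamma> B\<close>, because it is also used to establish that a family is a half-braiding.
\<close>

lemma repr_hexagon:
  assumes [simp]: "W \<in> Obj C" "A \<in> Obj C" "B \<in> Obj C"
    and \<gamma>: "\<gamma> A \<in> Hom C (W \<otimes> A) (A \<otimes> W)" "\<gamma> B \<in> Hom C (W \<otimes> B) (B \<otimes> W)"
  shows "repr (W \<otimes> (A \<otimes> B)) ((A \<otimes> B) \<otimes> W)
     (assoc' C A B W \<cdot> (ide C A \<odot> \<gamma> B) \<cdot> assoc C A W B \<cdot> (\<gamma> A \<odot> ide C B) \<cdot> assoc' C W A B)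
     (merge (A \<otimes> B) W \<bullet> (merge A B \<lhd> [W]) \<bullet> ([A] \<rhd> hb W \<gamma> B) \<bullet> (hb W \<gamma> A \<lhd> [B]) \<bullet> ([W] \<rhd> split A B) \<bullet> split W (A \<otimes> B))"
    (is "repr _ _ ?f ?F")
proof -
  note [simp] = structure_homs \<gamma>
  have "repr (W \<otimes> (A \<otimes> B)) ((A \<otimes> B) \<otimes> W) ?f
    ((merge (A \<otimes> B) W \<bullet> (merge A B \<lhd> [W]) \<bullet> ([A] \<rhd> split B W) \<bullet> split A (B \<otimes> W)) \<bullet>
     (merge A (B \<otimes> W) \<bullet> ([A] \<rhd> hat (W \<otimes> B) (B \<otimes> W) (\<gamma> B)) \<bullet> split A (W \<otimes> B)) \<bullet>
     (merge A (W \<otimes> B) \<bullet> ([A] \<rhd> merge W B) \<bullet> (split A W \<lhd> [B]) \<bullet> split (A \<otimes> W) B) \<bullet>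
     (merge (A \<otimes> W) B \<bullet> (hat (W \<otimes> A) (A \<otimes> W) (\<gamma> A) \<lhd> [B]) \<bullet> split (W \<otimes> A) B) \<bullet>
     (merge (W \<otimes> A) B \<bullet> (merge W A \<lhd> [B]) \<bullet> ([W] \<rhd> split A B) \<bullet> split W (A \<otimes> B)))" (is "repr _ _ _ ?G")
    by (rule repr_comp repr_assoc repr_assoc' repr_left repr_right repr_hat | simp)+
  also have "?G = ?F"
    by (simp add: hb_def whisk_simps cancel_whisk)
  finally show ?thesis .
qed

lemma hb_tensor:
  assumes hb: "half_braiding C W \<gamma>" and [simp]: "A \<in> Obj C" "B \<in> Obj C"
  shows "hb W \<gamma> (A \<otimes> B) \<bullet> ([W] \<rhd> merge A B) = (merge A B \<lhd> [W]) \<bullet> ([A] \<rhd> hb W \<gamma> B) \<bullet> (hb W \<gamma> A \<lhd> [B])"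
proof -
  note [simp] = half_braidingD(1)[OF hb] structure_homs half_braiding_hom[OF hb] hb_simps[OF hb]
  show ?thesis
    using reprD(4)[OF repr_hexagon[of W A B \<gamma>]] half_braidingD(4)[OF hb, of A B]
    by (simp add: hb_def[of W \<gamma> "A \<otimes> B"] whisk_simps cancel_whisk)
qed

text \<open>
  Crossing \<open>\<one>\<close> twice is the same as crossing it once, by the hexagon for \<open>\<one> \<otimes> \<one>\<close> and naturality along
  \<open>\<one> \<otimes> \<one> \<rightarrow> \<one>\<close>. Since the crossing is invertible, it is trivial.
\<close>

lemma hb_unit:
  assumes hb: "half_braiding C W \<gamma>"
  shows "hb W \<gamma> \<one> \<bullet> ([W] \<rhd> unt') = unt' \<lhd> [W]"
proof -
  note [simp] = half_braidingD(1)[OF hb] structure_homs half_braiding_hom[OF hb] hb_simps[OF hb]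
  let ?g = "hb W \<gamma> \<one>"
  let ?x = "(unt \<lhd> [W]) \<bullet> ?g \<bullet> ([W] \<rhd> unt')"
  have hu: "hom unt [\<one>] []" "hom unt' [] [\<one>]" by (simp_all add: hom_def)
  have "?g \<bullet> ([W] \<rhd> ((unt \<lhd> [\<one>]) \<bullet> split \<one> \<one>)) \<bullet> ([W] \<rhd> merge \<one> \<one>)
      = (((unt \<lhd> [\<one>]) \<bullet> split \<one> \<one>) \<lhd> [W]) \<bullet> hb W \<gamma> (\<one> \<otimes> \<one>) \<bullet> ([W] \<rhd> merge \<one> \<one>)"
    using hb_natural[OF hb, of "\<one> \<otimes> \<one>" \<one> "lunit C \<one>"]
    by (simp add: hat_lunit comp_assoc_diag[symmetric])
  then have "?g \<bullet> ([W] \<rhd> unt \<lhd> [\<one>]) = ((unt \<lhd> [\<one>, W]) \<bullet> ([\<one>] \<rhd> ?g)) \<bullet> (?g \<lhd> [\<one>])"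
    by (simp add: hb_tensor[OF hb] whisk_simps cancel_whisk)
  also have "(unt \<lhd> [\<one>, W]) \<bullet> ([\<one>] \<rhd> ?g) = ?g \<bullet> (unt \<lhd> [W, \<one>])"
    using exch[OF hu(1) hom_hb[OF hb, of \<one>], of "[]" "[]" "[]"] by simp
  finally have "hb' W \<gamma> \<one> \<bullet> ?g \<bullet> ([W] \<rhd> unt \<lhd> [\<one>]) = hb' W \<gamma> \<one> \<bullet> ?g \<bullet> (unt \<lhd> [W, \<one>]) \<bullet> (?g \<lhd> [\<one>])"
    by (simp add: whisk_simps)
  then have *: "[W] \<rhd> unt \<lhd> [\<one>] = (unt \<lhd> [W, \<one>]) \<bullet> (?g \<lhd> [\<one>])"
    by (simp add: pre_inverse[OF hb_inverse(1)[OF hb]])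
  have "?x \<lhd> [\<one>] = ((unt \<lhd> [W, \<one>]) \<bullet> (?g \<lhd> [\<one>])) \<bullet> ([W] \<rhd> unt' \<lhd> [\<one>])"
    by (simp add: whisk_simps)
  also have "\<dots> = idn [W, \<one>]" by (simp add: *[symmetric])
  finally have x1: "?x \<lhd> [\<one>] = idn [W, \<one>]" .
  have hx: "hom ?x [W] [W]" by (simp add: hom_def)
  have "?x = (([W] \<rhd> unt) \<bullet> ([W] \<rhd> unt')) \<bullet> ?x" using hx by (simp add: hom_def)
  also have "\<dots> = ([W] \<rhd> unt) \<bullet> (([W] \<rhd> unt') \<bullet> ?x)" by (rule comp_assoc_diag)
  also have "([W] \<rhd> unt') \<bullet> ?x = (?x \<lhd> [\<one>]) \<bullet> ([W] \<rhd> unt')"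
    using exchange[OF hx hu(2)] hx by (simp add: hom_def)
  also have "([W] \<rhd> unt) \<bullet> \<dots> = idn [W]" by (simp add: x1)
  finally have x: "?x = idn [W]" .
  have "?g \<bullet> ([W] \<rhd> unt') = (unt' \<lhd> [W]) \<bullet> ?x"
    by (simp add: cancel_whisk)
  then show ?thesis by (simp add: x)
qed

primrec hbs :: "'o \<Rightarrow> ('o \<Rightarrow> 'm) \<Rightarrow> 'o list \<Rightarrow> ('o, 'm) diag" where
  "hbs W \<gamma> [] = idn [W]"
| "hbs W \<gamma> (A # l) = ([A] \<rhd> hbs W \<gamma> l) \<bullet> (hb W \<gamma> A \<lhd> l)"

lemma hom_hbs: "\<lbrakk>half_braiding C W \<gamma>; set l \<subseteq> Obj C\<rbrakk> \<Longrightarrow> hom (hbs W \<gamma> l) (W # l) (l @ [W])"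
  by (induction l) (auto simp: hom_def hb_simps half_braidingD)

lemma hbs_append:
  assumes hb: "half_braiding C W \<gamma>" and l: "set l \<subseteq> Obj C" and m: "set m \<subseteq> Obj C"
  shows "hbs W \<gamma> (l @ m) = (l \<rhd> hbs W \<gamma> m) \<bullet> (hbs W \<gamma> l \<lhd> m)"
  using l
proof (induction l)
  case Nil
  then show ?case using hom_hbs[OF hb m] m half_braidingD(1)[OF hb] by (simp add: hom_def)
qed (simp add: whisk_simps)

lemma hbs_single: "\<lbrakk>half_braiding C W \<gamma>; A \<in> Obj C\<rbrakk> \<Longrightarrow> hbs W \<gamma> [A] = hb W \<gamma> A"
  by (simp add: hb_simps half_braidingD(1))

lemma hbs_inverse:
  assumes hb: "half_braiding C W \<gamma>" and l: "set l \<subseteq> Obj C"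
  shows "\<exists>g. hom g (l @ [W]) (W # l) \<and> g \<bullet> hbs W \<gamma> l = idn (W # l) \<and> hbs W \<gamma> l \<bullet> g = idn (l @ [W])"
  using l
proof (induction l)
  case Nil
  then show ?case using half_braidingD(1)[OF hb] by (intro exI[of _ "idn [W]"]) (simp add: hom_def)
next
  case (Cons A l)
  note [simp] = half_braidingD(1)[OF hb] hb_simps[OF hb]
  from Cons obtain g where g: "hom g (l @ [W]) (W # l)" "g \<bullet> hbs W \<gamma> l = idn (W # l)" "hbs W \<gamma> l \<bullet> g = idn (l @ [W])"
    by auto
  have [simp]: "A \<in> Obj C" "set l \<subseteq> Obj C" using Cons.prems by auto
  note [simp] = hom_simps[OF g(1)]
    hom_simps[OF hom_hbs[OF hb]]
  let ?h = "(hb' W \<gamma> A \<lhd> l) \<bullet> ([A] \<rhd> g)"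
  have 1: "([A] \<rhd> g) \<bullet> ([A] \<rhd> hbs W \<gamma> l) = idn (A # W # l)"
    "([A] \<rhd> hbs W \<gamma> l) \<bullet> ([A] \<rhd> g) = idn (A # l @ [W])"
    by (simp_all add: lwhisk_comp[symmetric] g)
  have 2: "(hb W \<gamma> A \<lhd> l) \<bullet> (hb' W \<gamma> A \<lhd> l) = idn (A # W # l)"
    "(hb' W \<gamma> A \<lhd> l) \<bullet> (hb W \<gamma> A \<lhd> l) = idn (W # A # l)"
    by (simp_all add: rwhisk_comp[symmetric] hb_inverse[OF hb])
  show ?case
    by (rule exI[of _ ?h]) (auto simp: hom_def comp_assoc_diag pre_inverse[OF 1(1)] pre_inverse[OF 2(1)] 1 2)
qed

text \<open>
  Merging a word into a single strand turns a crossing with the word into a crossing with one object.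
\<close>

lemma join:
  assumes hb: "half_braiding C W \<gamma>" and l: "set l \<subseteq> Obj C"
  shows "\<exists>P j j'. P \<in> Obj C \<and> hom j l [P] \<and> hom j' [P] l \<and> j' \<bullet> j = idn l \<and> j \<bullet> j' = idn [P] \<and>
    hb W \<gamma> P \<bullet> ([W] \<rhd> j) = (j \<lhd> [W]) \<bullet> hbs W \<gamma> l"
  using l
proof (induction l)
  case Nil
  note [simp] = half_braidingD(1)[OF hb] hb_simps[OF hb] structure_homs
  have "hb W \<gamma> \<one> \<bullet> ([W] \<rhd> unt') = (unt' \<lhd> [W]) \<bullet> hbs W \<gamma> []" by (simp add: hb_unit[OF hb])
  then show ?case by (intro exI[of _ \<one>] exI[of _ unt'] exI[of _ unt]) (auto simp: hom_def)
next
  case (Cons A l)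
  note [simp] = half_braidingD(1)[OF hb] hb_simps[OF hb] structure_homs
  from Cons obtain P j j' where IH: "P \<in> Obj C" "hom j l [P]" "hom j' [P] l" "j' \<bullet> j = idn l" "j \<bullet> j' = idn [P]"
    "hb W \<gamma> P \<bullet> ([W] \<rhd> j) = (j \<lhd> [W]) \<bullet> hbs W \<gamma> l"
    by auto
  have [simp]: "A \<in> Obj C" "set l \<subseteq> Obj C" using Cons.prems by auto
  note [simp] = IH(1) hom_simps[OF IH(2)] hom_simps[OF IH(3)]
    hom_simps[OF hom_hbs[OF hb]]
  let ?j = "merge A P \<bullet> ([A] \<rhd> j)" and ?j' = "([A] \<rhd> j') \<bullet> split A P"
  have inv: "([A] \<rhd> j') \<bullet> ([A] \<rhd> j) = idn (A # l)" "([A] \<rhd> j) \<bullet> ([A] \<rhd> j') = idn [A, P]"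
    by (simp_all add: lwhisk_comp[symmetric] IH(4,5))
  have "hb W \<gamma> (A \<otimes> P) \<bullet> ([W] \<rhd> ?j) = (hb W \<gamma> (A \<otimes> P) \<bullet> ([W] \<rhd> merge A P)) \<bullet> ([W, A] \<rhd> j)"
    by (simp add: whisk_simps)
  also have "\<dots> = (merge A P \<lhd> [W]) \<bullet> ([A] \<rhd> hb W \<gamma> P) \<bullet> ((hb W \<gamma> A \<lhd> [P]) \<bullet> ([W, A] \<rhd> j))"
    by (simp add: hb_tensor[OF hb] whisk_simps)
  also have "(hb W \<gamma> A \<lhd> [P]) \<bullet> ([W, A] \<rhd> j) = ([A, W] \<rhd> j) \<bullet> (hb W \<gamma> A \<lhd> l)"
    using exchange[OF hom_hb[OF hb, of A] IH(2)] by simp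
  also have "(merge A P \<lhd> [W]) \<bullet> ([A] \<rhd> hb W \<gamma> P) \<bullet> (([A, W] \<rhd> j) \<bullet> (hb W \<gamma> A \<lhd> l))
     = (merge A P \<lhd> [W]) \<bullet> ([A] \<rhd> (hb W \<gamma> P \<bullet> ([W] \<rhd> j))) \<bullet> (hb W \<gamma> A \<lhd> l)"
    by (simp add: whisk_simps)
  also have "\<dots> = (?j \<lhd> [W]) \<bullet> hbs W \<gamma> (A # l)"
    by (simp add: IH(6) whisk_simps)
  finally have "hb W \<gamma> (A \<otimes> P) \<bullet> ([W] \<rhd> ?j) = (?j \<lhd> [W]) \<bullet> hbs W \<gamma> (A # l)" .
  moreover have "?j' \<bullet> ?j = idn (A # l)" "?j \<bullet> ?j' = idn [A \<otimes> P]"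
    by (simp_all add: comp_assoc_diag cancel_whisk pre_inverse[OF inv(2)] inv)
  ultimately show ?case
    by (intro exI[of _ "A \<otimes> P"] exI[of _ ?j] exI[of _ ?j']) (auto simp: hom_def)
qed

text \<open>
  Merge the source and the target of \<open>f\<close> into single strands. The diagram between them comes from an arrow of
  the category, for which the half-braiding is natural.
\<close>

lemma hbs_natural:
  assumes hb: "half_braiding C W \<gamma>" and f: "hom f l m"
  shows "hbs W \<gamma> m \<bullet> ([W] \<rhd> f) = (f \<lhd> [W]) \<bullet> hbs W \<gamma> l"
proof -
  note [simp] = half_braidingD(1)[OF hb] hb_simps[OF hb] structure_homs hom_simps[OF f] hom_obj[OF f]
    hom_simps[OF hom_hbs[OF hb]]
  obtain P j j' where j: "P \<in> Obj C" "hom j l [P]" "hom j' [P] l" "j' \<bullet> j = idn l" "j \<bullet> j' = idn [P]"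
    "hb W \<gamma> P \<bullet> ([W] \<rhd> j) = (j \<lhd> [W]) \<bullet> hbs W \<gamma> l"
    using join[OF hb, of l] by auto
  obtain Q k k' where k: "Q \<in> Obj C" "hom k m [Q]" "hom k' [Q] m" "k' \<bullet> k = idn m" "k \<bullet> k' = idn [Q]"
    "hb W \<gamma> Q \<bullet> ([W] \<rhd> k) = (k \<lhd> [W]) \<bullet> hbs W \<gamma> m"
    using join[OF hb, of m] by auto
  note [simp] = j(1) hom_simps[OF j(2)] hom_simps[OF j(3)]
    k(1) hom_simps[OF k(2)] hom_simps[OF k(3)]
  let ?g = "k \<bullet> f \<bullet> j'"
  obtain g where g: "g \<in> Hom C P Q" "?g = hat P Q g"
    by (rule hat_full[of ?g P Q]) auto
  have g_nat: "hb W \<gamma> Q \<bullet> ([W] \<rhd> ?g) = (?g \<lhd> [W]) \<bullet> hb W \<gamma> P"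
    unfolding g(2) by (rule hb_natural[OF hb]) (use g(1) in auto)
  have gj: "?g \<bullet> j = k \<bullet> f" by (simp add: comp_assoc_diag j)
  have k'g: "k' \<bullet> ?g \<bullet> j = f" by (simp add: gj pre_inverse[OF k(4)])
  have "hbs W \<gamma> m = (k' \<lhd> [W]) \<bullet> (k \<lhd> [W]) \<bullet> hbs W \<gamma> m"
    by (simp add: comp_assoc_diag[symmetric] rwhisk_comp[symmetric] k)
  also have "\<dots> = (k' \<lhd> [W]) \<bullet> hb W \<gamma> Q \<bullet> ([W] \<rhd> k)" by (simp add: k(6))
  finally have "hbs W \<gamma> m \<bullet> ([W] \<rhd> f) = (k' \<lhd> [W]) \<bullet> hb W \<gamma> Q \<bullet> ([W] \<rhd> (?g \<bullet> j))"
    unfolding gj by (simp add: lwhisk_comp comp_assoc_diag)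
  also have "\<dots> = (k' \<lhd> [W]) \<bullet> (hb W \<gamma> Q \<bullet> ([W] \<rhd> ?g)) \<bullet> ([W] \<rhd> j)"
    by (simp add: lwhisk_comp comp_assoc_diag)
  also have "\<dots> = (k' \<lhd> [W]) \<bullet> (?g \<lhd> [W]) \<bullet> (hb W \<gamma> P \<bullet> ([W] \<rhd> j))"
    by (simp only: g_nat comp_assoc_diag)
  also have "\<dots> = ((k' \<bullet> ?g \<bullet> j) \<lhd> [W]) \<bullet> hbs W \<gamma> l"
    by (simp add: j(6) whisk_simps)
  finally show ?thesis by (simp only: k'g)
qed

end

section \<open>The twist\<close>

context pivotal_category
begin

definition twist_diag :: "'a \<Rightarrow> ('a \<Rightarrow> 'b) \<Rightarrow> ('a, 'b) diag" where
  "twist_diag W \<gamma> = trace W [W] [W] (hb W \<gamma> W)"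

lemma hom_twist_diag:
  assumes "half_braiding C W \<gamma>"
  shows "hom (twist_diag W \<gamma>) [W] [W]"
  unfolding twist_diag_def using hom_hb[OF assms half_braidingD(1)[OF assms]] by (intro trace_hom) simp

lemma repr_twist_arrow:
  assumes hb: "half_braiding C W \<gamma>"
  shows "repr W W (twist_arrow (drinfeld_center C) (W, \<gamma>)) (twist_diag W \<gamma>)"
proof -
  note [simp] = half_braidingD(1)[OF hb] hb_simps[OF hb] structure_homs ev_hom coev_hom piv_hom half_braiding_hom[OF hb]
  let ?D = "dual C W"
  let ?f = "runit C W \<cdot> (ide C W \<odot> ev C ?D) \<cdot> (ide C W \<odot> (piv C W \<odot> ide C ?D)) \<cdot>
     assoc C W W ?D \<cdot> (\<gamma> W \<odot> ide C ?D) \<cdot> assoc' C W W ?D \<cdot>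
     (ide C W \<odot> coev C W) \<cdot> runit' C W"
  have "twist_arrow (drinfeld_center C) (W, \<gamma>) = ?f"
    by (simp add: twist_arrow_def drinfeld_center_def)
  moreover have "repr W W ?f ((([W] \<rhd> unt) \<bullet> split W \<one>) \<bullet>
     (merge W \<one> \<bullet> ([W] \<rhd> hat (dual C ?D \<otimes> ?D) \<one> (ev C ?D)) \<bullet> split W (dual C ?D \<otimes> ?D)) \<bullet>
     (merge W (dual C ?D \<otimes> ?D) \<bullet> ([W] \<rhd> (merge (dual C ?D) ?D \<bullet> (hat W (dual C ?D) (piv C W) \<lhd> [?D]) \<bullet> split W ?D)) \<bullet> split W (W \<otimes> ?D)) \<bullet>
     (merge W (W \<otimes> ?D) \<bullet> ([W] \<rhd> merge W ?D) \<bullet> (split W W \<lhd> [?D]) \<bullet> split (W \<otimes> W) ?D) \<bullet>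
     (merge (W \<otimes> W) ?D \<bullet> (hat (W \<otimes> W) (W \<otimes> W) (\<gamma> W) \<lhd> [?D]) \<bullet> split (W \<otimes> W) ?D) \<bullet>
     (merge (W \<otimes> W) ?D \<bullet> (merge W W \<lhd> [?D]) \<bullet> ([W] \<rhd> split W ?D) \<bullet> split W (W \<otimes> ?D)) \<bullet>
     (merge W (W \<otimes> ?D) \<bullet> ([W] \<rhd> hat \<one> (W \<otimes> ?D) (coev C W)) \<bullet> split W \<one>) \<bullet>
     (merge W \<one> \<bullet> ([W] \<rhd> unt')))" (is "repr _ _ _ ?G")
    by (rule repr_comp repr_runit repr_runit' repr_assoc repr_assoc' repr_left repr_right repr_hat | simp)+
  moreover have "?G = twist_diag W \<gamma>"
    by (simp add: twist_diag_def trace_def cap'_def cap_def cup_def pairing_def piv_diag_def hb_def whisk_simps cancel_whisk)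
  ultimately show ?thesis by simp
qed

text \<open>
  Pull \<open>i\<close> through the crossing, slide it around the loop, and pull it through the crossing again.
\<close>

lemma twist_diag_natural:
  assumes hb: "half_braiding C W \<gamma>" and hb2: "half_braiding C V \<delta>" and i: "hom i [V] [W]"
    and central: "hb W \<gamma> W \<bullet> (i \<lhd> [W]) = ([W] \<rhd> i) \<bullet> hb V \<delta> W"
  shows "twist_diag W \<gamma> \<bullet> i = i \<bullet> twist_diag V \<delta>"
proof -
  note [simp] = half_braidingD(1)[OF hb] hb_simps[OF hb] half_braidingD(1)[OF hb2] hb_simps[OF hb2]
  have "twist_diag W \<gamma> \<bullet> i = trace W [V] [W] (hb W \<gamma> W \<bullet> (i \<lhd> [W]))"
    unfolding twist_diag_def by (rule trace_natural_right[symmetric]) (use i in auto)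
  also have "\<dots> = trace W [V] [W] (([W] \<rhd> i) \<bullet> hb V \<delta> W)" by (simp add: central)
  also have "\<dots> = trace V [V] [W] (hb V \<delta> W \<bullet> ([V] \<rhd> i))"
    by (rule trace_slide[OF i, symmetric]) (simp add: hom_def)
  also have "hb V \<delta> W \<bullet> ([V] \<rhd> i) = (i \<lhd> [V]) \<bullet> hb V \<delta> V"
    using hbs_natural[OF hb2 i] hbs_single[OF hb2, of W] hbs_single[OF hb2, of V] by (simp del: hbs.simps)
  also have "trace V [V] [W] \<dots> = i \<bullet> twist_diag V \<delta>"
    unfolding twist_diag_def by (rule trace_natural_left) (use i in auto)
  finally show ?thesis .
qed

text \<open>
  A strand \<open>A\<close> that crosses the loop over \<open>Y\<close> twice can be pulled out of it. The trace over \<open>A\<close> detects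
  the equation. After closing \<open>A\<close> as well, the crossing can be slid around both loops, where it cancels
  against its inverse up to moving the test diagram \<open>k\<close> through it; then the closed strand \<open>A\<close>
  is separated from the loop \<open>Y\<close>.
\<close>

lemma trace_conjugate:
  assumes hb: "half_braiding C Y \<gamma>" and A[simp]: "A \<in> Obj C" and h: "hom h (l @ [Y]) (m @ [Y])"
  shows "trace Y (l @ [A]) (m @ [A]) ((m \<rhd> hb Y \<gamma> A) \<bullet> (h \<lhd> [A]) \<bullet> (l \<rhd> hb' Y \<gamma> A)) = trace Y l m h \<lhd> [A]"
    (is "?u = ?v")
proof (rule trace_detects[OF A])
  note [simp] = half_braidingD(1)[OF hb] hb_simps[OF hb] hom_simps[OF h]
    hom_simps[OF hom_hbs[OF hb]]
  have [simp]: "set l \<subseteq> Obj C" "set m \<subseteq> Obj C" using hom_obj[OF h] by auto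
  note th = trace_hom[OF h]
  note [simp] = hom_simps[OF th]
  show "hom ?u (l @ [A]) (m @ [A])" by (rule trace_hom) (simp add: hom_def)
  show "hom ?v (l @ [A]) (m @ [A])" by (simp add: hom_def)
  fix B k assume k: "hom k (B @ [A]) [A]"
  note [simp] = hom_simps[OF k]
  have [simp]: "set B \<subseteq> Obj C" using hom_obj[OF k] by auto
  let ?g = "hb Y \<gamma> A" and ?g' = "hb' Y \<gamma> A"
  let ?e = "trace A B [] k"
  have he: "hom ?e B []" using trace_hom[of k B A "[]"] k by simp
  note [simp] = hom_simps[OF he]
  obtain b where b: "hom b (B @ [Y]) (Y # B)" "b \<bullet> hbs Y \<gamma> B = idn (Y # B)" "hbs Y \<gamma> B \<bullet> b = idn (B @ [Y])"
    using hbs_inverse[OF hb, of B] by auto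
  note [simp] = hom_simps[OF b(1)]
  let ?f = "(h \<lhd> [A]) \<bullet> (l \<rhd> ?g') \<bullet> (l \<rhd> k \<lhd> [Y])"
  have "?u \<bullet> (l \<rhd> k) = trace Y (l @ B @ [A]) (m @ [A]) (((m \<rhd> ?g) \<bullet> (h \<lhd> [A]) \<bullet> (l \<rhd> ?g')) \<bullet> ((l \<rhd> k) \<lhd> [Y]))"
    by (rule trace_natural_right[symmetric]) (auto simp: hom_def)
  then have "trace A (l @ B) m (?u \<bullet> (l \<rhd> k)) =
      trace A (l @ B) m (trace Y ((l @ B) @ [A]) (m @ [A]) ((m \<rhd> ?g) \<bullet> ?f))"
    by (simp add: whisk_simps)
  also have "\<dots> = trace Y (l @ B) m (trace A ((l @ B) @ [Y]) (m @ [Y]) (?f \<bullet> ((l @ B) \<rhd> ?g)))"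
    by (rule trace_slide2[symmetric]) (auto simp: hom_def)
  also have "?f \<bullet> ((l @ B) \<rhd> ?g) = (h \<lhd> [A]) \<bullet> (l \<rhd> (?g' \<bullet> (k \<lhd> [Y]) \<bullet> (B \<rhd> ?g)))"
    by (simp add: whisk_simps)
  \<comment> \<open>Pull \<open>k\<close> through the crossing; the crossing with \<open>A\<close> cancels, and one with \<open>B\<close> is left.\<close>
  also have "?g' \<bullet> (k \<lhd> [Y]) \<bullet> (B \<rhd> ?g) = ([Y] \<rhd> k) \<bullet> (b \<lhd> [A])"
  proof -
    have "?g \<bullet> ([Y] \<rhd> k) = (k \<lhd> [Y]) \<bullet> (B \<rhd> ?g) \<bullet> (hbs Y \<gamma> B \<lhd> [A])"
      using hbs_natural[OF hb k] hbs_single[OF hb A] by (simp add: hbs_append[OF hb] del: hbs.simps)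
    then have "(?g \<bullet> ([Y] \<rhd> k)) \<bullet> (b \<lhd> [A]) = ((k \<lhd> [Y]) \<bullet> (B \<rhd> ?g)) \<bullet> ((hbs Y \<gamma> B \<bullet> b) \<lhd> [A])"
      by (simp add: whisk_simps)
    then have "?g \<bullet> (([Y] \<rhd> k) \<bullet> (b \<lhd> [A])) = (k \<lhd> [Y]) \<bullet> (B \<rhd> ?g)"
      by (simp add: b(3) comp_assoc_diag)
    then show ?thesis
      using pre_inverse[OF hb_inverse(1)[OF hb A], of "([Y] \<rhd> k) \<bullet> (b \<lhd> [A])"] by simp
  qed
  also have "(h \<lhd> [A]) \<bullet> (l \<rhd> (([Y] \<rhd> k) \<bullet> (b \<lhd> [A]))) = ((h \<lhd> [A]) \<bullet> ((l @ [Y]) \<rhd> k)) \<bullet> ((l \<rhd> b) \<lhd> [A])"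
    by (simp add: whisk_simps)
  also have "trace A ((l @ B) @ [Y]) (m @ [Y]) \<dots> = trace A ((l @ [Y]) @ B) (m @ [Y]) ((h \<lhd> [A]) \<bullet> ((l @ [Y]) \<rhd> k)) \<bullet> (l \<rhd> b)"
    by (rule trace_natural_right) (auto simp: hom_def)
  also have "trace A ((l @ [Y]) @ B) (m @ [Y]) ((h \<lhd> [A]) \<bullet> ((l @ [Y]) \<rhd> k)) = h \<bullet> trace A ((l @ [Y]) @ B) (l @ [Y]) ((l @ [Y]) \<rhd> k)"
    by (rule trace_natural_left[OF A h])
  also have "trace A ((l @ [Y]) @ B) (l @ [Y]) ((l @ [Y]) \<rhd> k) = (l @ [Y]) \<rhd> ?e"
    using trace_whisk[of A "l @ [Y]" B "[]" k] by simp
  also have "(h \<bullet> ((l @ [Y]) \<rhd> ?e)) \<bullet> (l \<rhd> b) = h \<bullet> (l \<rhd> (([Y] \<rhd> ?e) \<bullet> b))"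
    by (simp add: whisk_simps)
  \<comment> \<open>The closed strand \<open>A\<close> is a diagram \<open>e\<close> from \<open>B\<close> to the empty word, which the strand \<open>Y\<close> crosses freely.\<close>
  also have "([Y] \<rhd> ?e) \<bullet> b = ?e \<lhd> [Y]"
  proof -
    have "[Y] \<rhd> ?e = (?e \<lhd> [Y]) \<bullet> hbs Y \<gamma> B"
      using hbs_natural[OF hb he] by simp
    then show ?thesis by (simp add: comp_assoc_diag b(3))
  qed
  also have "h \<bullet> (l \<rhd> (?e \<lhd> [Y])) = h \<bullet> ((l \<rhd> ?e) \<lhd> [Y])"
    by (simp add: whisk_simps)
  also have "trace Y (l @ B) m \<dots> = trace Y l m h \<bullet> (l \<rhd> ?e)"
    by (rule trace_natural_right) (auto simp: hom_def)
  also have "\<dots> = trace Y l m h \<bullet> trace A (l @ B) l (l \<rhd> k)"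
    using trace_whisk[of A l B "[]" k] by simp
  also have "\<dots> = trace A (l @ B) m (?v \<bullet> (l \<rhd> k))"
    by (rule trace_natural_left[symmetric]) (use th in auto)
  finally show "trace A (l @ B) m (?u \<bullet> (l \<rhd> k)) = trace A (l @ B) m (?v \<bullet> (l \<rhd> k))" .
qed

text \<open>
  Crossing \<open>A\<close> before or after the self-crossing of \<open>Y\<close> makes no difference (the Yang-Baxter equation, an instance of
  naturality). The extra crossings with the loop are removed by \<open>trace_conjugate\<close>.
\<close>

lemma twist_diag_central:
  assumes hb: "half_braiding C Y \<gamma>" and A[simp]: "A \<in> Obj C"
  shows "hb Y \<gamma> A \<bullet> (twist_diag Y \<gamma> \<lhd> [A]) = ([A] \<rhd> twist_diag Y \<gamma>) \<bullet> hb Y \<gamma> A"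
proof -
  note [simp] = half_braidingD(1)[OF hb] hb_simps[OF hb]
  let ?g = "hb Y \<gamma> A" and ?g' = "hb' Y \<gamma> A" and ?y = "hb Y \<gamma> Y"
  have "([A] \<rhd> ?y) \<bullet> (?g \<lhd> [Y]) \<bullet> ([Y] \<rhd> ?g) = (?g \<lhd> [Y]) \<bullet> ([Y] \<rhd> ?g) \<bullet> (?y \<lhd> [A])"
    using hbs_natural[OF hb hom_hb[OF hb A]] by (simp add: comp_assoc_diag)
  then have "(([A] \<rhd> ?y) \<bullet> (?g \<lhd> [Y]) \<bullet> ([Y] \<rhd> ?g)) \<bullet> ([Y] \<rhd> ?g') = ((?g \<lhd> [Y]) \<bullet> ([Y] \<rhd> ?g) \<bullet> (?y \<lhd> [A])) \<bullet> ([Y] \<rhd> ?g')"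
    by simp
  then have eq: "([A] \<rhd> ?y) \<bullet> (?g \<lhd> [Y]) = (?g \<lhd> [Y]) \<bullet> (([Y] \<rhd> ?g) \<bullet> (?y \<lhd> [A]) \<bullet> ([Y] \<rhd> ?g'))"
    by (simp add: comp_assoc_diag lwhisk_comp[symmetric] hb_inverse[OF hb])
  have "([A] \<rhd> twist_diag Y \<gamma>) \<bullet> ?g = trace Y [A, Y] [A, Y] ([A] \<rhd> ?y) \<bullet> ?g"
    using trace_whisk[of Y "[A]" "[Y]" "[Y]" ?y] by (simp add: twist_diag_def)
  also have "\<dots> = trace Y [Y, A] [A, Y] (([A] \<rhd> ?y) \<bullet> (?g \<lhd> [Y]))"
    by (rule trace_natural_right[symmetric]) (auto simp: hom_def)
  also have "\<dots> = ?g \<bullet> trace Y [Y, A] [Y, A] (([Y] \<rhd> ?g) \<bullet> (?y \<lhd> [A]) \<bullet> ([Y] \<rhd> ?g'))"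
    unfolding eq by (rule trace_natural_left) (auto simp: hom_def)
  also have "trace Y [Y, A] [Y, A] (([Y] \<rhd> ?g) \<bullet> (?y \<lhd> [A]) \<bullet> ([Y] \<rhd> ?g')) = twist_diag Y \<gamma> \<lhd> [A]"
    using trace_conjugate[OF hb A, of ?y "[Y]" "[Y]"] by (simp add: hom_def twist_diag_def)
  finally show ?thesis ..
qed

end

section \<open>Schur's lemma\<close>

context linear_category
begin

sublocale vs: vector_space "scale C"
  by (rule vector_space)

lemma zero_in_hom [simp]: "\<lbrakk>A \<in> Obj C; B \<in> Obj C\<rbrakk> \<Longrightarrow> 0 \<in> Hom C A B"
  and add_in_hom: "\<lbrakk>A \<in> Obj C; B \<in> Obj C; f \<in> Hom C A B; g \<in> Hom C A B\<rbrakk> \<Longrightarrow> f + g \<in> Hom C A B"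
  and scale_in_hom: "\<lbrakk>A \<in> Obj C; B \<in> Obj C; f \<in> Hom C A B\<rbrakk> \<Longrightarrow> scale C c f \<in> Hom C A B"
  and diff_in_hom: "\<lbrakk>A \<in> Obj C; B \<in> Obj C; f \<in> Hom C A B; g \<in> Hom C A B\<rbrakk> \<Longrightarrow> f - g \<in> Hom C A B"
  using hom_subspace vs.subspace_0 vs.subspace_add vs.subspace_scale vs.subspace_diff by blast+

lemma sum_in_hom: "\<lbrakk>A \<in> Obj C; B \<in> Obj C; \<And>i. i \<in> I \<Longrightarrow> f i \<in> Hom C A B\<rbrakk> \<Longrightarrow> sum f I \<in> Hom C A B"
  using hom_subspace vs.subspace_sum by blast

lemma comp_zero_left: "\<lbrakk>A \<in> Obj C; B \<in> Obj C; D \<in> Obj C; f \<in> Hom C A B\<rbrakk> \<Longrightarrow> 0 \<cdot> f = 0"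
  using comp_scale_left[of A B D f 0 0] by simp

lemma comp_zero_right: "\<lbrakk>A \<in> Obj C; B \<in> Obj C; D \<in> Obj C; g \<in> Hom C B D\<rbrakk> \<Longrightarrow> g \<cdot> 0 = 0"
  using comp_scale_right[of A B D 0 g 0] by simp

lemma comp_diff_left: "\<lbrakk>A \<in> Obj C; B \<in> Obj C; D \<in> Obj C; f \<in> Hom C A B; g \<in> Hom C B D; h \<in> Hom C B D\<rbrakk>
    \<Longrightarrow> (g - h) \<cdot> f = (g \<cdot> f) - (h \<cdot> f)"
  using comp_add_left[of A B D f "g - h" h] diff_in_hom[of B D g h] by simp

lemma comp_diff_right: "\<lbrakk>A \<in> Obj C; B \<in> Obj C; D \<in> Obj C; f \<in> Hom C A B; g \<in> Hom C A B; h \<in> Hom C B D\<rbrakk>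
    \<Longrightarrow> h \<cdot> (f - g) = (h \<cdot> f) - (h \<cdot> g)"
  using comp_add_right[of A B D "f - g" g h] diff_in_hom[of A B f g] by simp

lemma comp_sum_left: "\<lbrakk>A \<in> Obj C; B \<in> Obj C; D \<in> Obj C; f \<in> Hom C A B; \<And>i. i \<in> I \<Longrightarrow> g i \<in> Hom C B D\<rbrakk>
    \<Longrightarrow> (\<Sum>i\<in>I. g i) \<cdot> f = (\<Sum>i\<in>I. g i \<cdot> f)"
proof (induction I rule: infinite_finite_induct)
  case (insert i I)
  then show ?case
    using comp_add_left[of A B D f "g i" "sum g I"] sum_in_hom[of B D I g] by simp
qed (auto intro: comp_zero_left)

lemma comp_sum_right: "\<lbrakk>A \<in> Obj C; B \<in> Obj C; D \<in> Obj C; g \<in> Hom C B D; \<And>i. i \<in> I \<Longrightarrow> f i \<in> Hom C A B\<rbrakk>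
    \<Longrightarrow> g \<cdot> (\<Sum>i\<in>I. f i) = (\<Sum>i\<in>I. g \<cdot> f i)"
proof (induction I rule: infinite_finite_induct)
  case (insert i I)
  then show ?case
    using comp_add_right[of A B D "f i" "sum f I" g] sum_in_hom[of A B I f] by simp
qed (auto intro: comp_zero_right)

lemma zero_object_iff: "A \<in> Obj C \<Longrightarrow> zero_object C A \<longleftrightarrow> ide C A = 0"
proof
  assume A: "A \<in> Obj C"
  show "ide C A = 0" if "zero_object C A"
    using that A ide_in[OF A] by (auto simp: zero_object_def)
  assume 0: "ide C A = 0"
  have "f = 0" if "B \<in> Obj C" "f \<in> Hom C B A" for B f
    using ide_left[OF that(1) A that(2)] comp_zero_left[OF that(1) A A that(2)] 0 by simp
  moreover have "f = 0" if "B \<in> Obj C" "f \<in> Hom C A B" for B f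
    using ide_right[OF A that(1,2)] comp_zero_right[OF A A that] 0 by simp
  ultimately show "zero_object C A"
    using A by (auto simp: zero_object_def)
qed

lemma simple_objectD:
  assumes "simple_object C A"
  shows "A \<in> Obj C" "ide C A \<noteq> 0"
  using assms zero_object_iff[of A] by (auto simp: simple_object_def)

primrec power_arrow :: "'o \<Rightarrow> 'm \<Rightarrow> nat \<Rightarrow> 'm" where
  "power_arrow A f 0 = ide C A"
| "power_arrow A f (Suc k) = f \<cdot> power_arrow A f k"

lemma power_arrow_hom: "\<lbrakk>A \<in> Obj C; f \<in> Hom C A A\<rbrakk> \<Longrightarrow> power_arrow A f k \<in> Hom C A A"
  by (induction k) (auto intro: ide_in comp_in)

lemma power_arrow_commute: "\<lbrakk>A \<in> Obj C; f \<in> Hom C A A\<rbrakk> \<Longrightarrow> power_arrow A f k \<cdot> f = f \<cdot> power_arrow A f k"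
proof (induction k)
  case (Suc k)
  then show ?case
    using comp_assoc[of A A A A f "power_arrow A f k" f] power_arrow_hom[of A f k] by simp
qed (simp add: ide_left ide_right)

definition poly_arrow :: "'o \<Rightarrow> 'm \<Rightarrow> complex poly \<Rightarrow> 'm" where
  "poly_arrow A f p = (\<Sum>i\<le>degree p. scale C (coeff p i) (power_arrow A f i))"

lemma poly_arrow_bound: "degree p \<le> n \<Longrightarrow> poly_arrow A f p = (\<Sum>i\<le>n. scale C (coeff p i) (power_arrow A f i))"
  unfolding poly_arrow_def by (rule sum.mono_neutral_left) (auto simp: coeff_eq_0)

lemma poly_arrow_hom: "\<lbrakk>A \<in> Obj C; f \<in> Hom C A A\<rbrakk> \<Longrightarrow> poly_arrow A f p \<in> Hom C A A"
  unfolding poly_arrow_def by (auto intro!: sum_in_hom scale_in_hom power_arrow_hom)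

lemma poly_arrow_add: "poly_arrow A f (p + q) = poly_arrow A f p + poly_arrow A f q"
proof -
  let ?n = "max (degree p) (degree q)"
  show ?thesis
    by (simp add: poly_arrow_bound[of _ ?n] degree_add_le_max vs.scale_left_distrib sum.distrib)
qed

lemma poly_arrow_smult: "poly_arrow A f (smult c p) = scale C c (poly_arrow A f p)"
  by (simp add: poly_arrow_bound[of "smult c p" "degree p"] degree_smult_le poly_arrow_def vs.scale_sum_right)

lemma poly_arrow_pCons:
  assumes "A \<in> Obj C" "f \<in> Hom C A A"
  shows "poly_arrow A f (pCons c p) = scale C c (ide C A) + (f \<cdot> poly_arrow A f p)"
proof -
  have "poly_arrow A f (pCons c p) = (\<Sum>i\<le>Suc (degree p). scale C (coeff (pCons c p) i) (power_arrow A f i))"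
    by (rule poly_arrow_bound) (simp add: degree_pCons_le)
  also have "\<dots> = scale C c (ide C A) + (\<Sum>i\<le>degree p. scale C (coeff p i) (f \<cdot> power_arrow A f i))"
    by (simp add: sum.atMost_Suc_shift del: sum.atMost_Suc)
  also have "(\<Sum>i\<le>degree p. scale C (coeff p i) (f \<cdot> power_arrow A f i)) = f \<cdot> poly_arrow A f p"
    unfolding poly_arrow_def using assms power_arrow_hom[OF assms]
    by (subst comp_sum_right[where A = A and B = A and D = A])
       (auto simp: comp_scale_right[where A = A and B = A and D = A] scale_in_hom)
  finally show ?thesis .
qed

lemma poly_arrow_linear_factor:
  assumes "A \<in> Obj C" "f \<in> Hom C A A"
  shows "poly_arrow A f ([:- t, 1:] * p) = (f - scale C t (ide C A)) \<cdot> poly_arrow A f p"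
proof -
  note p = poly_arrow_hom[OF assms, of p]
  have "[:- t, 1:] * p = smult (- t) p + pCons 0 p" by simp
  then have "poly_arrow A f ([:- t, 1:] * p) = (f \<cdot> poly_arrow A f p) - scale C t (poly_arrow A f p)"
    using assms by (simp only: poly_arrow_add poly_arrow_smult poly_arrow_pCons) simp
  also have "\<dots> = (f - scale C t (ide C A)) \<cdot> poly_arrow A f p"
    using assms p comp_diff_left[of A A A "poly_arrow A f p" f "scale C t (ide C A)"]
      comp_scale_left[of A A A "poly_arrow A f p" "ide C A" t] ide_left[of A A "poly_arrow A f p"]
    by (simp add: scale_in_hom ide_in)
  finally show ?thesis .
qed

end

context abelian_category
begin

lemma kernel_mono: "is_kernel C A B f K k \<Longrightarrow> A \<in> Obj C \<Longrightarrow> B \<in> Obj C \<Longrightarrow> f \<in> Hom C A B \<Longrightarrow> mono_arrow C K A k"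
  unfolding mono_arrow_def
proof (intro conjI ballI impI)
  assume ker: "is_kernel C A B f K k" and AB: "A \<in> Obj C" "B \<in> Obj C" "f \<in> Hom C A B"
  then have K: "K \<in> Obj C" and k: "k \<in> Hom C K A" and fk: "f \<cdot> k = 0" by (auto simp: is_kernel_def)
  show "k \<in> Hom C K A" by (rule k)
  fix D g h assume D: "D \<in> Obj C" and g: "g \<in> Hom C D K" and h: "h \<in> Hom C D K" and eq: "k \<cdot> g = k \<cdot> h"
  have "f \<cdot> (k \<cdot> g) = 0"
    using comp_assoc[OF D K AB(1,2) g k AB(3)] fk comp_zero_left[OF D K AB(2) g] by simp
  moreover have "k \<cdot> g \<in> Hom C D A" using D K AB(1) g k by (rule comp_in)
  ultimately have "\<exists>!u. u \<in> Hom C D K \<and> k \<cdot> u = k \<cdot> g"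
    using ker D unfolding is_kernel_def by blast
  then show "g = h" using g h eq by auto
qed

text \<open>
  The kernel of \<open>f\<close> is a subobject of \<open>A\<close>. It is not all of \<open>A\<close>, hence zero, so that \<open>f\<close> is a monomorphism
  into \<open>B\<close>.
\<close>

lemma schur_iso:
  assumes A: "simple_object C A" and B: "simple_object C B" and f: "f \<in> Hom C A B" "f \<noteq> 0"
  shows "iso_arrow C A B f"
proof -
  note A' = simple_objectD[OF A] and B' = simple_objectD[OF B]
  obtain K k where ker: "is_kernel C A B f K k" using kernels[OF A'(1) B'(1) f(1)] by auto
  then have K: "K \<in> Obj C" and k: "k \<in> Hom C K A" and fk: "f \<cdot> k = 0" by (auto simp: is_kernel_def)
  have "\<not> iso_arrow C K A k"
  proof
    assume "iso_arrow C K A k"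
    then obtain g where g: "inverse_arrows C K A k g" by (auto simp: iso_arrow_def)
    note g' = inverse_arrowsD[OF g]
    have "f = (f \<cdot> k) \<cdot> g"
      using comp_assoc[OF A'(1) K A'(1) B'(1) g'(2) k f(1)] g'(4) ide_right[OF A'(1) B'(1) f(1)] by simp
    then show False using fk f(2) comp_zero_left[OF A'(1) K B'(1) g'(2)] by simp
  qed
  then have K0: "zero_object C K"
    using A K kernel_mono[OF ker A'(1) B'(1) f(1)] unfolding simple_object_def by blast
  have "mono_arrow C A B f"
    unfolding mono_arrow_def
  proof (intro conjI ballI impI)
    fix D g h assume D: "D \<in> Obj C" and g: "g \<in> Hom C D A" and h: "h \<in> Hom C D A" and eq: "f \<cdot> g = f \<cdot> h"
    have "f \<cdot> (g - h) = 0"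
      using comp_diff_right[OF D A'(1) B'(1) g h f(1)] eq by simp
    then obtain u where u: "u \<in> Hom C D K" "k \<cdot> u = g - h"
      using ker D diff_in_hom[OF D A'(1) g h] unfolding is_kernel_def by blast
    have "u = 0" using u(1) K0 D by (auto simp: zero_object_def)
    then have "g - h = 0" using u(2) comp_zero_right[OF D K A'(1) k] by simp
    then show "g = h" by simp
  qed (rule f)
  then show ?thesis
    using A B A'(1) unfolding simple_object_def by blast
qed

end

context finite_semisimple_category
begin

text \<open>
  The powers of \<open>f\<close> lie in a finite-dimensional space. If two of them coincide, their difference is the
  required polynomial; otherwise enough of them are linearly dependent.
\<close>

lemma endomorphism_annihilated:
  assumes A: "A \<in> Obj C" and f: "f \<in> Hom C A A"
  shows "\<exists>p. p \<noteq> 0 \<and> poly_arrow A f p = 0"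
proof -
  obtain U where U: "finite U" "vs.span U = Hom C A A"
    using finite_dimensional_hom[OF A A] by auto
  let ?n = "card U" and ?e = "power_arrow A f"
  show ?thesis
  proof (cases "inj_on ?e {..?n}")
    case True
    let ?S = "?e ` {..?n}"
    have "vs.dependent ?S"
    proof (rule ccontr)
      assume "\<not> vs.dependent ?S"
      then have "card ?S \<le> card U"
        using vs.independent_span_bound[OF U(1), of ?S] U(2) power_arrow_hom[OF A f] by auto
      then show False using card_image[OF True] by simp
    qed
    then obtain u v where uv: "v \<in> ?S" "u v \<noteq> 0" "(\<Sum>v\<in>?S. scale C (u v) v) = 0"
      using vs.dependent_finite[of ?S] by auto
    then obtain i where i: "i \<le> ?n" "u (?e i) \<noteq> 0" by auto
    define p where "p = (\<Sum>i\<le>?n. monom (u (?e i)) i)"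
    have coeff: "coeff p j = (if j \<le> ?n then u (?e j) else 0)" for j
      by (simp add: p_def coeff_sum)
    have "p \<noteq> 0" using i coeff[of i] by auto
    moreover have "degree p \<le> ?n" by (rule degree_le) (simp add: coeff)
    then have "poly_arrow A f p = (\<Sum>i\<le>?n. scale C (u (?e i)) (?e i))"
      by (simp add: poly_arrow_bound coeff)
    then have "poly_arrow A f p = 0"
      using uv(3) sum.reindex[OF True, of "\<lambda>v. scale C (u v) v"] by simp
    ultimately show ?thesis by blast
  next
    case False
    then obtain i j where ij: "i \<noteq> j" "?e i = ?e j" by (auto simp: inj_on_def)
    let ?p = "monom 1 i + smult (- 1) (monom 1 j) :: complex poly"
    have m: "poly_arrow A f (monom 1 k) = ?e k" for k
      by (subst poly_arrow_bound[of _ k]) (auto simp: degree_monom_le if_distrib[of "\<lambda>c. scale C c x" for x] cong: if_cong)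
    have "coeff ?p i \<noteq> 0" using ij(1) by simp
    then have "?p \<noteq> 0" by (metis coeff_0)
    moreover have "poly_arrow A f ?p = 0"
      by (simp only: poly_arrow_add poly_arrow_smult m) (simp add: ij(2))
    ultimately show ?thesis by blast
  qed
qed

text \<open>
  A polynomial that annihilates \<open>f\<close> has a root \<open>t\<close>. If \<open>f - t\<close> is not zero, it is invertible, and the linear factor
  can be removed from the polynomial; this cannot go on until the polynomial is constant.
\<close>

lemma schur_scalar:
  assumes S: "simple_object C A" and f: "f \<in> Hom C A A"
  shows "\<exists>t. f = scale C t (ide C A)"
proof -
  note A = simple_objectD[OF S]
  have "p \<noteq> 0 \<Longrightarrow> poly_arrow A f p = 0 \<Longrightarrow> \<exists>t. f = scale C t (ide C A)" for p
  proof (induction "degree p" arbitrary: p rule: less_induct)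
    case less
    show ?case
    proof (cases "degree p = 0")
      case True
      then obtain c where c: "p = [:c:]" by (rule degree_eq_zeroE)
      then show ?thesis using less.prems A(2) by (simp add: poly_arrow_def)
    next
      case False
      then have "\<not> constant (poly p)" by (simp add: constant_degree)
      then obtain t where "poly p t = 0" using fundamental_theorem_of_algebra by blast
      then obtain q where q: "p = [:- t, 1:] * q" by (auto simp: poly_eq_0_iff_dvd)
      have q0: "q \<noteq> 0" using q less.prems(1) by auto
      let ?g = "f - scale C t (ide C A)"
      have g: "?g \<in> Hom C A A" using f A(1) by (auto intro!: diff_in_hom scale_in_hom ide_in)
      show ?thesis
      proof (cases "?g = 0")
        case True
        then show ?thesis by auto
      next
        case False
        from schur_iso[OF S S g False] obtain h where h: "inverse_arrows C A A ?g h"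
          by (auto simp: iso_arrow_def)
        note q_hom = poly_arrow_hom[OF A(1) f, of q]
        have "?g \<cdot> poly_arrow A f q = 0"
          using less.prems(2) poly_arrow_linear_factor[OF A(1) f, of t q] q by simp
        then have "poly_arrow A f q = 0"
          using comp_assoc[OF A(1) A(1) A(1) A(1) q_hom g inverse_arrowsD(2)[OF h]] inverse_arrowsD(3)[OF h]
            ide_left[OF A(1) A(1) q_hom] comp_zero_right[OF A(1) A(1) A(1) inverse_arrowsD(2)[OF h]] by simp
        moreover have "degree q < degree p" using q0 degree_mult_eq[of "[:- t, 1:]" q] q by simp
        ultimately show ?thesis using less.hyps q0 by blast
      qed
    qed
  qed
  then show ?thesis using endomorphism_annihilated[OF A(1) f] by blast
qed

text \<open>
  Some projection of \<open>W\<close> to a simple summand would not vanish on \<open>f\<close>; composed with \<open>f\<close> it is an isomorphism, and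
  its inverse leads back to \<open>X\<close>.
\<close>

lemma simple_detects_zero:
  assumes S: "simple_object C X" and W: "W \<in> Obj C" and f: "f \<in> Hom C X W"
    and 0: "\<And>p. p \<in> Hom C W X \<Longrightarrow> p \<cdot> f = 0"
  shows "f = 0"
proof -
  note X = simple_objectD[OF S]
  obtain n T i p where ds: "direct_sum C n T W i p" and simp: "\<forall>k<n. simple_object C (T k)"
    using semisimple[OF W] by blast
  have T: "T k \<in> Obj C" "i k \<in> Hom C (T k) W" "p k \<in> Hom C W (T k)" if "k < n" for k
    using ds that by (auto simp: direct_sum_def)
  have pf: "p k \<cdot> f = 0" if k: "k < n" for k
  proof (rule ccontr)
    assume ne: "p k \<cdot> f \<noteq> 0"
    have pk: "p k \<cdot> f \<in> Hom C X (T k)" using comp_in[OF X(1) W T(1)[OF k] f T(3)[OF k]] .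
    have "iso_arrow C X (T k) (p k \<cdot> f)"
      using schur_iso[OF S _ pk ne] simp k by blast
    then obtain q where "inverse_arrows C X (T k) (p k \<cdot> f) q" by (auto simp: iso_arrow_def)
    note q = inverse_arrowsD[OF this]
    have "(q \<cdot> p k) \<cdot> f = ide C X"
      using comp_assoc[OF X(1) W T(1)[OF k] X(1) f T(3)[OF k] q(2)] q(3) by simp
    moreover have "(q \<cdot> p k) \<cdot> f = 0"
      by (rule 0[OF comp_in[OF W T(1)[OF k] X(1) T(3)[OF k] q(2)]])
    ultimately show False using X(2) by simp
  qed
  have "f = (\<Sum>k<n. i k \<cdot> p k) \<cdot> f"
    using ds ide_left[OF X(1) W f] by (simp add: direct_sum_def)
  also have "\<dots> = (\<Sum>k<n. (i k \<cdot> p k) \<cdot> f)"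
    by (rule comp_sum_left[OF X(1) W W f]) (auto intro!: comp_in[OF W T(1) W] T)
  also have "\<dots> = (\<Sum>k<n. 0)"
  proof (rule sum.cong[OF refl])
    fix k assume "k \<in> {..<n}"
    then have k: "k < n" by simp
    show "(i k \<cdot> p k) \<cdot> f = 0"
      using comp_assoc[OF X(1) W T(1)[OF k] W f T(3)[OF k] T(2)[OF k]] pf[OF k]
        comp_zero_right[OF X(1) T(1)[OF k] W T(2)[OF k]] by simp
  qed
  finally show ?thesis by simp
qed

end

section \<open>Scalars\<close>

context spherical_fusion_category
begin

text \<open>
  Scalars are diagrams without strands. Multiplying a diagram \<open>f\<close> with source \<open>a\<close> by \<open>c\<close> means composing it with
  \<open>scalar c \<lhd> a\<close>.
\<close>

definition scalar :: "complex \<Rightarrow> ('o, 'm) diag" where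
  "scalar c = Diag [] (\<lambda>D\<in>Obj C. scale C c (ide C D)) []"

lemma scale_ide_comp:
  "\<lbrakk>A \<in> Obj C; B \<in> Obj C; f \<in> Hom C A B\<rbrakk> \<Longrightarrow> scale C c (ide C B) \<cdot> f = scale C c f"
  "\<lbrakk>A \<in> Obj C; B \<in> Obj C; f \<in> Hom C A B\<rbrakk> \<Longrightarrow> f \<cdot> scale C c (ide C A) = scale C c f"
  using comp_scale_left[of A B B f "ide C B" c] comp_scale_right[of A A B "ide C A" f c] ide_left ide_right ide_in
  by simp_all

lemma family_scalar: "family [] [] (\<lambda>D\<in>Obj C. scale C c (ide C D))"
  unfolding family_def
proof (intro conjI ballI)
  fix D E assume [simp]: "D \<in> Obj C" "E \<in> Obj C"
  show "(\<lambda>D\<in>Obj C. scale C c (ide C D)) (D \<otimes> E) \<cdot> shift [] D E =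
      shift [] D E \<cdot> ((\<lambda>D\<in>Obj C. scale C c (ide C D)) D \<odot> ide C E)"
    using tensor_scale_left[of D D E E "ide C D" "ide C E" c]
      scale_ide_comp[of "D \<otimes> E" "D \<otimes> E" "ide C (D \<otimes> E)" c]
    by (simp add: ide_in tensor_obj tensor_ide)
qed (auto simp: scale_in_hom ide_in scale_ide_comp)

lemma scalar_simps [simp]: "valid (scalar c)" "src (scalar c) = []" "tgt (scalar c) = []"
  "D \<in> Obj C \<Longrightarrow> component (scalar c) D = scale C c (ide C D)"
  by (simp_all add: scalar_def family_scalar)

lemma hom_scalar: "hom (scalar c) [] []"
  by (simp add: hom_def)

lemma act_arrow_scale: "\<lbrakk>set a \<subseteq> Obj C; D \<in> Obj C; E \<in> Obj C; f \<in> Hom C D E\<rbrakk>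
    \<Longrightarrow> act_arrow a (scale C c f) = scale C c (act_arrow a f)"
proof (induction a)
  case (Cons A a)
  then show ?case
    using tensor_scale_right[of A A "act a D" "act a E" "ide C A" "act_arrow a f" c] act_arrow_hom[of a D E f]
    by (simp add: act_obj ide_in)
qed simp

text \<open>
  Scalars pass through strands because the tensor product is linear in its second argument.
\<close>

lemma lwhisk_scalar [simp]: "l \<rhd> scalar c = scalar c \<lhd> l"
proof (cases "set l \<subseteq> Obj C")
  case True
  then show ?thesis
    by (intro diag_eqI) (auto simp: act_obj act_arrow_scale act_arrow_ide ide_in)
qed (simp add: invalid_lwhisk invalid_rwhisk)

lemma lwhisk_rwhisk_scalar [simp]: "l \<rhd> scalar c \<lhd> r = scalar c \<lhd> (l @ r)"
  by (metis lwhisk_rwhisk lwhisk_scalar rwhisk_rwhisk)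

lemma scalar_commute: "hom f a b \<Longrightarrow> (scalar c \<lhd> b) \<bullet> f = f \<bullet> (scalar c \<lhd> a)"
  using exchange[OF hom_scalar, of f a b c] by (simp add: hom_def)

lemma scalar_mult: "scalar c \<bullet> scalar d = scalar (c * d)"
  by (rule diag_eqI) (auto simp: scale_ide_comp scale_in_hom ide_in)

lemma scalar_mult_whisk: "(scalar c \<lhd> a) \<bullet> (scalar d \<lhd> a) = scalar (c * d) \<lhd> a"
  by (simp add: rwhisk_comp[symmetric] scalar_mult)

lemma scalar_one: "scalar 1 = idn []"
  by (rule diag_eqI) auto

lemma scalar_whisk_eq_hat: "Z \<in> Obj C \<Longrightarrow> scalar c \<lhd> [Z] = hat Z Z (scale C c (ide C Z))"
  by (rule diag_eqI) (auto simp: scale_in_hom ide_in tensor_obj tensor_ide tensor_scale_left[where B = Z and A = Z])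

lemma scalar_inject:
  assumes "simple_object C Z" "scalar c \<lhd> [Z] = scalar d \<lhd> [Z]"
  shows "c = d"
proof -
  note Z = simple_objectD[OF assms(1)]
  have "scale C c (ide C Z) = scale C d (ide C Z)"
    using assms(2) Z(1) by (intro hat_faithful[of Z Z]) (auto simp: scalar_whisk_eq_hat scale_in_hom ide_in)
  then show ?thesis using Z(2) by simp
qed

lemma not_scalar_zero:
  assumes Z: "simple_object C Z" and eq: "idn [Z] = (scalar 0 \<lhd> [Z]) \<bullet> x"
  shows False
proof -
  have [simp]: "Z \<in> Obj C" by (rule simple_objectD(1)[OF Z])
  have "scalar 0 \<lhd> [Z] = (scalar 0 \<lhd> [Z]) \<bullet> idn [Z]" by simp
  also have "\<dots> = ((scalar 0 \<lhd> [Z]) \<bullet> (scalar 0 \<lhd> [Z])) \<bullet> x"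
    unfolding eq by (rule comp_assoc_diag[symmetric])
  also have "\<dots> = scalar 1 \<lhd> [Z]"
    by (simp only: scalar_mult_whisk mult_zero_left eq[symmetric] scalar_one rwhisk_idn append_Nil)
  finally show False using scalar_inject[OF Z] by fastforce
qed

lemma schur_diag:
  assumes Z: "simple_object C Z" and F: "hom F [Z] [Z]"
  shows "\<exists>c. F = scalar c \<lhd> [Z]"
proof -
  obtain f where f: "f \<in> Hom C Z Z" "F = hat Z Z f"
    using hat_full[of F Z Z] F by (auto simp: hom_def)
  then show ?thesis
    using schur_scalar[OF Z f(1)] simple_objectD(1)[OF Z] by (auto simp: scalar_whisk_eq_hat)
qed

lemma schur_unit:
  assumes F: "hom F [] []"
  shows "\<exists>c. F = scalar c"
proof -
  note [simp] = hom_simps[OF F]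
  obtain c where c: "unt' \<bullet> F \<bullet> unt = scalar c \<lhd> [\<one>]"
    using schur_diag[OF unit_simple, of "unt' \<bullet> F \<bullet> unt"] by (auto simp: hom_def)
  have "F = unt \<bullet> (unt' \<bullet> F \<bullet> unt) \<bullet> unt'"
    by (simp add: comp_assoc_diag cancel_whisk)
  also have "\<dots> = (unt \<bullet> (scalar c \<lhd> [\<one>])) \<bullet> unt'"
    by (simp add: c comp_assoc_diag)
  also have "unt \<bullet> (scalar c \<lhd> [\<one>]) = scalar c \<bullet> unt"
    using scalar_commute[of unt "[\<one>]" "[]" c] by (simp add: hom_def)
  also have "(scalar c \<bullet> unt) \<bullet> unt' = scalar c"
    by (simp add: comp_assoc_diag)
  finally show ?thesis by blast
qed

section \<open>Dimensions\<close>

definition dimension :: "'o \<Rightarrow> ('o, 'm) diag" where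
  "dimension A = trace A [] [] (idn [A])"

lemma hom_dimension: "A \<in> Obj C \<Longrightarrow> hom (dimension A) [] []"
  unfolding dimension_def by (rule trace_hom) (simp add: hom_def)

text \<open>
  Close the inner loop first. It is a scalar, which can be moved out of the outer loop.
\<close>

lemma dimension_tensor:
  assumes [simp]: "A \<in> Obj C" "B \<in> Obj C"
  shows "dimension (A \<otimes> B) = dimension A \<bullet> dimension B"
proof -
  obtain c where c: "dimension B = scalar c" using schur_unit[OF hom_dimension[of B]] by auto
  have "dimension (A \<otimes> B) = trace (A \<otimes> B) [] [] (([] \<rhd> merge A B) \<bullet> idn [A, B] \<bullet> ([] \<rhd> split A B))"
    by (simp add: dimension_def)
  also have "\<dots> = trace A [] [] (trace B ([] @ [A]) ([] @ [A]) (idn [A, B]))"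
    by (rule trace_tensor[symmetric]) (auto simp: hom_def)
  also have "trace B ([] @ [A]) ([] @ [A]) (idn [A, B]) = [A] \<rhd> dimension B"
    using trace_whisk[of B "[A]" "[]" "[]" "idn [B]"] by (simp add: dimension_def)
  also have "\<dots> = idn [A] \<bullet> (dimension B \<lhd> [A])"
    by (simp add: c)
  also have "trace A [] [] \<dots> = dimension A \<bullet> dimension B"
    unfolding dimension_def[of A] by (rule trace_natural_right) (auto simp: hom_dimension)
  finally show ?thesis .
qed

lemma dimension_iso:
  assumes u: "hom u [A] [B]" and v: "hom v [B] [A]" and vu: "v \<bullet> u = idn [A]" and uv: "u \<bullet> v = idn [B]"
  shows "dimension A = dimension B"
  using trace_slide[OF u, of v "[]" "[]"] u v vu uv by (simp add: dimension_def hom_def)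

text \<open>
  It is an idempotent scalar as \<open>\<one> \<otimes> \<one> \<cong> \<one>\<close>. If it were zero, then all traces over \<open>\<one>\<close> would vanish, since every
  diagram \<open>B \<one> \<rightarrow> \<one>\<close> is a diagram \<open>B \<rightarrow> []\<close> next to an idle strand \<open>\<one>\<close>. But these traces detect diagrams.
\<close>

lemma dimension_unit: "dimension \<one> = idn []"
proof -
  note [simp] = structure_homs
  obtain c where c: "dimension \<one> = scalar c" using schur_unit[OF hom_dimension[of \<one>]] by auto
  have "dimension (\<one> \<otimes> \<one>) = dimension \<one>"
    by (rule dimension_iso[of "(unt \<lhd> [\<one>]) \<bullet> split \<one> \<one>" _ _ "merge \<one> \<one> \<bullet> (unt' \<lhd> [\<one>])"])
       (auto simp: hom_def comp_assoc_diag cancel_whisk)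
  then have "scalar (c * c) = scalar c"
    by (simp add: dimension_tensor c scalar_mult)
  then have "scalar (c * c) \<lhd> [\<one>] = scalar c \<lhd> [\<one>]" by simp
  from scalar_inject[OF unit_simple this] have "c * c = c" .
  moreover have "c \<noteq> 0"
  proof
    assume c0: "c = 0"
    have "idn [\<one>] = scalar 0 \<lhd> [\<one>]"
    proof (rule trace_detects[where l = "[]" and m = "[]"])
      fix B k assume k: "hom k (B @ [\<one>]) [\<one>]"
      note [simp] = hom_simps[OF k]
      have [simp]: "set B \<subseteq> Obj C" using hom_obj[OF k] by auto
      define k' where "k' = unt \<bullet> k \<bullet> (B \<rhd> unt')"
      have k': "hom k' B []" by (simp add: k'_def hom_def)
      note [simp] = hom_simps[OF k']
      have "unt' \<bullet> k' = (k' \<lhd> [\<one>]) \<bullet> (B \<rhd> unt')"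
        using exchange[OF k', of unt' "[]" "[\<one>]"] by (simp add: hom_def)
      then have "(unt' \<bullet> k') \<bullet> (B \<rhd> unt) = k' \<lhd> [\<one>]"
        by (simp add: comp_assoc_diag)
      then have kk': "k = k' \<lhd> [\<one>]"
        by (simp add: k'_def comp_assoc_diag cancel_whisk)
      have *: "trace \<one> B [] (f \<lhd> [\<one>]) = scalar 0 \<bullet> f" if f: "hom f B []" for f
      proof -
        note [simp] = hom_simps[OF f]
        have "trace \<one> B [] (f \<lhd> [\<one>]) = trace \<one> B [] (idn [\<one>] \<bullet> (f \<lhd> [\<one>]))" by simp
        also have "\<dots> = dimension \<one> \<bullet> f"
          unfolding dimension_def by (rule trace_natural_right) (use f in auto)
        finally show ?thesis by (simp add: c c0)
      qed
      have "trace \<one> B [] (k' \<lhd> [\<one>]) = trace \<one> B [] ((scalar 0 \<bullet> k') \<lhd> [\<one>])"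
        using *[OF k'] *[of "scalar 0 \<bullet> k'"] by (simp add: hom_def comp_assoc_diag[symmetric] scalar_mult)
      then show "trace \<one> ([] @ B) [] (idn [\<one>] \<bullet> ([] \<rhd> k)) = trace \<one> ([] @ B) [] ((scalar 0 \<lhd> [\<one>]) \<bullet> ([] \<rhd> k))"
        by (simp add: kk' rwhisk_comp)
    qed (auto simp: hom_def)
    then have "scalar 1 \<lhd> [\<one>] = scalar 0 \<lhd> [\<one>]" by (simp add: scalar_one)
    then show False using scalar_inject[OF unit_simple] by fastforce
  qed
  ultimately show ?thesis by (simp add: c scalar_one)
qed

lemma tensor_power_obj: "X \<in> Obj C \<Longrightarrow> tensor_power C X k \<in> Obj C"
  by (induction k) (auto intro: structure_homs)

lemma dimension_tensor_power:
  assumes "X \<in> Obj C" "dimension X = scalar c"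
  shows "dimension (tensor_power C X k) = scalar (c ^ k)"
  by (induction k) (auto simp: dimension_unit scalar_one dimension_tensor tensor_power_obj assms scalar_mult)

lemma tensor_power_join:
  assumes [simp]: "X \<in> Obj C"
  shows "\<exists>j j'. hom j (replicate k X) [tensor_power C X k] \<and> hom j' [tensor_power C X k] (replicate k X) \<and>
     j' \<bullet> j = idn (replicate k X) \<and> j \<bullet> j' = idn [tensor_power C X k]"
proof (induction k)
  case 0
  then show ?case by (intro exI[of _ unt'] exI[of _ unt]) (auto simp: hom_def structure_homs)
next
  case (Suc k)
  then obtain j j' where j: "hom j (replicate k X) [tensor_power C X k]" "hom j' [tensor_power C X k] (replicate k X)"
     "j' \<bullet> j = idn (replicate k X)" "j \<bullet> j' = idn [tensor_power C X k]" by blast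
  note [simp] = hom_simps[OF j(1)] hom_simps[OF j(2)]
    tensor_power_obj structure_homs
  have [simp]: "([X] \<rhd> j') \<bullet> ([X] \<rhd> j) = idn (X # replicate k X)" "([X] \<rhd> j) \<bullet> ([X] \<rhd> j') = idn [X, tensor_power C X k]"
    by (simp_all add: lwhisk_comp[symmetric] j)
  have "set (replicate k X) \<subseteq> Obj C" by auto
  note [simp] = this
  show ?case
    by (rule exI[of _ "merge X (tensor_power C X k) \<bullet> ([X] \<rhd> j)"], rule exI[of _ "([X] \<rhd> j') \<bullet> split X (tensor_power C X k)"])
       (auto simp: hom_def comp_assoc_diag cancel_whisk pre_inverse[of "[X] \<rhd> j" "[X] \<rhd> j'"])
qed

text \<open>
  The word of \<open>n\<close> letters \<open>X\<close> is isomorphic to the tensor power, and isomorphic objects have the same dimension.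
\<close>

lemma trivial_power:
  assumes X: "X \<in> Obj C" and iso: "isomorphic C (tensor_power C X n) \<one>"
  obtains \<phi> \<phi>' where "hom \<phi> (replicate n X) []" "hom \<phi>' [] (replicate n X)"
    "\<phi>' \<bullet> \<phi> = idn (replicate n X)" "\<phi> \<bullet> \<phi>' = idn []"
    "dimension (tensor_power C X n) = idn []"
proof -
  let ?P = "tensor_power C X n"
  have P[simp]: "?P \<in> Obj C" by (rule tensor_power_obj[OF X])
  note [simp] = structure_homs
  obtain f g where fg: "inverse_arrows C ?P \<one> f g" using iso by (auto simp: isomorphic_def iso_arrow_def)
  note fg' = inverse_arrowsD[OF fg]
  note [simp] = fg'(1,2)
  let ?f = "hat ?P \<one> f" and ?g = "hat \<one> ?P g"
  have gf: "?g \<bullet> ?f = idn [?P]" "?f \<bullet> ?g = idn [\<one>]"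
    using hat_comp[of ?P \<one> ?P f g] hat_comp[of \<one> ?P \<one> g f] fg'(3,4) by simp_all
  obtain j j' where j: "hom j (replicate n X) [?P]" "hom j' [?P] (replicate n X)"
     "j' \<bullet> j = idn (replicate n X)" "j \<bullet> j' = idn [?P]" using tensor_power_join[OF X] by blast
  note [simp] = hom_simps[OF j(1)] hom_simps[OF j(2)]
  show thesis
  proof (rule that)
    show "hom (unt \<bullet> ?f \<bullet> j) (replicate n X) []" "hom (j' \<bullet> ?g \<bullet> unt') [] (replicate n X)"
      by (simp_all add: hom_def)
    show "(j' \<bullet> ?g \<bullet> unt') \<bullet> (unt \<bullet> ?f \<bullet> j) = idn (replicate n X)"
      by (simp add: comp_assoc_diag cancel_whisk pre_inverse[OF gf(1)] j)
    show "(unt \<bullet> ?f \<bullet> j) \<bullet> (j' \<bullet> ?g \<bullet> unt') = idn []"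
      by (simp add: comp_assoc_diag cancel_whisk pre_inverse[OF gf(2)] pre_inverse[OF j(4)])
    show "dimension ?P = idn []"
      using dimension_iso[of ?f ?P \<one> ?g] gf dimension_unit by (simp add: hom_def)
  qed
qed

section \<open>The fixed point\<close>

text \<open>
  The scalar is the endomorphism \<open>f h'\<close>, by Schur's lemma. It is not zero because \<open>f\<close> has a right inverse.
\<close>

lemma proportional_to_iso:
  assumes Z: "simple_object C Z" and f: "hom f u [Z]" and g: "hom g [Z] u" and fg: "f \<bullet> g = idn [Z]"
    and h: "hom h u [Z]" and h': "hom h' [Z] u" and h'h: "h' \<bullet> h = idn u"
  obtains \<mu> where "\<mu> \<noteq> 0" "f = (scalar \<mu> \<lhd> [Z]) \<bullet> h"
proof -
  note [simp] = hom_simps[OF f] hom_simps[OF h] hom_simps[OF h']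
  obtain \<mu> where \<mu>: "f \<bullet> h' = scalar \<mu> \<lhd> [Z]"
    using schur_diag[OF Z, of "f \<bullet> h'"] by (auto simp: hom_def)
  have f_eq: "f = (scalar \<mu> \<lhd> [Z]) \<bullet> h"
    by (simp add: \<mu>[symmetric] comp_assoc_diag h'h)
  have "\<mu> \<noteq> 0"
  proof
    assume "\<mu> = 0"
    then have "idn [Z] = (scalar 0 \<lhd> [Z]) \<bullet> h \<bullet> g"
      using fg by (simp add: f_eq comp_assoc_diag)
    then show False by (rule not_scalar_zero[OF Z])
  qed
  then show thesis using f_eq by (rule that)
qed

lemma cancel_scaled_iso:
  assumes "\<mu> \<noteq> 0" "Z \<in> Obj C" and f: "hom f w [Z]" and gf: "g \<bullet> f = idn w"
    and x: "hom x v w" and y: "hom y v w" and eq: "(scalar \<mu> \<lhd> [Z]) \<bullet> f \<bullet> x = (scalar \<mu> \<lhd> [Z]) \<bullet> f \<bullet> y"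
  shows "x = y"
proof -
  have s: "(scalar (1 / \<mu>) \<lhd> [Z]) \<bullet> (scalar \<mu> \<lhd> [Z]) = idn [Z]"
    using assms(1) by (simp add: scalar_mult_whisk scalar_one)
  have cancel: "g \<bullet> (scalar (1 / \<mu>) \<lhd> [Z]) \<bullet> (scalar \<mu> \<lhd> [Z]) \<bullet> f \<bullet> z = z" if "hom z v w" for z
    using hom_simps[OF that] hom_simps[OF f] by (simp add: pre_inverse[OF s] pre_inverse[OF gf])
  show ?thesis using cancel[OF x] cancel[OF y] eq by metis
qed

text \<open>
  Iterating \<open>\<zeta>\<close> gives isomorphisms \<open>a k : X\<^sup>k Z \<rightarrow> Z\<close>, and \<open>a n\<close> is a multiple of \<open>\<phi> \<lhd> Z\<close>. As \<open>a (n + 1)\<close> can be formed by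
  applying the extra \<open>\<zeta>\<close> last or first, it is the same multiple of \<open>\<zeta> (X \<rhd> \<phi> \<lhd> Z)\<close> and of \<open>\<zeta> (\<phi> \<lhd> X Z)\<close>.
\<close>

lemma fixed_left:
  assumes X: "X \<in> Obj C" and Z: "simple_object C Z" and \<zeta>: "hom \<zeta> [X, Z] [Z]" and \<zeta>': "hom \<zeta>' [Z] [X, Z]"
    and inv: "\<zeta>' \<bullet> \<zeta> = idn [X, Z]" "\<zeta> \<bullet> \<zeta>' = idn [Z]"
    and \<phi>: "hom \<phi> (replicate n X) []" and \<phi>': "hom \<phi>' [] (replicate n X)"
    and inv': "\<phi>' \<bullet> \<phi> = idn (replicate n X)"
  shows "[X] \<rhd> \<phi> \<lhd> [Z] = \<phi> \<lhd> [X, Z]"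
proof -
  let ?X = "\<lambda>k. replicate k X"
  have [simp]: "Z \<in> Obj C" by (rule simple_objectD(1)[OF Z])
  have [simp]: "set (?X k) \<subseteq> Obj C" for k using X by auto
  note [simp] = X hom_simps[OF \<zeta>] hom_simps[OF \<zeta>']
    hom_simps[OF \<phi>] hom_simps[OF \<phi>']
  define a where "a = rec_nat (idn [Z]) (\<lambda>k f. \<zeta> \<bullet> ([X] \<rhd> f))"
  \<comment> \<open>\<open>b k\<close> is a right inverse of \<open>a k\<close>.\<close>
  define b where "b = rec_nat (idn [Z]) (\<lambda>k f. ([X] \<rhd> f) \<bullet> \<zeta>')"
  have a_rec: "a 0 = idn [Z]" "a (Suc k) = \<zeta> \<bullet> ([X] \<rhd> a k)" and b_rec: "b 0 = idn [Z]" "b (Suc k) = ([X] \<rhd> b k) \<bullet> \<zeta>'" for k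
    by (simp_all add: a_def b_def)
  have a: "hom (a k) (?X k @ [Z]) [Z]" and b: "hom (b k) [Z] (?X k @ [Z])" for k
    by (induction k) (auto simp: hom_def a_rec b_rec)
  note [simp] = hom_simps[OF a] hom_simps[OF b]
  have ab: "a k \<bullet> b k = idn [Z]" for k
  proof (induction k)
    case (Suc k)
    have "a (Suc k) \<bullet> b (Suc k) = \<zeta> \<bullet> ([X] \<rhd> (a k \<bullet> b k)) \<bullet> \<zeta>'"
      by (simp add: a_rec b_rec whisk_simps)
    then show ?case by (simp add: Suc inv)
  qed (simp add: a_rec b_rec)
  have a_last: "a (Suc k) = a k \<bullet> (?X k \<rhd> \<zeta>)" for k
  proof (induction k)
    case (Suc k)
    have "a (Suc (Suc k)) = \<zeta> \<bullet> ([X] \<rhd> (a k \<bullet> (?X k \<rhd> \<zeta>)))"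
      by (simp only: a_rec(2)[of "Suc k"] Suc)
    then show ?case by (simp add: a_rec(2)[of k] whisk_simps)
  qed (simp add: a_rec)
  have inv_\<phi>: "(\<phi>' \<lhd> [Z]) \<bullet> (\<phi> \<lhd> [Z]) = idn (?X n @ [Z])"
    by (simp add: rwhisk_comp[symmetric] inv')
  obtain \<mu> where \<mu>0: "\<mu> \<noteq> 0" and an: "a n = (scalar \<mu> \<lhd> [Z]) \<bullet> (\<phi> \<lhd> [Z])"
    by (rule proportional_to_iso[OF Z a b ab _ _ inv_\<phi>]) (auto simp: hom_def)
  have "\<zeta> \<bullet> ([X] \<rhd> a n) = a n \<bullet> (?X n \<rhd> \<zeta>)"
    using a_last[of n] a_rec(2)[of n] by simp
  then have "(\<zeta> \<bullet> (scalar \<mu> \<lhd> [X, Z])) \<bullet> ([X] \<rhd> \<phi> \<lhd> [Z]) = (scalar \<mu> \<lhd> [Z]) \<bullet> ((\<phi> \<lhd> [Z]) \<bullet> (?X n \<rhd> \<zeta>))"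
    by (simp add: an whisk_simps)
  also have "\<zeta> \<bullet> (scalar \<mu> \<lhd> [X, Z]) = (scalar \<mu> \<lhd> [Z]) \<bullet> \<zeta>"
    by (rule scalar_commute[OF \<zeta>, symmetric])
  also have "(\<phi> \<lhd> [Z]) \<bullet> (?X n \<rhd> \<zeta>) = \<zeta> \<bullet> (\<phi> \<lhd> [X, Z])"
    using exchange[OF \<phi> \<zeta>] by simp
  finally have eq: "(scalar \<mu> \<lhd> [Z]) \<bullet> \<zeta> \<bullet> ([X] \<rhd> \<phi> \<lhd> [Z]) = (scalar \<mu> \<lhd> [Z]) \<bullet> \<zeta> \<bullet> (\<phi> \<lhd> [X, Z])"
    by (simp add: comp_assoc_diag)
  show ?thesis
    by (rule cancel_scaled_iso[OF \<mu>0 _ \<zeta> inv(1) _ _ eq]) (auto simp: hom_def replicate_append_same)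
qed

text \<open>
  The mirror image of \<open>fixed_left\<close>: the powers of \<open>X\<close> act from the right.
\<close>

lemma fixed_right:
  assumes X: "X \<in> Obj C" and Z: "simple_object C Z" and \<zeta>: "hom \<zeta> [Z, X] [Z]" and \<zeta>': "hom \<zeta>' [Z] [Z, X]"
    and inv: "\<zeta>' \<bullet> \<zeta> = idn [Z, X]" "\<zeta> \<bullet> \<zeta>' = idn [Z]"
    and \<phi>: "hom \<phi> (replicate n X) []" and \<phi>': "hom \<phi>' [] (replicate n X)"
    and inv': "\<phi>' \<bullet> \<phi> = idn (replicate n X)"
  shows "[Z, X] \<rhd> \<phi> = [Z] \<rhd> \<phi> \<lhd> [X]"
proof -
  let ?X = "\<lambda>k. replicate k X"
  have [simp]: "Z \<in> Obj C" by (rule simple_objectD(1)[OF Z])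
  have [simp]: "set (?X k) \<subseteq> Obj C" for k using X by auto
  note [simp] = X hom_simps[OF \<zeta>] hom_simps[OF \<zeta>']
    hom_simps[OF \<phi>] hom_simps[OF \<phi>']
  note [simp] = replicate_append_same
  define a where "a = rec_nat (idn [Z]) (\<lambda>k f. \<zeta> \<bullet> (f \<lhd> [X]))"
  \<comment> \<open>\<open>b k\<close> is a right inverse of \<open>a k\<close>.\<close>
  define b where "b = rec_nat (idn [Z]) (\<lambda>k f. (f \<lhd> [X]) \<bullet> \<zeta>')"
  have a_rec: "a 0 = idn [Z]" "a (Suc k) = \<zeta> \<bullet> (a k \<lhd> [X])" and b_rec: "b 0 = idn [Z]" "b (Suc k) = (b k \<lhd> [X]) \<bullet> \<zeta>'" for k
    by (simp_all add: a_def b_def)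
  have a: "hom (a k) (Z # ?X k) [Z]" and b: "hom (b k) [Z] (Z # ?X k)" for k
    by (induction k) (auto simp: hom_def a_rec b_rec)
  note [simp] = hom_simps[OF a] hom_simps[OF b]
  have ab: "a k \<bullet> b k = idn [Z]" for k
  proof (induction k)
    case (Suc k)
    have "a (Suc k) \<bullet> b (Suc k) = \<zeta> \<bullet> ((a k \<bullet> b k) \<lhd> [X]) \<bullet> \<zeta>'"
      by (simp add: a_rec b_rec whisk_simps)
    then show ?case by (simp add: Suc inv)
  qed (simp add: a_rec b_rec)
  have a_last: "a (Suc k) = a k \<bullet> (\<zeta> \<lhd> ?X k)" for k
  proof (induction k)
    case (Suc k)
    have "a (Suc (Suc k)) = \<zeta> \<bullet> ((a k \<bullet> (\<zeta> \<lhd> ?X k)) \<lhd> [X])"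
      by (simp only: a_rec(2)[of "Suc k"] Suc)
    then show ?case by (simp add: a_rec(2)[of k] whisk_simps)
  qed (simp add: a_rec)
  have inv_\<phi>: "([Z] \<rhd> \<phi>') \<bullet> ([Z] \<rhd> \<phi>) = idn (Z # ?X n)"
    by (simp add: lwhisk_comp[symmetric] inv')
  obtain \<mu> where \<mu>0: "\<mu> \<noteq> 0" and an: "a n = (scalar \<mu> \<lhd> [Z]) \<bullet> ([Z] \<rhd> \<phi>)"
    by (rule proportional_to_iso[OF Z a b ab _ _ inv_\<phi>]) (auto simp: hom_def)
  have "\<zeta> \<bullet> (a n \<lhd> [X]) = a n \<bullet> (\<zeta> \<lhd> ?X n)"
    using a_last[of n] a_rec(2)[of n] by simp
  then have "(\<zeta> \<bullet> (scalar \<mu> \<lhd> [Z, X])) \<bullet> ([Z] \<rhd> \<phi> \<lhd> [X]) = (scalar \<mu> \<lhd> [Z]) \<bullet> (([Z] \<rhd> \<phi>) \<bullet> (\<zeta> \<lhd> ?X n))"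
    by (simp add: an whisk_simps)
  also have "\<zeta> \<bullet> (scalar \<mu> \<lhd> [Z, X]) = (scalar \<mu> \<lhd> [Z]) \<bullet> \<zeta>"
    by (rule scalar_commute[OF \<zeta>, symmetric])
  also have "([Z] \<rhd> \<phi>) \<bullet> (\<zeta> \<lhd> ?X n) = \<zeta> \<bullet> ([Z, X] \<rhd> \<phi>)"
    using exchange[OF \<zeta> \<phi>] by simp
  finally have eq: "(scalar \<mu> \<lhd> [Z]) \<bullet> \<zeta> \<bullet> ([Z] \<rhd> \<phi> \<lhd> [X]) = (scalar \<mu> \<lhd> [Z]) \<bullet> \<zeta> \<bullet> ([Z, X] \<rhd> \<phi>)"
    by (simp add: comp_assoc_diag)
  show ?thesis
    by (rule cancel_scaled_iso[OF \<mu>0 _ \<zeta> inv(1) _ _ eq[symmetric]]) (auto simp: hom_def)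
qed

lemma diag_of_iso:
  assumes "A \<in> Obj C" "B \<in> Obj C" "D \<in> Obj C" "isomorphic C (A \<otimes> B) D"
  obtains f g where "hom f [A, B] [D]" "hom g [D] [A, B]" "g \<bullet> f = idn [A, B]" "f \<bullet> g = idn [D]"
proof -
  note [simp] = assms(1-3) structure_homs
  obtain f g where fg: "inverse_arrows C (A \<otimes> B) D f g" using assms(4) by (auto simp: isomorphic_def iso_arrow_def)
  note fg' = inverse_arrowsD[OF fg]
  note [simp] = fg'(1,2)
  let ?f = "hat (A \<otimes> B) D f" and ?g = "hat D (A \<otimes> B) g"
  have gf: "?g \<bullet> ?f = idn [A \<otimes> B]" "?f \<bullet> ?g = idn [D]"
    using hat_comp[of "A \<otimes> B" D "A \<otimes> B" f g] hat_comp[of D "A \<otimes> B" D g f] fg'(3,4) by simp_all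
  show thesis
    by (rule that[of "?f \<bullet> merge A B" "split A B \<bullet> ?g"])
       (auto simp: hom_def comp_assoc_diag cancel_whisk pre_inverse[OF gf(1)] gf)
qed

text \<open>
  The automorphism \<open>(\<phi> \<lhd> X) (X \<rhd> \<phi>)\<^sup>-\<^sup>1\<close> of the simple object \<open>X\<close> is a scalar, and it becomes the identity when the
  strand \<open>Z\<close> is placed next to it.
\<close>

lemma fixed_point_commutes:
  assumes X: "simple_object C X" and Z: "simple_object C Z"
    and fixed: "isomorphic C (X \<otimes> Z) Z \<or> isomorphic C (Z \<otimes> X) Z"
    and \<phi>: "hom \<phi> (replicate n X) []" and \<phi>': "hom \<phi>' [] (replicate n X)"
    and inv: "\<phi>' \<bullet> \<phi> = idn (replicate n X)" "\<phi> \<bullet> \<phi>' = idn []"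
  shows "[X] \<rhd> \<phi> = \<phi> \<lhd> [X]"
proof -
  note [simp] = simple_objectD(1)[OF X] simple_objectD(1)[OF Z] replicate_append_same
    hom_simps[OF \<phi>] hom_simps[OF \<phi>']
  have [simp]: "set (replicate n X) \<subseteq> Obj C" by auto
  let ?q = "(\<phi> \<lhd> [X]) \<bullet> ([X] \<rhd> \<phi>')"
  have "hom ?q [X] [X]" by (simp add: hom_def)
  then obtain c where c: "?q = scalar c \<lhd> [X]" using schur_diag[OF X] by blast
  \<comment> \<open>The scalar acts as the identity on \<open>X Z\<close> or \<open>Z X\<close>, hence on the isomorphic object \<open>Z\<close>.\<close>
  have "c = 1"
    using fixed
  proof
    assume "isomorphic C (X \<otimes> Z) Z"
    then obtain f g where f: "hom f [X, Z] [Z]" and g: "hom g [Z] [X, Z]" and gf: "g \<bullet> f = idn [X, Z]" "f \<bullet> g = idn [Z]"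
      by (rule diag_of_iso[rotated 3]) auto
    note [simp] = hom_simps[OF f] hom_simps[OF g]
    have "?q \<lhd> [Z] = (\<phi> \<lhd> [X, Z]) \<bullet> ([X] \<rhd> \<phi>' \<lhd> [Z])" by (simp add: whisk_simps)
    also have "\<dots> = ([X] \<rhd> \<phi> \<lhd> [Z]) \<bullet> ([X] \<rhd> \<phi>' \<lhd> [Z])"
      using fixed_left[OF _ Z f g gf \<phi> \<phi>' inv(1)] by simp
    also have "\<dots> = idn [X, Z]" using whisk[OF inv(2), of "[X]" "[Z]"] by simp
    finally have "scalar c \<lhd> [X, Z] = idn [X, Z]" by (simp add: c rwhisk_rwhisk)
    then have "(scalar c \<lhd> [Z]) \<bullet> f = f"
      using scalar_commute[OF f, of c] by simp
    then have "(scalar c \<lhd> [Z]) \<bullet> f \<bullet> g = f \<bullet> g" by (simp add: comp_assoc_diag[symmetric])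
    then have "scalar c \<lhd> [Z] = scalar 1 \<lhd> [Z]" by (simp add: gf scalar_one)
    then show ?thesis by (rule scalar_inject[OF Z])
  next
    assume "isomorphic C (Z \<otimes> X) Z"
    then obtain f g where f: "hom f [Z, X] [Z]" and g: "hom g [Z] [Z, X]" and gf: "g \<bullet> f = idn [Z, X]" "f \<bullet> g = idn [Z]"
      by (rule diag_of_iso[rotated 3]) auto
    note [simp] = hom_simps[OF f] hom_simps[OF g]
    have "[Z] \<rhd> ?q = ([Z] \<rhd> \<phi> \<lhd> [X]) \<bullet> ([Z, X] \<rhd> \<phi>')" by (simp add: whisk_simps)
    also have "\<dots> = ([Z, X] \<rhd> \<phi>) \<bullet> ([Z, X] \<rhd> \<phi>')"
      using fixed_right[OF _ Z f g gf \<phi> \<phi>' inv(1)] by simp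
    also have "\<dots> = idn [Z, X]" by (simp add: lwhisk_comp[symmetric] inv)
    finally have "scalar c \<lhd> [Z, X] = idn [Z, X]" by (simp add: c)
    then have "(scalar c \<lhd> [Z]) \<bullet> f = f"
      using scalar_commute[OF f, of c] by simp
    then have "(scalar c \<lhd> [Z]) \<bullet> f \<bullet> g = f \<bullet> g" by (simp add: comp_assoc_diag[symmetric])
    then have "scalar c \<lhd> [Z] = scalar 1 \<lhd> [Z]" by (simp add: gf scalar_one)
    then show ?thesis by (rule scalar_inject[OF Z])
  qed
  then have q: "?q = idn [X]" using c by (simp add: scalar_one)
  have "[X] \<rhd> \<phi> = ?q \<bullet> ([X] \<rhd> \<phi>)" by (subst q) simp
  also have "\<dots> = (\<phi> \<lhd> [X]) \<bullet> ([X] \<rhd> (\<phi>' \<bullet> \<phi>))" by (simp add: whisk_simps)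
  finally show ?thesis by (simp add: inv)
qed

section \<open>The twist against arrows to an invertible object\<close>

text \<open>
  Cancel the strand \<open>X\<close> against \<open>n - 1\<close> further copies by \<open>\<phi>\<close>. To get \<open>q\<close> back, the strand \<open>X\<close> that is
  added to the right has to change places with \<open>X\<^sup>n\<close>, which is what \<open>comm\<close> allows.
\<close>

lemma strand_removable:
  assumes X: "X \<in> Obj C" and n: "n \<ge> 1"
    and \<phi>: "hom \<phi> (replicate n X) []" and \<phi>': "hom \<phi>' [] (replicate n X)"
    and inv: "\<phi>' \<bullet> \<phi> = idn (replicate n X)" "\<phi> \<bullet> \<phi>' = idn []"
    and comm: "[X] \<rhd> \<phi> = \<phi> \<lhd> [X]"
    and q: "hom q (a @ [X]) (b @ [X])"
  shows "\<exists>s. hom s a b \<and> s \<lhd> [X] = q"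
proof -
  obtain k where k: "n = Suc k" using n by (cases n) auto
  let ?k = "replicate k X"
  note [simp] = X hom_simps[OF q] replicate_append_same
    hom_simps[OF \<phi>] hom_simps[OF \<phi>']
  have [simp]: "set a \<subseteq> Obj C" "set b \<subseteq> Obj C" "set ?k \<subseteq> Obj C" using hom_obj[OF q] by auto
  have comm': "[X] \<rhd> \<phi>' = \<phi>' \<lhd> [X]"
  proof -
    have "[X] \<rhd> \<phi>' = ((\<phi>' \<bullet> \<phi>) \<lhd> [X]) \<bullet> ([X] \<rhd> \<phi>')" by (simp add: inv)
    also have "\<dots> = (\<phi>' \<lhd> [X]) \<bullet> ([X] \<rhd> (\<phi> \<bullet> \<phi>'))" by (simp add: rwhisk_comp comm[symmetric] lwhisk_comp comp_assoc_diag)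
    finally show ?thesis by (simp add: inv)
  qed
  let ?s = "(b \<rhd> \<phi>) \<bullet> (q \<lhd> ?k) \<bullet> (a \<rhd> \<phi>')"
  have "?s \<lhd> [X] = (b \<rhd> (\<phi> \<lhd> [X])) \<bullet> (q \<lhd> replicate n X) \<bullet> (a \<rhd> (\<phi>' \<lhd> [X]))"
    by (simp add: rwhisk_comp lwhisk_rwhisk rwhisk_rwhisk k)
  also have "\<dots> = ((b @ [X]) \<rhd> \<phi>) \<bullet> ((q \<lhd> replicate n X) \<bullet> ((a @ [X]) \<rhd> \<phi>'))"
    by (simp add: comm[symmetric] comm'[symmetric] lwhisk_lwhisk)
  also have "(q \<lhd> replicate n X) \<bullet> ((a @ [X]) \<rhd> \<phi>') = ((b @ [X]) \<rhd> \<phi>') \<bullet> q"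
    using exchange[OF q \<phi>'] by simp
  also have "((b @ [X]) \<rhd> \<phi>) \<bullet> \<dots> = ((b @ [X]) \<rhd> (\<phi> \<bullet> \<phi>')) \<bullet> q"
    by (simp add: lwhisk_comp comp_assoc_diag)
  also have "\<dots> = q" by (simp add: inv)
  finally show ?thesis
    by (intro exI[of _ ?s]) (simp add: hom_def k)
qed

text \<open>
  The self-crossing of \<open>W\<close> is closed over \<open>W\<close>. The arrow \<open>p\<close> at the output can be moved through the crossing onto
  the loop and slid around it, which turns the loop into a loop over \<open>X\<close>.
\<close>

lemma twist_as_trace:
  assumes hb: "half_braiding C W \<gamma>" and p: "hom p [W] [X]"
  shows "p \<bullet> twist_diag W \<gamma> = trace X [W] [X] (([X] \<rhd> p) \<bullet> hb W \<gamma> X)"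
proof -
  have [simp]: "X \<in> Obj C" using hom_obj[OF p] by simp
  note [simp] = half_braidingD(1)[OF hb] hb_simps[OF hb]
  have "p \<bullet> twist_diag W \<gamma> = trace W [W] [X] ((p \<lhd> [W]) \<bullet> hb W \<gamma> W)"
    unfolding twist_diag_def by (rule trace_natural_left[symmetric]) (use p in auto)
  also have "(p \<lhd> [W]) \<bullet> hb W \<gamma> W = hb W \<gamma> X \<bullet> ([W] \<rhd> p)"
    using hbs_natural[OF hb p] hbs_single[OF hb, of W] hbs_single[OF hb, of X] by (simp del: hbs.simps)
  also have "trace W [W] [X] \<dots> = trace X [W] [X] (([X] \<rhd> p) \<bullet> hb W \<gamma> X)"
    by (rule trace_slide[OF p]) (simp add: hom_def)
  finally show ?thesis .
qed

text \<open>
  Removing the strand \<open>X\<close> from \<open>(X \<rhd> x) \<gamma>\<^sub>X\<close> gives an operator \<open>S\<close> on the arrows \<open>W \<rightarrow> X\<close>, and the trace over \<open>X\<close> shows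
  that \<open>S x = x \<theta> / d\<close>. Its powers are read off from the crossing with a power of \<open>X\<close>, and the crossing with
  \<open>X\<^sup>n\<close> is trivialised by \<open>\<phi>\<close>.
\<close>

lemma twist_power_projection:
  assumes X: "simple_object C X" and n: "n \<ge> 1"
    and iso: "isomorphic C (tensor_power C X n) \<one>"
    and Z: "simple_object C Z" "isomorphic C (X \<otimes> Z) Z \<or> isomorphic C (Z \<otimes> X) Z"
    and hb: "half_braiding C W \<gamma>" and p: "hom p [W] [X]"
  shows "((\<lambda>x. x \<bullet> twist_diag W \<gamma>) ^^ n) p = p"
proof -
  note X' = simple_objectD[OF X]
  obtain \<phi> \<phi>' where \<phi>: "hom \<phi> (replicate n X) []" and \<phi>': "hom \<phi>' [] (replicate n X)"
    and inv: "\<phi>' \<bullet> \<phi> = idn (replicate n X)" "\<phi> \<bullet> \<phi>' = idn []"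
    and dim: "dimension (tensor_power C X n) = idn []"
    by (rule trivial_power[OF X'(1) iso])
  note comm = fixed_point_commutes[OF X Z \<phi> \<phi>' inv]
  let ?t = "twist_diag W \<gamma>"
  note t = hom_twist_diag[OF hb]
  note [simp] = X'(1) half_braidingD(1)[OF hb] hb_simps[OF hb] hom_simps[OF t]
    hom_simps[OF \<phi>] hom_simps[OF \<phi>']
    hom_simps[OF hom_hbs[OF hb]]
  have [simp]: "set (replicate k X) \<subseteq> Obj C" for k by auto
  obtain c where c: "dimension X = scalar c" using schur_unit[OF hom_dimension[OF X'(1)]] by auto
  have "scalar (c ^ n) = scalar 1"
    using dimension_tensor_power[OF X'(1) c, of n] dim by (simp add: scalar_one)
  then have "scalar (c ^ n) \<lhd> [X] = scalar 1 \<lhd> [X]" by simp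
  then have cn: "c ^ n = 1" by (rule scalar_inject[OF X])
  then have c0: "c \<noteq> 0" using n by (auto simp: power_0_left)
  define S where "S = (\<lambda>x. (scalar (1 / c) \<lhd> [X]) \<bullet> x \<bullet> ?t)"
  have S_hom: "hom (S x) [W] [X]" if x: "hom x [W] [X]" for x
    using x by (simp add: S_def hom_def)
  have step: "([X] \<rhd> x) \<bullet> hb W \<gamma> X = S x \<lhd> [X]" if x: "hom x [W] [X]" for x
  proof -
    note [simp] = hom_simps[OF x]
    have "hom (([X] \<rhd> x) \<bullet> hb W \<gamma> X) ([W] @ [X]) ([X] @ [X])" by (simp add: hom_def)
    from strand_removable[OF X'(1) n \<phi> \<phi>' inv comm this]
    obtain s where s: "hom s [W] [X]" and sX: "s \<lhd> [X] = ([X] \<rhd> x) \<bullet> hb W \<gamma> X" by blast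
    note [simp] = hom_simps[OF s]
    have "x \<bullet> ?t = trace X [W] [X] (idn ([X] @ [X]) \<bullet> (s \<lhd> [X]))"
      using twist_as_trace[OF hb x] by (simp add: sX)
    also have "\<dots> = trace X [X] [X] (idn ([X] @ [X])) \<bullet> s"
      by (rule trace_natural_right[OF X'(1) s])
    also have "trace X [X] [X] (idn ([X] @ [X])) = scalar c \<lhd> [X]"
      using trace_whisk[of X "[X]" "[]" "[]" "idn [X]"] c by (simp add: dimension_def)
    finally have "(scalar (1 / c) \<lhd> [X]) \<bullet> x \<bullet> ?t = ((scalar (1 / c) \<lhd> [X]) \<bullet> (scalar c \<lhd> [X])) \<bullet> s"
      by (simp add: comp_assoc_diag)
    then have "S x = s" using c0 by (simp add: S_def scalar_mult_whisk scalar_one)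
    then show ?thesis using sX by simp
  qed
  \<comment> \<open>The crossing with \<open>X\<^sup>k\<^sup>+\<^sup>1\<close> is split off at the last strand, so that \<open>S\<close> is applied to \<open>x\<close> first.\<close>
  have iterate: "(replicate k X \<rhd> x) \<bullet> hbs W \<gamma> (replicate k X) = (S ^^ k) x \<lhd> replicate k X"
    if "hom x [W] [X]" for x k
    using that
  proof (induction k arbitrary: x)
    case 0
    then show ?case by (simp add: hom_def)
  next
    case (Suc k)
    note x = Suc.prems
    let ?k = "replicate k X"
    have r: "replicate (Suc k) X = ?k @ [X]" by (simp add: replicate_append_same)
    have hX: "hbs W \<gamma> [X] = hb W \<gamma> X" by (rule hbs_single[OF hb X'(1)])
    have "(replicate (Suc k) X \<rhd> x) \<bullet> hbs W \<gamma> (replicate (Suc k) X)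
        = (?k \<rhd> (([X] \<rhd> x) \<bullet> hb W \<gamma> X)) \<bullet> (hbs W \<gamma> ?k \<lhd> [X])"
      unfolding r by (subst hbs_append[OF hb]) (auto simp: hX whisk_simps)
    also have "\<dots> = ((?k \<rhd> S x) \<bullet> hbs W \<gamma> ?k) \<lhd> [X]"
      by (simp add: step[OF x] whisk_simps)
    also have "\<dots> = (S ^^ k) (S x) \<lhd> replicate (Suc k) X"
      by (simp only: Suc.IH[OF S_hom[OF x]] rwhisk_rwhisk r)
    finally show ?case by (simp add: funpow_swap1)
  qed
  have S_pow: "(S ^^ k) p = (scalar ((1 / c) ^ k) \<lhd> [X]) \<bullet> (((\<lambda>x. x \<bullet> ?t) ^^ k) p)" and
    R_hom: "hom (((\<lambda>x. x \<bullet> ?t) ^^ k) p) [W] [X]" for k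
  proof (induction k)
    case 0
    show "(S ^^ 0) p = (scalar ((1 / c) ^ 0) \<lhd> [X]) \<bullet> (((\<lambda>x. x \<bullet> ?t) ^^ 0) p)"
      using p by (simp add: scalar_one hom_def)
    show "hom (((\<lambda>x. x \<bullet> ?t) ^^ 0) p) [W] [X]" using p by simp
  next
    case (Suc k)
    show "(S ^^ Suc k) p = (scalar ((1 / c) ^ Suc k) \<lhd> [X]) \<bullet> (((\<lambda>x. x \<bullet> ?t) ^^ Suc k) p)"
    proof -
      let ?R = "((\<lambda>x. x \<bullet> ?t) ^^ k) p"
      have "(S ^^ Suc k) p = S ((scalar ((1 / c) ^ k) \<lhd> [X]) \<bullet> ?R)" by (simp add: Suc(1))
      also have "\<dots> = (scalar (1 / c) \<lhd> [X]) \<bullet> (scalar ((1 / c) ^ k) \<lhd> [X]) \<bullet> ?R \<bullet> ?t"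
        by (simp add: S_def comp_assoc_diag)
      also have "\<dots> = (scalar ((1 / c) ^ Suc k) \<lhd> [X]) \<bullet> ?R \<bullet> ?t"
        by (simp only: pre[OF scalar_mult_whisk] power_Suc)
      finally show ?thesis by simp
    qed
    show "hom (((\<lambda>x. x \<bullet> ?t) ^^ Suc k) p) [W] [X]" using Suc(2) by (simp add: hom_def)
  qed
  let ?n = "replicate n X" and ?P = "(S ^^ n) p"
  have "(1 / c) ^ n = 1" using cn by (simp add: power_divide)
  then have P: "?P = ((\<lambda>x. x \<bullet> ?t) ^^ n) p"
    using R_hom[of n] by (simp add: S_pow scalar_one hom_def)
  then have P_hom: "hom ?P [W] [X]" using R_hom[of n] by simp
  have wphi: "([W] \<rhd> \<phi>) \<bullet> ([W] \<rhd> \<phi>') = idn [W]" by (simp add: lwhisk_comp[symmetric] inv)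
  \<comment> \<open>\<open>p \<otimes> \<phi>\<close> computed in two ways.\<close>
  have "p \<bullet> ([W] \<rhd> \<phi>) = p \<bullet> ((\<phi> \<lhd> [W]) \<bullet> hbs W \<gamma> ?n)"
    using hbs_natural[OF hb \<phi>] by simp
  also have "\<dots> = (p \<bullet> (\<phi> \<lhd> [W])) \<bullet> hbs W \<gamma> ?n" by (rule comp_assoc_diag[symmetric])
  also have "p \<bullet> (\<phi> \<lhd> [W]) = (\<phi> \<lhd> [X]) \<bullet> (?n \<rhd> p)"
    using exchange[OF \<phi> p] p by (simp add: hom_def)
  also have "((\<phi> \<lhd> [X]) \<bullet> (?n \<rhd> p)) \<bullet> hbs W \<gamma> ?n = (\<phi> \<lhd> [X]) \<bullet> (?P \<lhd> ?n)"
    by (simp only: comp_assoc_diag iterate[OF p])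
  also have "\<dots> = ([X] \<rhd> \<phi>) \<bullet> (?P \<lhd> ?n)" by (simp only: comm)
  also have "\<dots> = ?P \<bullet> ([W] \<rhd> \<phi>)"
    using exchange[OF P_hom \<phi>] P_hom by (simp add: hom_def)
  finally have "p \<bullet> (([W] \<rhd> \<phi>) \<bullet> ([W] \<rhd> \<phi>')) = ?P \<bullet> (([W] \<rhd> \<phi>) \<bullet> ([W] \<rhd> \<phi>'))"
    by (simp only: comp_assoc_diag[symmetric])
  then have "p = ?P" using p P_hom by (simp only: wphi) (simp add: hom_def)
  then show ?thesis using P by simp
qed

text \<open>
  By \<open>twist_power_projection\<close>, \<open>f\<close> and \<open>\<theta>\<^sup>n f\<close> have the same composites with all arrows \<open>W \<rightarrow> X\<close>.
\<close>

lemma twist_power_fixes: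
  assumes X: "simple_object C X" and n: "n \<ge> 1"
    and iso: "isomorphic C (tensor_power C X n) \<one>"
    and Z: "simple_object C Z" "isomorphic C (X \<otimes> Z) Z \<or> isomorphic C (Z \<otimes> X) Z"
    and hb: "half_braiding C W \<gamma>" and f: "f \<in> Hom C X W"
  defines "t \<equiv> twist_arrow (drinfeld_center C) (W, \<gamma>)"
  shows "power_arrow W t n \<cdot> f = f"
proof -
  note r = repr_twist_arrow[OF hb, folded t_def]
  note W = half_braidingD(1)[OF hb] and t = reprD(3)[OF r] and X' = simple_objectD(1)[OF X]
  note tn = power_arrow_hom[OF W t]
  have fix_p: "p \<cdot> power_arrow W t n = p" if p: "p \<in> Hom C W X" for p
  proof -
    have *: "hat W X (p \<cdot> power_arrow W t k) = ((\<lambda>x. x \<bullet> twist_diag W \<gamma>) ^^ k) (hat W X p)" for k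
    proof (induction k)
      case 0
      then show ?case using ide_right[OF W X' p] by simp
    next
      case (Suc k)
      have "p \<cdot> power_arrow W t (Suc k) = (p \<cdot> power_arrow W t k) \<cdot> t"
        using comp_assoc[OF W W W X' t tn[of k] p] power_arrow_commute[OF W t, of k] by simp
      then have "hat W X (p \<cdot> power_arrow W t (Suc k)) = hat W X (p \<cdot> power_arrow W t k) \<bullet> hat W W t"
        using hat_comp[OF W W X' t comp_in[OF W W X' tn[of k] p]] by simp
      then show ?case using reprD(4)[OF r] Suc by simp
    qed
    show ?thesis
      using *[of n] twist_power_projection[OF X n iso Z hb hom_hat[OF W X' p]]
      by (intro hat_faithful[OF W X' comp_in[OF W W X' tn p] p]) simp
  qed
  have tf: "power_arrow W t n \<cdot> f \<in> Hom C X W" by (rule comp_in[OF X' W W f tn])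
  have "f - (power_arrow W t n \<cdot> f) = 0"
  proof (rule simple_detects_zero[OF X W diff_in_hom[OF X' W f tf]])
    fix p assume p: "p \<in> Hom C W X"
    show "p \<cdot> (f - (power_arrow W t n \<cdot> f)) = 0"
      using comp_diff_right[OF X' W X' f tf p] comp_assoc[OF X' W W X' f tn p, of n] fix_p[OF p] by simp
  qed
  then show ?thesis by simp
qed

section \<open>The Drinfeld center\<close>

text \<open>
  The arrows \<open>(V, \<gamma>) \<rightarrow> (W, \<delta>)\<close> of the center.
\<close>

definition central :: "'o \<Rightarrow> ('o \<Rightarrow> 'm) \<Rightarrow> 'o \<Rightarrow> ('o \<Rightarrow> 'm) \<Rightarrow> 'm \<Rightarrow> bool" where
  "central V \<gamma> W \<delta> f \<longleftrightarrow> f \<in> Hom C V W \<and> (\<forall>A\<in>Obj C. \<delta> A \<cdot> (f \<odot> ide C A) = (ide C A \<odot> f) \<cdot> \<gamma> A)"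

lemma center_simps [simp]:
  "(W, \<gamma>) \<in> Obj (drinfeld_center C) \<longleftrightarrow> half_braiding C W \<gamma>"
  "f \<in> Hom (drinfeld_center C) (V, \<gamma>) (W, \<delta>) \<longleftrightarrow> central V \<gamma> W \<delta> f"
  "ide (drinfeld_center C) (W, \<gamma>) = ide C W"
  "Comp (drinfeld_center C) = Comp C"
  "scale (drinfeld_center C) = scale C"
  by (auto simp: drinfeld_center_def central_def)

lemma central_hom: "central V \<gamma> W \<delta> f \<Longrightarrow> f \<in> Hom C V W"
  by (simp add: central_def)

lemma central_diag:
  assumes V: "half_braiding C V \<gamma>" and W: "half_braiding C W \<delta>" and f: "f \<in> Hom C V W"
  shows "central V \<gamma> W \<delta> f \<longleftrightarrow> (\<forall>A\<in>Obj C. hb W \<delta> A \<bullet> (hat V W f \<lhd> [A]) = ([A] \<rhd> hat V W f) \<bullet> hb V \<gamma> A)"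
proof -
  have "\<delta> A \<cdot> (f \<odot> ide C A) = (ide C A \<odot> f) \<cdot> \<gamma> A \<longleftrightarrow>
     hb W \<delta> A \<bullet> (hat V W f \<lhd> [A]) = ([A] \<rhd> hat V W f) \<bullet> hb V \<gamma> A" if [simp]: "A \<in> Obj C" for A
  proof -
    note [simp] = half_braidingD(1)[OF V] half_braidingD(1)[OF W] structure_homs f half_braiding_hom[OF V] half_braiding_hom[OF W]
    let ?f = "hat V W f" and ?g = "hat (V \<otimes> A) (A \<otimes> V) (\<gamma> A)" and ?d = "hat (W \<otimes> A) (A \<otimes> W) (\<delta> A)"
    have l: "repr (V \<otimes> A) (A \<otimes> W) (\<delta> A \<cdot> (f \<odot> ide C A)) (?d \<bullet> merge W A \<bullet> (?f \<lhd> [A]) \<bullet> split V A)"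
      by (rule repr_comp repr_left repr_hat | simp)+
    have r: "repr (V \<otimes> A) (A \<otimes> W) ((ide C A \<odot> f) \<cdot> \<gamma> A) ((merge A W \<bullet> ([A] \<rhd> ?f) \<bullet> split A V) \<bullet> ?g)"
      by (rule repr_comp repr_right repr_hat | simp)+
    have "\<delta> A \<cdot> (f \<odot> ide C A) = (ide C A \<odot> f) \<cdot> \<gamma> A \<longleftrightarrow>
       ?d \<bullet> merge W A \<bullet> (?f \<lhd> [A]) \<bullet> split V A = (merge A W \<bullet> ([A] \<rhd> ?f) \<bullet> split A V) \<bullet> ?g" (is "?lhs \<longleftrightarrow> ?L = ?R")
      using hat_faithful[OF reprD(1,2)[OF l] reprD(3)[OF l] reprD(3)[OF r]] reprD(4)[OF l] reprD(4)[OF r] by auto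
    also have "\<dots> \<longleftrightarrow> split A W \<bullet> ?L \<bullet> merge V A = split A W \<bullet> ?R \<bullet> merge V A"
    proof
      assume "split A W \<bullet> ?L \<bullet> merge V A = split A W \<bullet> ?R \<bullet> merge V A"
      then have "merge A W \<bullet> (split A W \<bullet> ?L \<bullet> merge V A) \<bullet> split V A = merge A W \<bullet> (split A W \<bullet> ?R \<bullet> merge V A) \<bullet> split V A"
        by simp
      then show "?L = ?R" by (simp add: comp_assoc_diag cancel_whisk)
    qed simp
    also have "\<dots> \<longleftrightarrow> hb W \<delta> A \<bullet> (?f \<lhd> [A]) = ([A] \<rhd> ?f) \<bullet> hb V \<gamma> A"
      by (simp add: hb_def comp_assoc_diag cancel_whisk)
    finally show ?thesis .
  qed
  then show ?thesis using f by (simp add: central_def)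
qed

lemma central_ide:
  assumes hb: "half_braiding C W \<gamma>"
  shows "central W \<gamma> W \<gamma> (ide C W)"
  unfolding central_diag[OF hb hb ide_in[OF half_braidingD(1)[OF hb]]]
  by (simp add: half_braidingD(1)[OF hb] hb_simps[OF hb])

lemma central_comp:
  assumes U: "half_braiding C U \<alpha>" and V: "half_braiding C V \<gamma>" and W: "half_braiding C W \<delta>"
    and f: "central U \<alpha> V \<gamma> f" and g: "central V \<gamma> W \<delta> g"
  shows "central U \<alpha> W \<delta> (g \<cdot> f)"
proof -
  note [simp] = half_braidingD(1)[OF U] half_braidingD(1)[OF V] half_braidingD(1)[OF W]
  note f' = central_hom[OF f] and g' = central_hom[OF g]
  have gf: "g \<cdot> f \<in> Hom C U W" by (rule comp_in[where B = V]) (use f' g' in auto)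
  have h: "hat U W (g \<cdot> f) = hat V W g \<bullet> hat U V f" by (rule hat_comp) (use f' g' in auto)
  have "hb W \<delta> A \<bullet> (hat U W (g \<cdot> f) \<lhd> [A]) = ([A] \<rhd> hat U W (g \<cdot> f)) \<bullet> hb U \<alpha> A" if A: "A \<in> Obj C" for A
  proof -
    have 1: "hb V \<gamma> A \<bullet> (hat U V f \<lhd> [A]) = ([A] \<rhd> hat U V f) \<bullet> hb U \<alpha> A"
      and 2: "hb W \<delta> A \<bullet> (hat V W g \<lhd> [A]) = ([A] \<rhd> hat V W g) \<bullet> hb V \<gamma> A"
      using f g A central_diag[OF U V f'] central_diag[OF V W g'] by auto
    show ?thesis
      by (simp add: h whisk_simps pre[OF 2] 1)
  qed
  then show ?thesis using central_diag[OF U W gf] by blast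
qed

lemma central_twist:
  assumes hb: "half_braiding C W \<gamma>"
  shows "central W \<gamma> W \<gamma> (twist_arrow (drinfeld_center C) (W, \<gamma>))"
  using central_diag[OF hb hb reprD(3)[OF repr_twist_arrow[OF hb]]] twist_diag_central[OF hb]
    reprD(4)[OF repr_twist_arrow[OF hb]] by simp

lemma central_power:
  assumes hb: "half_braiding C W \<gamma>" and f: "central W \<gamma> W \<gamma> f"
  shows "central W \<gamma> W \<gamma> (power_arrow W f k)"
  by (induction k) (auto intro: central_ide central_comp hb f)

lemma twist_natural:
  assumes V: "half_braiding C V \<gamma>" and W: "half_braiding C W \<delta>" and f: "central V \<gamma> W \<delta> f"
  shows "twist_arrow (drinfeld_center C) (W, \<delta>) \<cdot> f = f \<cdot> twist_arrow (drinfeld_center C) (V, \<gamma>)"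
    (is "?w \<cdot> f = f \<cdot> ?v")
proof -
  note V' = half_braidingD(1)[OF V] and W' = half_braidingD(1)[OF W]
  note f' = central_hom[OF f]
  note w = repr_comp[OF repr_twist_arrow[OF W] repr_hat[OF V' W' f']]
  note v = repr_comp[OF repr_hat[OF V' W' f'] repr_twist_arrow[OF V]]
  have "hb W \<delta> W \<bullet> (hat V W f \<lhd> [W]) = ([W] \<rhd> hat V W f) \<bullet> hb V \<gamma> W"
    using f central_diag[OF V W f'] W' by blast
  from twist_diag_natural[OF W V hom_hat[OF V' W' f'] this]
  show ?thesis
    by (intro hat_faithful[OF reprD(1,2,3)[OF w] reprD(3)[OF v]]) (simp add: reprD(4)[OF w] reprD(4)[OF v])
qed

lemma twist_power_natural:
  assumes V: "half_braiding C V \<gamma>" and W: "half_braiding C W \<delta>" and f: "central V \<gamma> W \<delta> f"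
  shows "power_arrow W (twist_arrow (drinfeld_center C) (W, \<delta>)) k \<cdot> f
    = f \<cdot> power_arrow V (twist_arrow (drinfeld_center C) (V, \<gamma>)) k"
proof (induction k)
  case 0
  then show ?case
    using half_braidingD(1)[OF V] half_braidingD(1)[OF W] central_hom[OF f] by (simp add: ide_left ide_right)
next
  case (Suc k)
  let ?w = "twist_arrow (drinfeld_center C) (W, \<delta>)" and ?v = "twist_arrow (drinfeld_center C) (V, \<gamma>)"
  note V' = half_braidingD(1)[OF V] and W' = half_braidingD(1)[OF W]
  note f' = central_hom[OF f]
  note w = reprD(3)[OF repr_twist_arrow[OF W]] and v = reprD(3)[OF repr_twist_arrow[OF V]]
  note wk = power_arrow_hom[OF W' w, of k] and vk = power_arrow_hom[OF V' v, of k]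
  have "power_arrow W ?w (Suc k) \<cdot> f = ?w \<cdot> (f \<cdot> power_arrow V ?v k)"
    using comp_assoc[OF V' W' W' W' f' wk w] Suc by simp
  also have "\<dots> = (f \<cdot> ?v) \<cdot> power_arrow V ?v k"
    using comp_assoc[OF V' V' W' W' vk f' w] twist_natural[OF V W f] by simp
  finally show ?case
    using comp_assoc[OF V' V' V' W' vk v f'] by simp
qed

section \<open>Twists of simple objects of the center\<close>

text \<open>
  The image of \<open>e\<close> is the kernel of \<open>1 - e\<close>.
\<close>

lemma split_idempotent:
  assumes W: "W \<in> Obj C" and e: "e \<in> Hom C W W" and ee: "e \<cdot> e = e"
  obtains K k r where "K \<in> Obj C" "k \<in> Hom C K W" "r \<in> Hom C W K" "k \<cdot> r = e" "r \<cdot> k = ide C K"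
proof -
  let ?f = "ide C W - e"
  have f: "?f \<in> Hom C W W" by (rule diff_in_hom[OF W W ide_in[OF W] e])
  obtain K k where ker: "is_kernel C W W ?f K k" using kernels[OF W W f] by auto
  then have K: "K \<in> Obj C" and k: "k \<in> Hom C K W" and fk: "?f \<cdot> k = 0" by (auto simp: is_kernel_def)
  have ek: "e \<cdot> k = k"
    using fk comp_diff_left[OF K W W k ide_in[OF W] e] ide_left[OF K W k] by simp
  have "?f \<cdot> e = 0"
    using comp_diff_left[OF W W W e ide_in[OF W] e] ide_left[OF W W e] ee by simp
  then obtain r where r: "r \<in> Hom C W K" "k \<cdot> r = e"
    using ker W e unfolding is_kernel_def by blast
  have rk: "r \<cdot> k \<in> Hom C K K" by (rule comp_in[OF K W K k r(1)])
  have "k \<cdot> (r \<cdot> k) = k \<cdot> ide C K"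
    using comp_assoc[OF K W K W k r(1) k] r(2) ek ide_right[OF K W k] by simp
  then have "r \<cdot> k = ide C K"
    using kernel_mono[OF ker W W f] K rk ide_in[OF K] unfolding mono_arrow_def by blast
  then show thesis using that[OF K k r(1,2)] by blast
qed

text \<open>
  The half-braiding of the retract is \<open>(A \<odot> r) \<gamma>\<^sub>A (k \<odot> A)\<close>. Since the idempotent \<open>k r\<close> commutes with the crossings, it is
  absorbed wherever two of these arrows, or one of them and its inverse, are composed.
\<close>

lemma retract_half_braiding:
  assumes hb: "half_braiding C W \<gamma>" and K: "K \<in> Obj C" and k: "k \<in> Hom C K W" and r: "r \<in> Hom C W K"
    and rk: "r \<cdot> k = ide C K" and e: "central W \<gamma> W \<gamma> (k \<cdot> r)"
  obtains \<delta> where "half_braiding C K \<delta>" "central K \<delta> W \<gamma> k"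
proof -
  note W = half_braidingD(1)[OF hb]
  note [simp] = W K k r structure_homs hb_simps[OF hb] half_braiding_hom[OF hb]
  let ?k = "hat K W k" and ?r = "hat W K r" and ?e = "hat W W (k \<cdot> r)"
  have rk': "?r \<bullet> ?k = idn [K]" using hat_comp[OF K W K k r] rk by simp
  have kr': "?k \<bullet> ?r = ?e" using hat_comp[OF W K W r k] by simp
  have e_hom[simp]: "k \<cdot> r \<in> Hom C W W" by (rule central_hom[OF e])
  have ek: "?e \<bullet> ?k = ?k" by (simp add: kr'[symmetric] comp_assoc_diag rk')
  have re: "?r \<bullet> ?e = ?r" by (simp add: kr'[symmetric] pre_inverse[OF rk'])
  have ce: "hb W \<gamma> A \<bullet> (?e \<lhd> [A]) = ([A] \<rhd> ?e) \<bullet> hb W \<gamma> A" if "A \<in> Obj C" for A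
    using e central_diag[OF hb hb e_hom] that by blast
  have kr_mid: "(l \<rhd> ?k \<lhd> s) \<bullet> (l \<rhd> ?r \<lhd> s) = l \<rhd> ?e \<lhd> s" for l s by (rule whisk[OF kr'])
  have rk_mid: "(l \<rhd> ?r \<lhd> s) \<bullet> (l \<rhd> ?k \<lhd> s) = l \<rhd> idn [K] \<lhd> s" for l s by (rule whisk[OF rk'])
  define \<delta> where "\<delta> = (\<lambda>A\<in>Obj C. (ide C A \<odot> r) \<cdot> \<gamma> A \<cdot> (k \<odot> ide C A))"
  have d: "repr (K \<otimes> A) (A \<otimes> K) (\<delta> A) ((merge A K \<bullet> ([A] \<rhd> ?r) \<bullet> split A W) \<bullet> hat (W \<otimes> A) (A \<otimes> W) (\<gamma> A) \<bullet>
      (merge W A \<bullet> (?k \<lhd> [A]) \<bullet> split K A))" if [simp]: "A \<in> Obj C" for A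
  proof -
    have "\<delta> A = (ide C A \<odot> r) \<cdot> \<gamma> A \<cdot> (k \<odot> ide C A)" by (simp add: \<delta>_def)
    then show ?thesis by (simp only:) (rule repr_comp repr_left repr_right repr_hat | simp)+
  qed
  have d_hom[simp]: "\<delta> A \<in> Hom C (K \<otimes> A) (A \<otimes> K)" if "A \<in> Obj C" for A by (rule reprD(3)[OF d[OF that]])
  have hbK: "hb K \<delta> A = ([A] \<rhd> ?r) \<bullet> hb W \<gamma> A \<bullet> (?k \<lhd> [A])" if [simp]: "A \<in> Obj C" for A
    by (simp add: hb_def reprD(4)[OF d] comp_assoc_diag cancel_whisk)
  have hatd: "hat (K \<otimes> A) (A \<otimes> K) (\<delta> A) = merge A K \<bullet> hb K \<delta> A \<bullet> split K A" if [simp]: "A \<in> Obj C" for A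
    by (simp add: hb_def comp_assoc_diag cancel_whisk)
  have half: "half_braiding C K \<delta>"
    unfolding half_braiding_def
  proof (intro conjI ballI)
    show "K \<in> Obj C" "\<delta> \<in> extensional (Obj C)" by (auto simp: \<delta>_def)
  next
    fix A assume [simp]: "A \<in> Obj C"
    \<comment> \<open>The inverse crossing, restricted to the retract.\<close>
    let ?h = "(?r \<lhd> [A]) \<bullet> hb' W \<gamma> A \<bullet> ([A] \<rhd> ?k)"
    obtain g where g: "g \<in> Hom C (A \<otimes> K) (K \<otimes> A)" "merge K A \<bullet> ?h \<bullet> split A K = hat (A \<otimes> K) (K \<otimes> A) g"
      by (rule hat_full[of "merge K A \<bullet> ?h \<bullet> split A K" "A \<otimes> K" "K \<otimes> A"]) simp_all
    have ce': "(?e \<lhd> [A]) \<bullet> hb' W \<gamma> A = hb' W \<gamma> A \<bullet> ([A] \<rhd> ?e)"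
    proof -
      have "(?e \<lhd> [A]) \<bullet> hb' W \<gamma> A = hb' W \<gamma> A \<bullet> (hb W \<gamma> A \<bullet> (?e \<lhd> [A])) \<bullet> hb' W \<gamma> A"
        by (simp add: comp_assoc_diag pre_inverse[OF hb_inverse(1)[OF hb]])
      also have "\<dots> = hb' W \<gamma> A \<bullet> ([A] \<rhd> ?e)"
        by (simp add: ce comp_assoc_diag hb_inverse(2)[OF hb])
      finally show ?thesis .
    qed
    have 1: "?h \<bullet> hb K \<delta> A = idn [K, A]"
    proof -
      have "?h \<bullet> hb K \<delta> A = (?r \<lhd> [A]) \<bullet> (hb' W \<gamma> A \<bullet> ([A] \<rhd> ?e)) \<bullet> hb W \<gamma> A \<bullet> (?k \<lhd> [A])"
        by (simp add: hbK kr'[symmetric] whisk_simps)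
      also have "\<dots> = ((?r \<bullet> ?e) \<lhd> [A]) \<bullet> (hb' W \<gamma> A \<bullet> hb W \<gamma> A) \<bullet> (?k \<lhd> [A])"
        by (simp add: ce'[symmetric] whisk_simps)
      also have "\<dots> = (?r \<bullet> ?k) \<lhd> [A]" by (simp add: re hb_inverse(1)[OF hb] rwhisk_comp)
      finally show ?thesis by (simp add: rk')
    qed
    have 2: "hb K \<delta> A \<bullet> ?h = idn [A, K]"
    proof -
      have "hb K \<delta> A \<bullet> ?h = ([A] \<rhd> ?r) \<bullet> (hb W \<gamma> A \<bullet> (?e \<lhd> [A])) \<bullet> hb' W \<gamma> A \<bullet> ([A] \<rhd> ?k)"
        by (simp add: hbK kr'[symmetric] whisk_simps)
      also have "\<dots> = ([A] \<rhd> (?r \<bullet> ?e)) \<bullet> (hb W \<gamma> A \<bullet> hb' W \<gamma> A) \<bullet> ([A] \<rhd> ?k)"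
        by (simp add: ce whisk_simps)
      also have "\<dots> = [A] \<rhd> (?r \<bullet> ?k)" by (simp add: re hb_inverse(2)[OF hb] lwhisk_comp)
      finally show ?thesis by (simp add: rk')
    qed
    have hK[simp]: "valid (hb K \<delta> A)" "src (hb K \<delta> A) = [K, A]" "tgt (hb K \<delta> A) = [A, K]"
      by (simp_all add: hbK)
    have i1: "hat (A \<otimes> K) (K \<otimes> A) g \<bullet> hat (K \<otimes> A) (A \<otimes> K) (\<delta> A) = hat (K \<otimes> A) (K \<otimes> A) (ide C (K \<otimes> A))"
      using 1 by (simp add: g(2)[symmetric] hatd comp_assoc_diag cancel_whisk del: hat_ide)
        (simp add: comp_assoc_diag[symmetric])
    have i2: "hat (K \<otimes> A) (A \<otimes> K) (\<delta> A) \<bullet> hat (A \<otimes> K) (K \<otimes> A) g = hat (A \<otimes> K) (A \<otimes> K) (ide C (A \<otimes> K))"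
      using 2 by (simp add: g(2)[symmetric] hatd comp_assoc_diag cancel_whisk del: hat_ide)
        (simp add: comp_assoc_diag[symmetric])
    have "g \<cdot> \<delta> A = ide C (K \<otimes> A)"
      by (rule hat_faithful[of "K \<otimes> A" "K \<otimes> A"])
         (use i1 g(1) comp_in[of "K \<otimes> A" "A \<otimes> K" "K \<otimes> A"] hat_comp[of "K \<otimes> A" "A \<otimes> K" "K \<otimes> A" "\<delta> A" g] in simp_all)
    moreover have "\<delta> A \<cdot> g = ide C (A \<otimes> K)"
      by (rule hat_faithful[of "A \<otimes> K" "A \<otimes> K"])
         (use i2 g(1) comp_in[of "A \<otimes> K" "K \<otimes> A" "A \<otimes> K"] hat_comp[of "A \<otimes> K" "K \<otimes> A" "A \<otimes> K" g "\<delta> A"] in simp_all)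
    ultimately have "inverse_arrows C (K \<otimes> A) (A \<otimes> K) (\<delta> A) g"
      using g(1) by (simp add: inverse_arrows_def)
    then show "iso_arrow C (K \<otimes> A) (A \<otimes> K) (\<delta> A)" by (auto simp: iso_arrow_def)
  next
    fix A B f assume [simp]: "A \<in> Obj C" "B \<in> Obj C" and f[simp]: "f \<in> Hom C A B"
    have hf: "hom (hat A B f) [A] [B]" by (rule hom_hat) auto
    have hr: "hom ?r [W] [K]" and hk: "hom ?k [K] [W]" by (simp_all add: hom_def)
    have l: "repr (K \<otimes> A) (B \<otimes> K) (\<delta> B \<cdot> (ide C K \<odot> f)) (hat (K \<otimes> B) (B \<otimes> K) (\<delta> B) \<bullet> merge K B \<bullet> ([K] \<rhd> hat A B f) \<bullet> split K A)"
      by (rule repr_comp repr_right repr_hat | simp)+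
    have r: "repr (K \<otimes> A) (B \<otimes> K) ((f \<odot> ide C K) \<cdot> \<delta> A) ((merge B K \<bullet> (hat A B f \<lhd> [K]) \<bullet> split A K) \<bullet> hat (K \<otimes> A) (A \<otimes> K) (\<delta> A))"
      by (rule repr_comp repr_left repr_hat | simp)+
    have "hb K \<delta> B \<bullet> ([K] \<rhd> hat A B f) = ([B] \<rhd> ?r) \<bullet> hb W \<gamma> B \<bullet> ((?k \<lhd> [B]) \<bullet> ([K] \<rhd> hat A B f))"
      by (simp add: hbK comp_assoc_diag)
    also have "(?k \<lhd> [B]) \<bullet> ([K] \<rhd> hat A B f) = ([W] \<rhd> hat A B f) \<bullet> (?k \<lhd> [A])"
      by (rule exchange[OF hk hf, symmetric])
    also have "([B] \<rhd> ?r) \<bullet> hb W \<gamma> B \<bullet> (([W] \<rhd> hat A B f) \<bullet> (?k \<lhd> [A]))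
        = ([B] \<rhd> ?r) \<bullet> (hb W \<gamma> B \<bullet> ([W] \<rhd> hat A B f)) \<bullet> (?k \<lhd> [A])"
      by (simp add: comp_assoc_diag)
    also have "\<dots> = (([B] \<rhd> ?r) \<bullet> (hat A B f \<lhd> [W])) \<bullet> hb W \<gamma> A \<bullet> (?k \<lhd> [A])"
      by (simp add: hb_natural[OF hb] comp_assoc_diag)
    also have "([B] \<rhd> ?r) \<bullet> (hat A B f \<lhd> [W]) = (hat A B f \<lhd> [K]) \<bullet> ([A] \<rhd> ?r)"
      by (rule exchange[OF hf hr])
    finally have "hb K \<delta> B \<bullet> ([K] \<rhd> hat A B f) = (hat A B f \<lhd> [K]) \<bullet> hb K \<delta> A"
      by (simp add: hbK comp_assoc_diag)
    from pre[OF this]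
    have "hat (K \<otimes> B) (B \<otimes> K) (\<delta> B) \<bullet> merge K B \<bullet> ([K] \<rhd> hat A B f) \<bullet> split K A =
        (merge B K \<bullet> (hat A B f \<lhd> [K]) \<bullet> split A K) \<bullet> hat (K \<otimes> A) (A \<otimes> K) (\<delta> A)"
      by (simp add: hatd comp_assoc_diag cancel_whisk hbK)
    then show "\<delta> B \<cdot> (ide C K \<odot> f) = (f \<odot> ide C K) \<cdot> \<delta> A"
      by (intro hat_faithful[OF reprD(1,2,3)[OF l] reprD(3)[OF r]]) (simp add: reprD(4)[OF l] reprD(4)[OF r])
  next
    fix A B assume [simp]: "A \<in> Obj C" "B \<in> Obj C"
    have hr: "hom ?r [W] [K]" and hk: "hom ?k [K] [W]" by (simp_all add: hom_def)
    have hm: "hom (merge A B) [A, B] [A \<otimes> B]" and hs: "hom (split A B) [A \<otimes> B] [A, B]" by (simp_all add: hom_def)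
    note hex = repr_hexagon[of K A B \<delta>, OF K _ _ d_hom d_hom, simplified]
    have hbW: "hb W \<gamma> (A \<otimes> B) = (merge A B \<lhd> [W]) \<bullet> ([A] \<rhd> hb W \<gamma> B) \<bullet> (hb W \<gamma> A \<lhd> [B]) \<bullet> ([W] \<rhd> split A B)"
    proof -
      have "hb W \<gamma> (A \<otimes> B) = (hb W \<gamma> (A \<otimes> B) \<bullet> ([W] \<rhd> merge A B)) \<bullet> ([W] \<rhd> split A B)"
        by (simp add: comp_assoc_diag)
      then show ?thesis by (simp only: hb_tensor[OF hb \<open>A \<in> Obj C\<close> \<open>B \<in> Obj C\<close>] comp_assoc_diag)
    qed
    have ceB: "([A] \<rhd> ?e \<lhd> [B]) \<bullet> (hb W \<gamma> A \<lhd> [B]) = (hb W \<gamma> A \<lhd> [B]) \<bullet> (?e \<lhd> [A, B])"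
      using arg_cong[OF ce[of A], of "\<lambda>x. x \<lhd> [B]"] by (simp add: whisk_simps)
    have "([A] \<rhd> hb K \<delta> B) \<bullet> (hb K \<delta> A \<lhd> [B]) = ([A, B] \<rhd> ?r) \<bullet> ([A] \<rhd> hb W \<gamma> B) \<bullet>
        (([A] \<rhd> ?k \<lhd> [B]) \<bullet> ([A] \<rhd> ?r \<lhd> [B])) \<bullet> (hb W \<gamma> A \<lhd> [B]) \<bullet> (?k \<lhd> [A, B])"
      by (simp add: hbK whisk_simps)
    also have "\<dots> = ([A, B] \<rhd> ?r) \<bullet> ([A] \<rhd> hb W \<gamma> B) \<bullet> (([A] \<rhd> ?e \<lhd> [B]) \<bullet> (hb W \<gamma> A \<lhd> [B])) \<bullet> (?k \<lhd> [A, B])"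
      by (simp only: kr_mid comp_assoc_diag)
    also have "\<dots> = ([A, B] \<rhd> ?r) \<bullet> ([A] \<rhd> hb W \<gamma> B) \<bullet> (hb W \<gamma> A \<lhd> [B]) \<bullet> ((?e \<bullet> ?k) \<lhd> [A, B])"
      by (simp only: ceB comp_assoc_diag rwhisk_comp)
    finally have mid: "([A] \<rhd> hb K \<delta> B) \<bullet> (hb K \<delta> A \<lhd> [B]) = ([A, B] \<rhd> ?r) \<bullet> ([A] \<rhd> hb W \<gamma> B) \<bullet> (hb W \<gamma> A \<lhd> [B]) \<bullet> (?k \<lhd> [A, B])"
      by (simp only: ek)
    have "hb K \<delta> (A \<otimes> B) = (([A \<otimes> B] \<rhd> ?r) \<bullet> (merge A B \<lhd> [W])) \<bullet> ([A] \<rhd> hb W \<gamma> B) \<bullet> (hb W \<gamma> A \<lhd> [B]) \<bullet>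
       (([W] \<rhd> split A B) \<bullet> (?k \<lhd> [A \<otimes> B]))"
      by (simp add: hbK hbW comp_assoc_diag)
    also have "([A \<otimes> B] \<rhd> ?r) \<bullet> (merge A B \<lhd> [W]) = (merge A B \<lhd> [K]) \<bullet> ([A, B] \<rhd> ?r)"
      by (rule exchange[OF hm hr])
    also have "([W] \<rhd> split A B) \<bullet> (?k \<lhd> [A \<otimes> B]) = (?k \<lhd> [A, B]) \<bullet> ([K] \<rhd> split A B)"
      by (rule exchange[OF hk hs])
    also have "((merge A B \<lhd> [K]) \<bullet> ([A, B] \<rhd> ?r)) \<bullet> ([A] \<rhd> hb W \<gamma> B) \<bullet> (hb W \<gamma> A \<lhd> [B]) \<bullet> (?k \<lhd> [A, B]) \<bullet> ([K] \<rhd> split A B)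
      = (merge A B \<lhd> [K]) \<bullet> (([A, B] \<rhd> ?r) \<bullet> ([A] \<rhd> hb W \<gamma> B) \<bullet> (hb W \<gamma> A \<lhd> [B]) \<bullet> (?k \<lhd> [A, B])) \<bullet> ([K] \<rhd> split A B)"
      by (simp only: comp_assoc_diag)
    finally have "hb K \<delta> (A \<otimes> B) = (merge A B \<lhd> [K]) \<bullet> ([A] \<rhd> hb K \<delta> B) \<bullet> (hb K \<delta> A \<lhd> [B]) \<bullet> ([K] \<rhd> split A B)"
      by (simp only: mid[symmetric] comp_assoc_diag)
    then have "hat (K \<otimes> (A \<otimes> B)) ((A \<otimes> B) \<otimes> K) (\<delta> (A \<otimes> B)) =
        hat (K \<otimes> (A \<otimes> B)) ((A \<otimes> B) \<otimes> K) (assoc' C A B K \<cdot> (ide C A \<odot> \<delta> B) \<cdot> assoc C A K B \<cdot> (\<delta> A \<odot> ide C B) \<cdot> assoc' C K A B)"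
      by (simp add: hatd reprD(4)[OF hex] comp_assoc_diag)
    then show "\<delta> (A \<otimes> B) = assoc' C A B K \<cdot> (ide C A \<odot> \<delta> B) \<cdot> assoc C A K B \<cdot> (\<delta> A \<odot> ide C B) \<cdot> assoc' C K A B"
      by (intro hat_faithful[OF reprD(1,2)[OF hex] _ reprD(3)[OF hex]]) simp_all
  qed
  have "hb W \<gamma> A \<bullet> (?k \<lhd> [A]) = ([A] \<rhd> ?k) \<bullet> hb K \<delta> A" if [simp]: "A \<in> Obj C" for A
  proof -
    have "([A] \<rhd> ?k) \<bullet> hb K \<delta> A = (([A] \<rhd> ?e) \<bullet> hb W \<gamma> A) \<bullet> (?k \<lhd> [A])"
      by (simp add: hbK kr'[symmetric] whisk_simps)
    also have "\<dots> = hb W \<gamma> A \<bullet> ((?e \<bullet> ?k) \<lhd> [A])"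
      by (simp add: ce[symmetric] rwhisk_comp comp_assoc_diag)
    finally show ?thesis by (simp add: ek)
  qed
  then have "central K \<delta> W \<gamma> k" using central_diag[OF half hb k] by blast
  with half show thesis by (rule that)
qed

lemma central_scale:
  assumes V: "half_braiding C V \<gamma>" and W: "half_braiding C W \<delta>" and f: "central V \<gamma> W \<delta> f"
  shows "central V \<gamma> W \<delta> (scale C c f)"
proof -
  note V' = half_braidingD(1)[OF V] and W' = half_braidingD(1)[OF W] and f' = central_hom[OF f]
  have "\<delta> A \<cdot> (scale C c f \<odot> ide C A) = (ide C A \<odot> scale C c f) \<cdot> \<gamma> A" if A: "A \<in> Obj C" for A
  proof -
    note [simp] = V' W' f' A structure_homs half_braiding_hom[OF V] half_braiding_hom[OF W]
    have "\<delta> A \<cdot> (scale C c f \<odot> ide C A) = scale C c (\<delta> A \<cdot> (f \<odot> ide C A))"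
      by (simp add: tensor_scale_left[of V W A A] comp_scale_right[of "V \<otimes> A" "W \<otimes> A" "A \<otimes> W"])
    also have "\<delta> A \<cdot> (f \<odot> ide C A) = (ide C A \<odot> f) \<cdot> \<gamma> A" using f A by (simp add: central_def)
    also have "scale C c \<dots> = (ide C A \<odot> scale C c f) \<cdot> \<gamma> A"
      by (simp add: tensor_scale_right[of A A V W] comp_scale_left[of "V \<otimes> A" "A \<otimes> V" "A \<otimes> W"])
    finally show ?thesis .
  qed
  then show ?thesis using scale_in_hom[OF V' W' f'] by (simp add: central_def)
qed

lemma central_add:
  assumes V: "half_braiding C V \<gamma>" and W: "half_braiding C W \<delta>" and f: "central V \<gamma> W \<delta> f" and g: "central V \<gamma> W \<delta> g"
  shows "central V \<gamma> W \<delta> (f + g)"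
proof -
  note V' = half_braidingD(1)[OF V] and W' = half_braidingD(1)[OF W] and f' = central_hom[OF f] and g' = central_hom[OF g]
  have "\<delta> A \<cdot> ((f + g) \<odot> ide C A) = (ide C A \<odot> (f + g)) \<cdot> \<gamma> A" if A: "A \<in> Obj C" for A
  proof -
    note [simp] = V' W' f' g' A structure_homs half_braiding_hom[OF V] half_braiding_hom[OF W]
    have "\<delta> A \<cdot> ((f + g) \<odot> ide C A) = (\<delta> A \<cdot> (f \<odot> ide C A)) + (\<delta> A \<cdot> (g \<odot> ide C A))"
      by (simp add: tensor_add_left[of V W A A] comp_add_right[of "V \<otimes> A" "W \<otimes> A" "A \<otimes> W"])
    also have "\<dots> = ((ide C A \<odot> f) \<cdot> \<gamma> A) + ((ide C A \<odot> g) \<cdot> \<gamma> A)" using f g A by (simp add: central_def)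
    also have "\<dots> = (ide C A \<odot> (f + g)) \<cdot> \<gamma> A"
      by (simp add: tensor_add_right[of A A V W] comp_add_left[of "V \<otimes> A" "A \<otimes> V" "A \<otimes> W"])
    finally show ?thesis .
  qed
  then show ?thesis using add_in_hom[OF V' W' f' g'] by (simp add: central_def)
qed

lemma central_sum:
  assumes V: "half_braiding C V \<gamma>" and W: "half_braiding C W \<delta>" and f: "\<And>i. i \<in> I \<Longrightarrow> central V \<gamma> W \<delta> (f i)"
    and I: "finite I" "I \<noteq> {}"
  shows "central V \<gamma> W \<delta> (sum f I)"
  using I f by (induction rule: finite_ne_induct) (auto intro: central_add[OF V W])

text \<open>
  If the identity of \<open>W\<close> vanished, then all arrows to and from \<open>(W, \<gamma>)\<close> would.
\<close>

lemma center_simple_nonzero: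
  assumes simple: "simple_object (drinfeld_center C) (W, \<gamma>)"
  shows "half_braiding C W \<gamma>" "ide C W \<noteq> 0"
proof -
  show W: "half_braiding C W \<gamma>" using simple by (simp add: simple_object_def)
  note W' = half_braidingD(1)[OF W]
  show "ide C W \<noteq> 0"
  proof
    assume 0: "ide C W = 0"
    then have z: "zero_object C W" using zero_object_iff[OF W'] by simp
    have "Hom (drinfeld_center C) (V, \<delta>) (W, \<gamma>) = {0} \<and> Hom (drinfeld_center C) (W, \<gamma>) (V, \<delta>) = {0}"
      if V: "half_braiding C V \<delta>" for V \<delta>
    proof -
      note V' = half_braidingD(1)[OF V]
      have h: "Hom C V W = {0}" "Hom C W V = {0}" using z V' by (auto simp: zero_object_def)
      note [simp] = V' W' structure_homs half_braiding_hom[OF V] half_braiding_hom[OF W] zero_in_hom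
      have t0: "0 \<odot> ide C A = 0" "ide C A \<odot> 0 = 0" if "A \<in> Obj C" "D \<in> Obj C" "E \<in> Obj C" for A D E
        using tensor_scale_left[of D E A A 0 "ide C A" 0] tensor_scale_right[of A A D E "ide C A" 0 0] that by simp_all
      have "central V \<delta> W \<gamma> 0" "central W \<gamma> V \<delta> 0"
        using t0 comp_zero_left[of "V \<otimes> A" "A \<otimes> V" "A \<otimes> W" "\<delta> A" for A] comp_zero_right[of "V \<otimes> A" "W \<otimes> A" "A \<otimes> W" "\<gamma> A" for A]
          comp_zero_left[of "W \<otimes> A" "A \<otimes> W" "A \<otimes> V" "\<gamma> A" for A] comp_zero_right[of "W \<otimes> A" "V \<otimes> A" "A \<otimes> V" "\<delta> A" for A]
        by (auto simp: central_def)
      then show ?thesis using h central_hom by (auto simp: set_eq_iff)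
    qed
    then have "zero_object (drinfeld_center C) (W, \<gamma>)"
      using W by (auto simp: zero_object_def)
    then show False using simple by (simp add: simple_object_def)
  qed
qed

lemma power_arrow_eigen:
  assumes W: "W \<in> Obj C" and f: "f \<in> Hom C W W" and e: "e \<in> Hom C W W" and fe: "f \<cdot> e = scale C t e"
  shows "power_arrow W f k \<cdot> e = scale C (t ^ k) e"
proof (induction k)
  case (Suc k)
  then show ?case
    using comp_assoc[OF W W W W e power_arrow_hom[OF W f] f, of k] comp_scale_right[OF W W W e f, of "t ^ k"] fe
    by (simp add: mult.commute)
qed (simp add: ide_left[OF W W e])

text \<open>
  A geometric sum with ratio \<open>w\<^sup>k\<close>, which is different from \<open>1\<close> for \<open>0 < k < n\<close>.
\<close>

lemma sum_roots_of_unity_power: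
  assumes "n \<ge> 1"
  defines "w \<equiv> cis (2 * pi / real n)"
  assumes "k < n"
  shows "(\<Sum>j<n. (w ^ j) ^ k) = (if k = 0 then of_nat n else 0)"
proof (cases "k = 0")
  case False
  have wn: "w ^ n = 1" using assms(1) by (simp add: w_def DeMoivre)
  have wk: "w ^ k \<noteq> 1"
  proof
    assume "w ^ k = 1"
    then have "cis (2 * pi * real k / real n) = cis (2 * pi * real 0 / real n)"
      by (simp add: w_def DeMoivre mult_ac)
    moreover have "inj_on (\<lambda>k. cis (2 * pi * real k / real n)) {..<n}"
      using bij_betw_roots_unity[of n] assms(1) by (simp add: bij_betw_def)
    ultimately have "k = 0"
      using assms(1,3) unfolding inj_on_def by (metis lessThan_iff less_le_trans zero_less_one)
    then show False using False by simp
  qed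
  have "(\<Sum>j<n. (w ^ j) ^ k) = (\<Sum>j<n. (w ^ k) ^ j)" by (simp add: power_mult[symmetric] mult.commute)
  also have "\<dots> = ((w ^ k) ^ n - 1) / (w ^ k - 1)" by (rule geometric_sum[OF wk])
  also have "(w ^ k) ^ n = 1" using wn by (metis power_mult mult.commute power_one)
  finally show ?thesis using False by simp
qed (use assms in simp)

text \<open>
  Summed over all \<open>n\<close>-th roots of unity \<open>s\<close>, these arrows give \<open>n\<close> times the identity.
\<close>

lemma eigenprojection_exists:
  assumes W: "W \<in> Obj C" "ide C W \<noteq> 0" and f: "f \<in> Hom C W W" and n: "n \<ge> 1" and fn: "power_arrow W f n = ide C W"
  obtains s where "s ^ n = 1" "(\<Sum>k<n. scale C (s ^ k) (power_arrow W f k)) \<noteq> 0"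
proof -
  define w where "w = cis (2 * pi / real n)"
  have wn: "w ^ n = 1" using n by (simp add: w_def DeMoivre)
  let ?e = "\<lambda>s. \<Sum>k<n. scale C (s ^ k) (power_arrow W f k)"
  have "(\<Sum>j<n. ?e (w ^ j)) = (\<Sum>k<n. scale C (\<Sum>j<n. (w ^ j) ^ k) (power_arrow W f k))"
    by (subst sum.swap) (simp add: vs.scale_sum_left)
  also have "\<dots> = (\<Sum>k<n. if k = 0 then scale C (of_nat n) (ide C W) else 0)"
    by (rule sum.cong) (auto simp: sum_roots_of_unity_power[OF n, folded w_def])
  also have "\<dots> = scale C (of_nat n) (ide C W)" using n by (simp add: sum.delta)
  finally have "(\<Sum>j<n. ?e (w ^ j)) \<noteq> 0" using n W(2) by simp
  then obtain j where "?e (w ^ j) \<noteq> 0" by (metis (no_types, lifting) sum.neutral)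
  moreover have "(w ^ j) ^ n = 1" using wn by (metis power_mult mult.commute power_one)
  ultimately show thesis using that by blast
qed

text \<open>
  The projection to the eigenvalue \<open>s\<^sup>-\<^sup>1\<close>: multiplication by \<open>f\<close> shifts the sum cyclically, because \<open>s\<^sup>k f\<^sup>k\<close> depends on
  \<open>k\<close> modulo \<open>n\<close> only.
\<close>

lemma eigenprojection:
  assumes W: "W \<in> Obj C" and f: "f \<in> Hom C W W" and n: "n \<ge> 1" and fn: "power_arrow W f n = ide C W" and s: "s ^ n = 1"
  defines "e \<equiv> scale C (1 / of_nat n) (\<Sum>k<n. scale C (s ^ k) (power_arrow W f k))"
  shows "e \<in> Hom C W W" "f \<cdot> e = scale C (inverse s) e" "e \<cdot> e = e"
proof -
  have s0: "s \<noteq> 0" using s n by (auto simp: power_0_left)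
  note fk = power_arrow_hom[OF W f]
  let ?a = "\<lambda>k. scale C (s ^ k) (power_arrow W f k)"
  have a: "?a k \<in> Hom C W W" for k by (rule scale_in_hom[OF W W fk])
  have sum_a: "sum ?a {..<n} \<in> Hom C W W" by (rule sum_in_hom[OF W W a])
  show e: "e \<in> Hom C W W" unfolding e_def by (rule scale_in_hom[OF W W sum_a])
  have "f \<cdot> sum ?a {..<n} = (\<Sum>k<n. f \<cdot> ?a k)" by (rule comp_sum_right[OF W W W f a])
  also have "\<dots> = (\<Sum>k<n. scale C (inverse s) (?a (Suc k)))"
    using s0 by (intro sum.cong refl) (simp add: comp_scale_right[OF W W W fk f])
  also have "\<dots> = scale C (inverse s) (\<Sum>k<n. ?a (Suc k))" by (simp add: vs.scale_sum_right)
  also have "(\<Sum>k<n. ?a (Suc k)) = sum ?a {..<n}"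
    using sum.lessThan_Suc_shift[of ?a n] sum.lessThan_Suc[of ?a n] by (simp add: s fn)
  finally have fs: "f \<cdot> sum ?a {..<n} = scale C (inverse s) (sum ?a {..<n})" .
  show fe: "f \<cdot> e = scale C (inverse s) e"
    unfolding e_def using fs comp_scale_right[OF W W W sum_a f] by (simp add: mult.commute)
  have "e \<cdot> e = scale C (1 / of_nat n) (sum ?a {..<n} \<cdot> e)"
    unfolding e_def[of] using comp_scale_left[OF W W W e[unfolded e_def] sum_a] by simp
  also have "sum ?a {..<n} \<cdot> e = (\<Sum>k<n. ?a k \<cdot> e)" by (rule comp_sum_left[OF W W W e a])
  also have "\<dots> = (\<Sum>k<n. e)"
  proof (rule sum.cong[OF refl])
    fix k
    show "?a k \<cdot> e = e"
      using comp_scale_left[OF W W W e fk, of "s ^ k" k] power_arrow_eigen[OF W f e fe, of k] s0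
      by (simp add: power_inverse)
  qed
  also have "\<dots> = scale C (of_nat n) e" by (simp add: vs.sum_constant_scale)
  finally show "e \<cdot> e = e" using n by simp
qed

text \<open>
  Some eigenprojection of the twist is not zero. It splits in the category, and its image is a subobject of
  \<open>(W, \<gamma>)\<close> in the center, hence all of it by simplicity. So the twist is the corresponding eigenvalue.
\<close>

lemma twist_of_center_simple:
  assumes simple: "simple_object (drinfeld_center C) (W, \<gamma>)" and n: "n \<ge> 1"
    and tn: "power_arrow W (twist_arrow (drinfeld_center C) (W, \<gamma>)) n = ide C W"
  shows "twist (drinfeld_center C) (W, \<gamma>) ^ n = 1"
proof -
  let ?t = "twist_arrow (drinfeld_center C) (W, \<gamma>)"
  note hb = center_simple_nonzero(1)[OF simple] and W0 = center_simple_nonzero(2)[OF simple]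
  note W = half_braidingD(1)[OF hb] and tc = central_twist[OF hb]
  note t = central_hom[OF tc]
  obtain s where s: "s ^ n = 1" and ne: "(\<Sum>k<n. scale C (s ^ k) (power_arrow W ?t k)) \<noteq> 0"
    by (rule eigenprojection_exists[OF W W0 t n tn])
  define e where "e = scale C (1 / of_nat n) (\<Sum>k<n. scale C (s ^ k) (power_arrow W ?t k))"
  note e = eigenprojection[OF W t n tn s, folded e_def]
  have ec: "central W \<gamma> W \<gamma> e"
    unfolding e_def using n by (intro central_scale[OF hb hb] central_sum[OF hb hb] central_power[OF hb tc]) (auto simp: lessThan_empty_iff)
  have e0: "e \<noteq> 0" using ne n by (simp add: e_def)
  obtain K k r where K: "K \<in> Obj C" and k: "k \<in> Hom C K W" and r: "r \<in> Hom C W K" and kr: "k \<cdot> r = e" and rk: "r \<cdot> k = ide C K"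
    by (rule split_idempotent[OF W e(1,3)])
  obtain \<delta> where \<delta>: "half_braiding C K \<delta>" "central K \<delta> W \<gamma> k"
    using retract_half_braiding[OF hb K k r rk] ec kr by auto
  have "mono_arrow (drinfeld_center C) (K, \<delta>) (W, \<gamma>) k"
    unfolding mono_arrow_def
  proof (intro conjI ballI impI)
    show "k \<in> Hom (drinfeld_center C) (K, \<delta>) (W, \<gamma>)" using \<delta>(2) by simp
    fix D g h assume D: "D \<in> Obj (drinfeld_center C)" and g: "g \<in> Hom (drinfeld_center C) D (K, \<delta>)" and h: "h \<in> Hom (drinfeld_center C) D (K, \<delta>)"
      and eq: "k \<cdot>\<^bsub>drinfeld_center C\<^esub> g = k \<cdot>\<^bsub>drinfeld_center C\<^esub> h"
    obtain V \<alpha> where V: "D = (V, \<alpha>)" by (cases D)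
    have V': "V \<in> Obj C" using D V half_braidingD(1) by auto
    have gh: "g \<in> Hom C V K" "h \<in> Hom C V K" using g h V central_hom by auto
    have cancel: "x = r \<cdot> (k \<cdot> x)" if "x \<in> Hom C V K" for x
      using comp_assoc[OF V' K W K that k r] rk ide_left[OF V' K that] by simp
    show "g = h" using cancel[OF gh(1)] cancel[OF gh(2)] eq by simp
  qed
  moreover have "(K, \<delta>) \<in> Obj (drinfeld_center C)" using \<delta>(1) by simp
  ultimately have "zero_object (drinfeld_center C) (K, \<delta>) \<or> iso_arrow (drinfeld_center C) (K, \<delta>) (W, \<gamma>) k"
    using simple unfolding simple_object_def by blast
  moreover have "\<not> zero_object (drinfeld_center C) (K, \<delta>)"
  proof
    assume "zero_object (drinfeld_center C) (K, \<delta>)"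
    then have "Hom (drinfeld_center C) (K, \<delta>) (W, \<gamma>) = {0}" using hb by (simp add: zero_object_def)
    moreover have "k \<in> Hom (drinfeld_center C) (K, \<delta>) (W, \<gamma>)" using \<delta>(2) by simp
    ultimately have "k = 0" by blast
    then show False using kr e0 comp_zero_left[OF W K W r] by simp
  qed
  ultimately obtain k' where "inverse_arrows (drinfeld_center C) (K, \<delta>) (W, \<gamma>) k k'"
    by (auto simp: iso_arrow_def)
  then have k': "k' \<in> Hom C W K" "k \<cdot> k' = ide C W"
    by (auto simp: inverse_arrows_def dest: central_hom)
  have "e \<cdot> k = k" using comp_assoc[OF K W K W k r k] kr rk ide_right[OF K W k] by simp
  then have "e = ide C W"
    using comp_assoc[OF W K W W k'(1) k e(1)] k'(2) ide_right[OF W W e(1)] by simp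
  then have scalar: "?t = scale C (inverse s) (ide C W)"
    using e(2) ide_right[OF W W t] by simp
  have "twist (drinfeld_center C) (W, \<gamma>) = inverse s"
    unfolding twist_def using scalar W0 by (intro the_equality) simp_all
  then show ?thesis using s by (simp add: power_inverse)
qed

end

theorem proposition3p11:
  fixes C :: "('o, 'm::ab_group_add) pivotal_cat"
    and Io :: "'o \<Rightarrow> 'o \<times> ('o \<Rightarrow> 'm)"
    and Ia :: "'o \<Rightarrow> 'o \<Rightarrow> 'm \<Rightarrow> 'm"
    and \<Phi> :: "'o \<Rightarrow> 'o \<times> ('o \<Rightarrow> 'm) \<Rightarrow> 'm \<Rightarrow> 'm"
    and X :: 'o and n :: nat and Y :: "'o \<times> ('o \<Rightarrow> 'm)"
  assumes "spherical_fusion_category C"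
    and "adjunction C (drinfeld_center C) Io Ia forget_obj forget_arrow \<Phi>"
    and "simple_object C X"
    and "n \<ge> 1"
    and "isomorphic C (tensor_power C X n) (unit_obj C)"
    and "\<exists>Z. simple_object C Z \<and>
           (isomorphic C (tensor C X Z) Z \<or> isomorphic C (tensor C Z X) Z)"
    and "simple_object (drinfeld_center C) Y"
    and "subobject (drinfeld_center C) Y (Io X)"
  shows "twist (drinfeld_center C) Y ^ n = 1"
proof -
  interpret C: spherical_fusion_category C by (rule assms(1))
  interpret I: adjunction C "drinfeld_center C" Io Ia forget_obj forget_arrow \<Phi> by (rule assms(2))
  let ?Z = "drinfeld_center C"
  obtain Z where Z: "simple_object C Z" "isomorphic C (tensor C X Z) Z \<or> isomorphic C (tensor C Z X) Z"
    using assms(6) by blast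
  note X = C.simple_objectD(1)[OF assms(3)]
  obtain W \<delta> where W: "Io X = (W, \<delta>)" by (cases "Io X")
  obtain V \<gamma> where V: "Y = (V, \<gamma>)" by (cases Y)
  have hW: "half_braiding C W \<delta>" using I.L.obj[OF X] W by simp
  have hV: "half_braiding C V \<gamma>" using C.center_simple_nonzero(1)[of V \<gamma>] assms(7) V by simp
  let ?w = "twist_arrow ?Z (W, \<delta>)" and ?v = "twist_arrow ?Z (V, \<gamma>)"
  let ?g = "C.power_arrow W ?w n"
  note wo = C.half_braidingD(1)[OF hW] and vo = C.half_braidingD(1)[OF hV]
  have g: "C.central W \<delta> W \<delta> ?g" by (rule C.central_power[OF hW C.central_twist[OF hW]])
  have ide: "C.central W \<delta> W \<delta> (ide C W)" by (rule C.central_ide[OF hW])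
  \<comment> \<open>The unit of the adjunction at \<open>X\<close>. An arrow out of \<open>I(X)\<close> is determined by its composite with it.\<close>
  define \<eta> where "\<eta> = \<Phi> X (W, \<delta>) (ide C W)"
  have bij: "bij_betw (\<Phi> X (W, \<delta>)) (Hom ?Z (W, \<delta>) (W, \<delta>)) (Hom C X W)"
    using I.bij[OF X, of "(W, \<delta>)"] hW W by (simp add: forget_obj_def)
  have \<eta>: "\<eta> \<in> Hom C X W"
    unfolding \<eta>_def using bij ide by (auto simp: bij_betw_def)
  have "\<Phi> X (W, \<delta>) (Comp C ?g (ide C W)) = Comp C ?g \<eta>"
    unfolding \<eta>_def using I.natural_right[OF X, of "(W, \<delta>)" "(W, \<delta>)" ?g "ide C W"] hW W g ide
    by (simp add: forget_arrow_def)
  also have "\<dots> = \<eta>"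
    by (rule C.twist_power_fixes[OF assms(3,4,5) Z hW \<eta>])
  finally have "\<Phi> X (W, \<delta>) ?g = \<Phi> X (W, \<delta>) (ide C W)"
    using C.ide_right[OF wo wo C.central_hom[OF g]] by (simp add: \<eta>_def)
  then have g1: "?g = ide C W"
    using bij g ide unfolding bij_betw_def by (auto dest: inj_onD)
  obtain i where i: "mono_arrow ?Z (V, \<gamma>) (W, \<delta>) i"
    using assms(8) V W by (auto simp: subobject_def)
  then have ic: "C.central V \<gamma> W \<delta> i" by (simp add: mono_arrow_def)
  let ?h = "C.power_arrow V ?v n"
  have h: "C.central V \<gamma> V \<gamma> ?h" by (rule C.central_power[OF hV C.central_twist[OF hV]])
  have "Comp C i ?h = Comp C i (ide C V)"
    using C.twist_power_natural[OF hV hW ic, of n] g1 C.ide_left[OF vo wo C.central_hom[OF ic]]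
      C.ide_right[OF vo wo C.central_hom[OF ic]] by simp
  \<comment> \<open>The monomorphism \<open>i\<close> of the center can only be cancelled against arrows of the center.\<close>
  then have ih: "Comp ?Z i ?h = Comp ?Z i (ide C V)" by simp
  have "(V, \<gamma>) \<in> Obj ?Z" "?h \<in> Hom ?Z (V, \<gamma>) (V, \<gamma>)" "ide C V \<in> Hom ?Z (V, \<gamma>) (V, \<gamma>)"
    using hV h C.central_ide[OF hV] by simp_all
  then have "?h = ide C V"
    using i ih unfolding mono_arrow_def by blast
  then show ?thesis
    using C.twist_of_center_simple[of V \<gamma> n] assms(4,7) V by simp
qed

end
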